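(* Let $(\mathcal Z,\mathcal I)$ be the twistor space of a tree-level q-map space $(\overline N,g_{\overline N})$ and let $\lambda\in\Omega^1(\mathcal Z,\mathcal L)$ be the holomorphic $1$-form valued in $\mathcal L$ defining the holomorphic contact structure of $(\mathcal Z,\mathcal I)$. Then on the open subset $\mathcal Z_0:=\overline N\times(\mathbb CP^1-\{0,\infty\})\subset\mathcal Z\cong\overline N\times\mathbb CP^1$ we can write $$\lambda=\frac1{8i}\big(d\alpha+\langle\xi,d\xi\rangle\big)\cdot s=\frac1{8i}\big(d\alpha+\widetilde\xi_id\xi^i-\xi^id\widetilde\xi_i\big)\cdot s,$$ where $$\xi^i=\zeta^i-\frac{i\tau_2}2(t^{-1}z^i+t\overline z^i),\quad\widetilde\xi_i=\widetilde\zeta_i-\frac{i\tau_2}2(t^{-1}F_i+t\overline F_i),\quad\alpha=\sigma-\frac{i\tau_2}2\big(t^{-1}\langle\widetilde Z,\zeta\rangle+t\langle\overline{\widetilde Z},\zeta\rangle\big),$$ and $s$ is the holomorphic section of $\mathcal L\to\mathcal Z$ induced by the function $zw$. In particular, $(\xi^i,\widetilde\xi_i,\alpha)$ are holomorphic coordinates on $(\mathcal Z,\mathcal I)$.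
   Context: Conventions: indices $a,b,c,\dots$ run from $1$ to $n$ ($n\ge1$), indices $i,j,k,\dots$ from $0$ to $n$ (an $i$ in front of $\tau_2$, or multiplying a complex quantity, is $\sqrt{-1}$); repeated indices are summed. $\langle v,w\rangle=v_iw^i-v^iw_i$ for $v=(v_i,v^i)$, $w=(w_i,w^i)$; $\zeta=(\widetilde\zeta_i,\zeta^i)$, $\xi=(\widetilde\xi_i,\xi^i)$. PSR manifold: let $h(t)=\frac16 k_{abc}t^at^bt^c$ ($k_{abc}\in\mathbb R$ symmetric) be a homogeneous cubic polynomial on $\mathbb R^n$. A projective special real (PSR) manifold is a hypersurface $\mathcal H\subset\{h=1\}$ such that $-\partial^2h|_{T\mathcal H\times T\mathcal H}$ is a Riemannian metric. Tree-level q-map space: put $U=\mathbb R_{>0}\cdot\mathcal H\subset\mathbb R^n$, $\overline M=\mathbb R^n+iU\subset\mathbb C^n$ with coordinates $z^a=b^a+it^a$, $z^0:=1$, $K=8h(t)$ with $t=(t^a)$, $\mathcal K=-\log K$, $g_{\overline M}=\frac{\partial^2\mathcal K}{\partial z^a\partial\overline z^b}dz^ad\overline z^b$. Let $\mathfrak F(X)=-h(X^1,\dots,X^n)/X^0$, $F_i=\partial_{X^i}\mathfrak F(1,z)$, $\widetilde Z=(F_i,z^i)$, $\tau_{ij}=\partial_{X^i}\partial_{X^j}\mathfrak F(1,z)$, $N_{ij}=-2\,\mathrm{Im}\,\tau_{ij}$, $W_i=d\widetilde\zeta_i-\tau_{ij}d\zeta^j$. Then $\overline N=\overline M\times\mathbb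 R_{>0}\times\mathbb R^{2n+2}\times\mathbb R$ with coordinates $(z^a,\rho,\widetilde\zeta_i,\zeta^i,\sigma)$ and $g_{\overline N}=g_{\overline M}+\frac{d\rho^2}{4\rho^2}-\frac1{4\rho}(N^{ij}-\frac2Kz^i\overline z^j)W_i\overline W_j+\frac1{64\rho^2}(d\sigma+\widetilde\zeta_id\zeta^i-\zeta^id\widetilde\zeta_i)^2$. Put $\tau_2:=\sqrt{2\rho/h(t^a)}$. Twistor space (via the HK/QK correspondence). Let $M=\{(Z^0,\dots,Z^n)=Z^0\cdot(1,z)\mid Z^0\in\mathbb C^\times,z\in\overline M\}$ with $g_M=-\mathrm{Im}(\partial_i\partial_j\mathfrak F)dZ^id\overline Z^j$, complex structure $J$, Euler field $\xi_M$, $r^2=g_M(\xi_M,\xi_M)>0$, $\widetilde\eta=r^{-2}g_M(J\xi_M,\cdot)$. Let $P=M\times\mathbb R^{2n+2}\times\mathbb R$ with coordinates $(Z^i,\widetilde\zeta_i',\zeta'^i,\sigma')$, $\zeta'=(\widetilde\zeta_i',\zeta'^i)$, and let $Z'=(-\partial_{Z^i}\mathfrak F(Z),Z^i)$, $f=2\pi r^2$, $\theta_+^P=-\langle Z',d\zeta'\rangle$, $\theta_-^P=-\langle\overline{Z'},d\zeta'\rangle$, $\theta_3^P=d\sigma'-\frac1{4\pi}\langle\zeta',d\zeta'\rangle+\pi r^2\widetilde\eta$. Let $V_3=2(iZ^i\partial_{Z^i}-i\overline Z^i\partial_{\overline Z^i})$. On $\widetilde N=\mathbb H^\times\times P$ with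 complex coordinates $z=q_0+iq_3$, $w=q_1+iq_2$ on $\mathbb H^\times\ni q_0+q_1i+q_2j+q_3k$, put $V_3^L=iz\partial_z-i\overline z\partial_{\overline z}-iw\partial_w+i\overline w\partial_{\overline w}-V_3$ and $$\widetilde\lambda=\tfrac\pi4\big(f(z\,dw-w\,dz)+z^2\theta_+^P+w^2\theta_-^P-2izw\,\theta_3^P\big).$$ $\hat N$ is the space of integral curves of $V_3^L$; $\widetilde\lambda$ descends to a $1$-form $\hat\lambda$ on $\hat N$. $\hat N$ is the HK cone (Swann bundle) of $\overline N$; $d\hat\lambda$ is (a constant multiple of) its holomorphic symplectic form for the complex structure $\hat I_3$, so that $\hat I_3$ is the complex structure whose $(0,1)$-space is the kernel of $d\hat\lambda$. The $\mathbb C^\times$-action $(z,w)\mapsto(xz,xw)$ descends to an $\hat I_3$-holomorphic action on $\hat N$ and $(\mathcal Z,\mathcal I)=(\hat N,\hat I_3)/\mathbb C^\times$. $\mathcal L=\hat N\times_{\mathbb C^\times}\mathbb C$ is the holomorphic line bundle associated with $x\cdot y=x^2y$, whose sections are functions on $\hat N$ homogeneous of degree $2$; $\lambda$ is the $\mathcal L$-valued $1$-form induced by $\hat\lambda$ and $s$ the section induced by the $V_3^L$-invariant function $zw$. Identification $\mathcal Z\cong\overline N\times\mathbb CP^1$: represent points by points of $\widetilde N$ with $\mathrm{Arg}(Z^0)=0$; the $\mathbb CP^1$-coordinate is $t:=w/z$ (in the formulas of the claim, $t$ denotes this coordinate) and the point of $\overline N$ is given by $z^a=Z^a/Z^0$,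 $\rho=\frac\pi4f$, $\sigma=4\pi\sigma'$, $\zeta^i=-\zeta'^i$, $\widetilde\zeta_i=\widetilde\zeta_i'$. *)

theory Defs
  imports "HOL-Analysis.Analysis"
begin

text \<open>
  The indices \<open>a, b, c = 1, \<dots>, n\<close> range over a finite type \<open>'n\<close>; the indices \<open>i, j = 0, \<dots>, n\<close> range
  over \<open>'n option\<close>, with \<open>None\<close> for \<open>0\<close>. All the spaces below that are not quotients are subsets of
  real vector spaces, with the vector space itself as tangent space at each point. Complex-valued
  1-forms are functions of a point and a tangent vector. A Hermitian expression
  \<open>g\<^sub>i\<^sub>j \<alpha>\<^sup>i \<beta>\<^sup>j\<close> in complex 1-forms \<open>\<alpha>\<^sup>i\<close> and conjugates \<open>\<beta>\<^sup>j\<close> of such stands for the symmetric product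
  (i.e. for the real part of the tensor product).
\<close>

section \<open>Differential calculus\<close>

abbreviation D :: "('a::real_normed_vector \<Rightarrow> 'b::real_normed_vector) \<Rightarrow> 'a \<Rightarrow> 'a \<Rightarrow> 'b" where
  "D f p \<equiv> frechet_derivative f (at p)"

definition ext_deriv ::
    "('a::real_normed_vector \<Rightarrow> 'a \<Rightarrow> complex) \<Rightarrow> 'a \<Rightarrow> 'a \<Rightarrow> 'a \<Rightarrow> complex" where
  "ext_deriv \<omega> p u v = D (\<lambda>x. \<omega> x v) p u - D (\<lambda>x. \<omega> x u) p v"

definition cpartial :: "'m::finite \<Rightarrow> (complex^'m \<Rightarrow> complex) \<Rightarrow> complex^'m \<Rightarrow> complex" where
  "cpartial i \<Phi> X = deriv (\<lambda>x. \<Phi> (X + axis i x)) 0"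

definition wirtinger :: "'m::finite \<Rightarrow> (complex^'m \<Rightarrow> complex) \<Rightarrow> complex^'m \<Rightarrow> complex" where
  "wirtinger a \<phi> z = (D \<phi> z (axis a 1) - \<i> * D \<phi> z (axis a \<i>)) / 2"

definition wirtinger_bar :: "'m::finite \<Rightarrow> (complex^'m \<Rightarrow> complex) \<Rightarrow> complex^'m \<Rightarrow> complex" where
  "wirtinger_bar a \<phi> z = (D \<phi> z (axis a 1) + \<i> * D \<phi> z (axis a \<i>)) / 2"

definition cvec :: "real^'m \<Rightarrow> complex^'m" where
  "cvec x = (\<chi> i. complex_of_real (x $ i))"

definition cnjvec :: "complex^'m \<Rightarrow> complex^'m" where
  "cnjvec x = (\<chi> i. cnj (x $ i))"

definition pairing ::
    "(complex^'m::finite) \<times> (complex^'m) \<Rightarrow> (complex^'m) \<times> (complex^'m) \<Rightarrow> complex" where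
  "pairing v w = (\<Sum>i\<in>UNIV. fst v $ i * snd w $ i - snd v $ i * fst w $ i)"

text \<open>Each curve below is defined on the whole real line; the field \<open>V3L\<close> is complete, so that its maximal
  integral curves are all of this kind. Curves are taken up to parametrization.\<close>

definition integral_curves :: "('a::real_normed_vector \<Rightarrow> 'a) \<Rightarrow> 'a set \<Rightarrow> 'a set set" where
  "integral_curves V S =
     {range \<gamma> |\<gamma>. \<forall>s. \<gamma> s \<in> S \<and> (\<gamma> has_vector_derivative V (\<gamma> s)) (at s)}"


section \<open>Projective special real manifolds\<close>

definition cubic :: "('n::finite \<Rightarrow> 'n \<Rightarrow> 'n \<Rightarrow> real) \<Rightarrow> 'a::real_normed_field^'n \<Rightarrow> 'a" where
  "cubic k t = (\<Sum>a\<in>UNIV. \<Sum>b\<in>UNIV. \<Sum>c\<in>UNIV. of_real (k a b c) * t $ a * t $ b * t $ c) / 6"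

text \<open>\<open>C\<^sup>1\<close> is enough: an embedded \<open>C\<^sup>1\<close> hypersurface contained in the regular level set \<open>{h = 1}\<close> is
  open in it, hence smooth.\<close>

definition hypersurface :: "(real^'n::finite) set \<Rightarrow> bool" where
  "hypersurface S \<longleftrightarrow>
     (\<forall>p\<in>S. \<exists>V g G. open V \<and> p \<in> V \<and>
        (\<forall>x\<in>V. (g has_derivative (\<lambda>v. G x \<bullet> v)) (at x) \<and> G x \<noteq> 0) \<and>
        continuous_on V G \<and> S \<inter> V = {x \<in> V. g x = (0::real)})"

definition tangent_vectors :: "(real^'n::finite) set \<Rightarrow> real^'n \<Rightarrow> (real^'n) set" where
  "tangent_vectors S p =
     {v. \<exists>\<gamma>. \<gamma> 0 = p \<and> (\<forall>s. \<gamma> s \<in> S) \<and> (\<gamma> has_vector_derivative v) (at 0)}"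

definition PSR_manifold :: "('n::finite \<Rightarrow> 'n \<Rightarrow> 'n \<Rightarrow> real) \<Rightarrow> (real^'n) set \<Rightarrow> bool" where
  "PSR_manifold k H \<longleftrightarrow>
     (\<forall>a b c. k a b c = k b a c \<and> k a b c = k a c b) \<and>
     H \<subseteq> {t. cubic k t = 1} \<and> hypersurface H \<and>
     (\<forall>p\<in>H. \<forall>v\<in>tangent_vectors H p. v \<noteq> 0 \<longrightarrow> - D (\<lambda>x. D (cubic k) x v) p v > 0)"


section \<open>Tree-level q-map spaces\<close>

text \<open>Points \<open>(z\<^sup>a, \<rho>, \<zeta>\<^sub>i with tilde, \<zeta>\<^sup>i, \<sigma>)\<close>.\<close>

type_synonym 'n qpoint =
  "(complex^'n) \<times> real \<times> (real^('n option)) \<times> (real^('n option)) \<times> real"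

definition cone :: "(real^'n::finite) set \<Rightarrow> (real^'n) set" where
  "cone H = {s *\<^sub>R p |s p. s > 0 \<and> p \<in> H}"

definition Mbar :: "(real^'n::finite) set \<Rightarrow> (complex^'n) set" where
  "Mbar H = {z. (\<chi> a. Im (z $ a)) \<in> cone H}"

definition himag :: "('n::finite \<Rightarrow> 'n \<Rightarrow> 'n \<Rightarrow> real) \<Rightarrow> complex^'n \<Rightarrow> real" where
  "himag k z = cubic k (\<chi> a. Im (z $ a))"

definition prepot :: "('n::finite \<Rightarrow> 'n \<Rightarrow> 'n \<Rightarrow> real) \<Rightarrow> complex^('n option) \<Rightarrow> complex" where
  "prepot k X = - cubic k (\<chi> a. X $ Some a) / X $ None"

definition dprepot ::
    "('n::finite \<Rightarrow> 'n \<Rightarrow> 'n \<Rightarrow> real) \<Rightarrow> complex^('n option) \<Rightarrow> complex^('n option)" where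
  "dprepot k X = (\<chi> i. cpartial i (prepot k) X)"

definition tau ::
    "('n::finite \<Rightarrow> 'n \<Rightarrow> 'n \<Rightarrow> real) \<Rightarrow> complex^('n option) \<Rightarrow> 'n option \<Rightarrow> 'n option \<Rightarrow> complex" where
  "tau k X i j = cpartial i (cpartial j (prepot k)) X"

definition homog :: "complex^'n::finite \<Rightarrow> complex^('n option)" where
  "homog z = (\<chi> i. case i of None \<Rightarrow> 1 | Some a \<Rightarrow> z $ a)"

definition Ztilde ::
    "('n::finite \<Rightarrow> 'n \<Rightarrow> 'n \<Rightarrow> real) \<Rightarrow> complex^'n \<Rightarrow> (complex^('n option)) \<times> (complex^('n option))" where
  "Ztilde k z = (dprepot k (homog z), homog z)"

definition qmap_metric ::
    "('n::finite \<Rightarrow> 'n \<Rightarrow> 'n \<Rightarrow> real) \<Rightarrow> 'n qpoint \<Rightarrow> 'n qpoint \<Rightarrow> 'n qpoint \<Rightarrow> real" where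
  "qmap_metric k = (\<lambda>(z, \<rho>, \<zeta>t, \<zeta>, \<sigma>) (uz, u\<rho>, u\<zeta>t, u\<zeta>, u\<sigma>) (vz, v\<rho>, v\<zeta>t, v\<zeta>, v\<sigma>).
     let K = (\<lambda>z. 8 * himag k z);
         g = (\<lambda>a b. wirtinger a (wirtinger_bar b (\<lambda>z. complex_of_real (- ln (K z)))) z);
         N = (\<chi> i j. - 2 * Im (tau k (homog z) i j)) :: real^('n option)^('n option);
         W = (\<lambda>dt d i. complex_of_real (dt $ i)
                - (\<Sum>j\<in>UNIV. tau k (homog z) i j * complex_of_real (d $ j)));
         \<theta> = (\<lambda>d\<sigma> dt d. d\<sigma> + (\<Sum>i\<in>UNIV. \<zeta>t $ i * d $ i - \<zeta> $ i * dt $ i))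
     in Re (\<Sum>a\<in>UNIV. \<Sum>b\<in>UNIV. g a b * uz $ a * cnj (vz $ b))
        + u\<rho> * v\<rho> / (4 * \<rho>\<^sup>2)
        - 1 / (4 * \<rho>) * Re (\<Sum>i\<in>UNIV. \<Sum>j\<in>UNIV.
            (complex_of_real (matrix_inv N $ i $ j)
               - complex_of_real (2 / K z) * homog z $ i * cnj (homog z $ j))
            * W u\<zeta>t u\<zeta> i * cnj (W v\<zeta>t v\<zeta> j))
        + 1 / (64 * \<rho>\<^sup>2) * \<theta> u\<sigma> u\<zeta>t u\<zeta> * \<theta> v\<sigma> v\<zeta>t v\<zeta>)"

definition qmap_space ::
    "('n::finite \<Rightarrow> 'n \<Rightarrow> 'n \<Rightarrow> real) \<Rightarrow> (real^'n) set
      \<Rightarrow> 'n qpoint set \<Rightarrow> ('n qpoint \<Rightarrow> 'n qpoint \<Rightarrow> 'n qpoint \<Rightarrow> real) \<Rightarrow> bool" where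
  "qmap_space k H N g \<longleftrightarrow>
     PSR_manifold k H \<and>
     N = {(z, \<rho>, \<zeta>t, \<zeta>, \<sigma>). z \<in> Mbar H \<and> \<rho> > 0} \<and>
     (\<forall>p\<in>N. g p = qmap_metric k p)"


section \<open>The conical special Kaehler manifold M\<close>

definition csk :: "(real^'n::finite) set \<Rightarrow> (complex^('n option)) set" where
  "csk H = {Z0 *s homog z |Z0 z. Z0 \<noteq> 0 \<and> z \<in> Mbar H}"

definition gM ::
    "('n::finite \<Rightarrow> 'n \<Rightarrow> 'n \<Rightarrow> real)
      \<Rightarrow> complex^('n option) \<Rightarrow> complex^('n option) \<Rightarrow> complex^('n option) \<Rightarrow> real" where
  "gM k Z u v =
     Re (\<Sum>i\<in>UNIV. \<Sum>j\<in>UNIV. complex_of_real (- Im (tau k Z i j)) * u $ i * cnj (v $ j))"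

text \<open>The real vector field \<open>Z\<^sup>i \<partial>/\<partial>Z\<^sup>i + c.c.\<close> has the value \<open>Z\<close> at the point \<open>Z\<close>.\<close>

definition euler :: "complex^('n::finite option) \<Rightarrow> complex^('n option)" where
  "euler Z = Z"

definition rsq :: "('n::finite \<Rightarrow> 'n \<Rightarrow> 'n \<Rightarrow> real) \<Rightarrow> complex^('n option) \<Rightarrow> real" where
  "rsq k Z = gM k Z (euler Z) (euler Z)"

definition eta ::
    "('n::finite \<Rightarrow> 'n \<Rightarrow> 'n \<Rightarrow> real) \<Rightarrow> complex^('n option) \<Rightarrow> complex^('n option) \<Rightarrow> real" where
  "eta k Z u = gM k Z (\<i> *s euler Z) u / rsq k Z"

definition fM :: "('n::finite \<Rightarrow> 'n \<Rightarrow> 'n \<Rightarrow> real) \<Rightarrow> complex^('n option) \<Rightarrow> real" where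
  "fM k Z = 2 * pi * rsq k Z"


section \<open>The space of integral curves and the twistor space\<close>

text \<open>Points \<open>(z, w, Z\<^sup>i, \<zeta>'\<^sub>i with tilde, \<zeta>'\<^sup>i, \<sigma>')\<close>.\<close>

type_synonym 'n npoint =
  "complex \<times> complex \<times> (complex^('n option)) \<times> (real^('n option)) \<times> (real^('n option)) \<times> real"

definition Ntilde :: "(real^'n::finite) set \<Rightarrow> 'n npoint set" where
  "Ntilde H = {(z, w, Z, \<zeta>t, \<zeta>, \<sigma>). (z, w) \<noteq> (0, 0) \<and> Z \<in> csk H}"

text \<open>A real vector field \<open>X\<^sup>\<mu> \<partial>/\<partial>x\<^sup>\<mu> + c.c.\<close> in complex coordinates \<open>x\<^sup>\<mu>\<close> has the components \<open>X\<^sup>\<mu>\<close>.\<close>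

definition V3 :: "complex^('n::finite option) \<Rightarrow> complex^('n option)" where
  "V3 Z = (2 * \<i>) *s Z"

definition V3L :: "'n::finite npoint \<Rightarrow> 'n npoint" where
  "V3L = (\<lambda>(z, w, Z, \<zeta>t, \<zeta>, \<sigma>). (\<i> * z, - \<i> * w, - V3 Z, 0, 0, 0))"

definition theta_plus ::
    "('n::finite \<Rightarrow> 'n \<Rightarrow> 'n \<Rightarrow> real) \<Rightarrow> 'n npoint \<Rightarrow> 'n npoint \<Rightarrow> complex" where
  "theta_plus k = (\<lambda>(z, w, Z, \<zeta>t, \<zeta>, \<sigma>) (dz, dw, dZ, d\<zeta>t, d\<zeta>, d\<sigma>).
     - pairing (- dprepot k Z, Z) (cvec d\<zeta>t, cvec d\<zeta>))"

definition theta_minus ::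
    "('n::finite \<Rightarrow> 'n \<Rightarrow> 'n \<Rightarrow> real) \<Rightarrow> 'n npoint \<Rightarrow> 'n npoint \<Rightarrow> complex" where
  "theta_minus k = (\<lambda>(z, w, Z, \<zeta>t, \<zeta>, \<sigma>) (dz, dw, dZ, d\<zeta>t, d\<zeta>, d\<sigma>).
     - pairing (cnjvec (- dprepot k Z), cnjvec Z) (cvec d\<zeta>t, cvec d\<zeta>))"

definition theta_3 ::
    "('n::finite \<Rightarrow> 'n \<Rightarrow> 'n \<Rightarrow> real) \<Rightarrow> 'n npoint \<Rightarrow> 'n npoint \<Rightarrow> complex" where
  "theta_3 k = (\<lambda>(z, w, Z, \<zeta>t, \<zeta>, \<sigma>) (dz, dw, dZ, d\<zeta>t, d\<zeta>, d\<sigma>).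
     complex_of_real d\<sigma>
     - 1 / (4 * complex_of_real pi) * pairing (cvec \<zeta>t, cvec \<zeta>) (cvec d\<zeta>t, cvec d\<zeta>)
     + complex_of_real (pi * rsq k Z * eta k Z dZ))"

definition lambda_tilde ::
    "('n::finite \<Rightarrow> 'n \<Rightarrow> 'n \<Rightarrow> real) \<Rightarrow> 'n npoint \<Rightarrow> 'n npoint \<Rightarrow> complex" where
  "lambda_tilde k p v =
     (case p of (z, w, Z, \<zeta>t, \<zeta>, \<sigma>) \<Rightarrow> case v of (dz, dw, dZ, d\<zeta>t, d\<zeta>, d\<sigma>) \<Rightarrow>
        complex_of_real (pi / 4) *
          (complex_of_real (fM k Z) * (z * dw - w * dz)
           + z\<^sup>2 * theta_plus k p v + w\<^sup>2 * theta_minus k p v - 2 * \<i> * z * w * theta_3 k p v))"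

definition Nhat :: "(real^'n::finite) set \<Rightarrow> 'n npoint set set" where
  "Nhat H = integral_curves V3L (Ntilde H)"

definition curve_through :: "(real^'n::finite) set \<Rightarrow> 'n npoint \<Rightarrow> 'n npoint set" where
  "curve_through H q = the_elem {c \<in> Nhat H. q \<in> c}"

text \<open>The action of \<open>x\<close> on \<open>Nhat H\<close> is \<open>c \<mapsto> act x ` c\<close>.\<close>

definition act :: "complex \<Rightarrow> 'n::finite npoint \<Rightarrow> 'n npoint" where
  "act x = (\<lambda>(z, w, p). (x * z, x * w, p))"

definition twistor_space :: "(real^'n::finite) set \<Rightarrow> 'n npoint set set set" where
  "twistor_space H = {{act x ` c |x. x \<noteq> 0} |c. c \<in> Nhat H}"

definition twistor_class :: "(real^'n::finite) set \<Rightarrow> 'n npoint \<Rightarrow> 'n npoint set set" where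
  "twistor_class H q = the_elem {P \<in> twistor_space H. q \<in> \<Union>P}"


section \<open>The line bundle L\<close>

text \<open>The element \<open>[c, y]\<close> of \<open>Nhat \<times>\<^bsub>\<complex>\<^sup>\<times>\<^esub> \<complex>\<close> is the set of the pairs \<open>(x \<cdot> c, x\<^sup>2 y)\<close>. A function \<open>\<phi>\<close> on \<open>Nhat\<close> that
  is homogeneous of degree 2 thus gives the section whose value is \<open>[c, \<phi>(c)]\<close>. Functions
  and forms on \<open>Nhat\<close> are represented by their pullbacks to \<open>Ntilde\<close>. The sets under \<open>the_elem\<close> below are
  singletons precisely if the form or function in question descends.\<close>

definition L_elem :: "'n::finite npoint set \<Rightarrow> complex \<Rightarrow> ('n npoint set \<times> complex) set" where
  "L_elem c y = {(act x ` c, x\<^sup>2 * y) |x. x \<noteq> 0}"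

definition L_scale ::
    "complex \<Rightarrow> ('n::finite npoint set \<times> complex) set \<Rightarrow> ('n npoint set \<times> complex) set" where
  "L_scale a l = (\<lambda>(c, y). (c, a * y)) ` l"

definition L_section ::
    "(real^'n::finite) set \<Rightarrow> ('n npoint \<Rightarrow> complex) \<Rightarrow> 'n npoint set set \<Rightarrow> ('n npoint set \<times> complex) set" where
  "L_section H \<phi> P = the_elem {L_elem (curve_through H q) (\<phi> q) |q. q \<in> \<Union>P}"

definition zw_fun :: "'n::finite npoint \<Rightarrow> complex" where
  "zw_fun = (\<lambda>(z, w, p). z * w)"


section \<open>The identification with the product of the q-map space and the projective line\<close>

text \<open>\<open>twistor_space_0\<close> is the locus \<open>t \<noteq> 0, \<infinity>\<close> of the coordinate \<open>t = w/z\<close> on the projective line.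
  Its points have coordinates \<open>(p, t)\<close> with \<open>p\<close> in the q-map space and \<open>t \<noteq> 0\<close> complex; tangent
  vectors of the twistor space at such points are given in these coordinates.\<close>

type_synonym 'n tpoint = "'n qpoint \<times> complex"

definition twistor_space_0 :: "(real^'n::finite) set \<Rightarrow> 'n npoint set set set" where
  "twistor_space_0 H =
     {P \<in> twistor_space H. \<forall>(z, w, p) \<in> \<Union>P. z \<noteq> 0 \<and> w \<noteq> 0}"

definition slice :: "(real^'n::finite) set \<Rightarrow> 'n npoint set" where
  "slice H = {(z, w, Z, \<zeta>t, \<zeta>, \<sigma>) \<in> Ntilde H. Im (Z $ None) = 0 \<and> Re (Z $ None) > 0}"

definition slice_coords ::
    "('n::finite \<Rightarrow> 'n \<Rightarrow> 'n \<Rightarrow> real) \<Rightarrow> 'n npoint \<Rightarrow> 'n tpoint" where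
  "slice_coords k = (\<lambda>(z, w, Z, \<zeta>t, \<zeta>, \<sigma>).
     (((\<chi> a. Z $ Some a / Z $ None), pi / 4 * fM k Z, \<zeta>t, - \<zeta>, 4 * pi * \<sigma>), w / z))"

definition twistor_coords ::
    "('n::finite \<Rightarrow> 'n \<Rightarrow> 'n \<Rightarrow> real) \<Rightarrow> (real^'n) set \<Rightarrow> 'n npoint set set \<Rightarrow> 'n tpoint" where
  "twistor_coords k H P = the_elem (slice_coords k ` (slice H \<inter> \<Union>P))"

text \<open>The projection of \<open>Ntilde\<close> to the twistor space, in coordinates.\<close>

definition proj ::
    "('n::finite \<Rightarrow> 'n \<Rightarrow> 'n \<Rightarrow> real) \<Rightarrow> (real^'n) set \<Rightarrow> 'n npoint \<Rightarrow> 'n tpoint" where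
  "proj k H q = twistor_coords k H (twistor_class H q)"

text \<open>The value of the \<open>L\<close>-valued 1-form \<open>\<lambda>\<close> at \<open>P\<close> on the tangent vector \<open>v\<close>; here \<open>u\<close> runs through
  the lifts of \<open>v\<close>.\<close>

definition contact_form ::
    "('n::finite \<Rightarrow> 'n \<Rightarrow> 'n \<Rightarrow> real) \<Rightarrow> (real^'n) set
      \<Rightarrow> 'n npoint set set \<Rightarrow> 'n tpoint \<Rightarrow> ('n npoint set \<times> complex) set" where
  "contact_form k H P v =
     the_elem {L_elem (curve_through H q) (lambda_tilde k q u) |q u. q \<in> \<Union>P \<and> D (proj k H) q u = v}"


section \<open>The complex structure\<close>

text \<open>A complexified tangent vector \<open>u\<^sub>1 + i u\<^sub>2\<close> is the pair \<open>(u\<^sub>1, u\<^sub>2)\<close>. The kernel of the exterior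
  derivative of \<open>lambda_tilde\<close> is the preimage in the complexified tangent space of \<open>Ntilde\<close> of
  the (0,1)-space of \<open>Nhat\<close>.\<close>

definition kernel_dlambda ::
    "('n::finite \<Rightarrow> 'n \<Rightarrow> 'n \<Rightarrow> real) \<Rightarrow> 'n npoint \<Rightarrow> ('n npoint \<times> 'n npoint) set" where
  "kernel_dlambda k q =
     {(u1, u2). \<forall>v. ext_deriv (lambda_tilde k) q u1 v + \<i> * ext_deriv (lambda_tilde k) q u2 v = 0}"

definition holomorphic_L_section ::
    "('n::finite \<Rightarrow> 'n \<Rightarrow> 'n \<Rightarrow> real) \<Rightarrow> (real^'n) set \<Rightarrow> ('n npoint \<Rightarrow> complex) \<Rightarrow> bool" where
  "holomorphic_L_section k H \<phi> \<longleftrightarrow>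
     (\<forall>c\<in>Nhat H. \<forall>p\<in>c. \<forall>q\<in>c. \<phi> p = \<phi> q) \<and>
     (\<forall>q\<in>Ntilde H. \<forall>x. x \<noteq> 0 \<longrightarrow> \<phi> (act x q) = x\<^sup>2 * \<phi> q) \<and>
     (\<forall>q\<in>Ntilde H. \<phi> differentiable (at q) \<and>
        (\<forall>(u1, u2) \<in> kernel_dlambda k q. D \<phi> q u1 + \<i> * D \<phi> q u2 = 0))"

definition space_01 :: "('a::real_vector \<Rightarrow> 'a) \<Rightarrow> ('a \<times> 'a) set" where
  "space_01 J = {(u1, u2). J u1 = u2 \<and> J u2 = - u1}"

definition twistor_01 ::
    "('n::finite \<Rightarrow> 'n \<Rightarrow> 'n \<Rightarrow> real) \<Rightarrow> (real^'n) set \<Rightarrow> 'n tpoint \<Rightarrow> ('n tpoint \<times> 'n tpoint) set" where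
  "twistor_01 k H b =
     {(D (proj k H) q u1, D (proj k H) q u2) |q u1 u2.
        q \<in> \<Union>(\<Union>(twistor_space_0 H)) \<and> proj k H q = b \<and> (u1, u2) \<in> kernel_dlambda k q}"

definition twistor_J ::
    "('n::finite \<Rightarrow> 'n \<Rightarrow> 'n \<Rightarrow> real) \<Rightarrow> (real^'n) set \<Rightarrow> 'n tpoint \<Rightarrow> 'n tpoint \<Rightarrow> 'n tpoint" where
  "twistor_J k H b =
     (THE J. linear J \<and> (\<forall>v. J (J v) = - v) \<and> space_01 J = twistor_01 k H b)"

definition times_i ::
    "(complex^'m::finite) \<times> (complex^'m) \<times> complex \<Rightarrow> (complex^'m) \<times> (complex^'m) \<times> complex" where
  "times_i = (\<lambda>(x, y, a). (\<i> *s x, \<i> *s y, \<i> * a))"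

text \<open>Coordinates in the local sense: near each point of \<open>S\<close>, the map \<open>X\<close> is a biholomorphism onto an
  open set, with respect to the almost complex structure \<open>J\<close>.\<close>

definition holomorphic_coordinates ::
    "('a::real_normed_vector \<Rightarrow> 'a \<Rightarrow> 'a) \<Rightarrow> 'a set
      \<Rightarrow> ('a \<Rightarrow> (complex^'m::finite) \<times> (complex^'m) \<times> complex) \<Rightarrow> bool" where
  "holomorphic_coordinates J S X \<longleftrightarrow>
     (\<forall>b\<in>S. \<exists>W. open W \<and> b \<in> W \<and> W \<subseteq> S \<and>
        inj_on X W \<and> open (X ` W) \<and>
        X differentiable_on W \<and> inv_into W X differentiable_on (X ` W) \<and>
        (\<forall>p\<in>W. \<forall>v. D X p (J p v) = times_i (D X p v)))"


section \<open>The functions of the claim\<close>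

definition tau2 :: "('n::finite \<Rightarrow> 'n \<Rightarrow> 'n \<Rightarrow> real) \<Rightarrow> complex^'n \<Rightarrow> real \<Rightarrow> complex" where
  "tau2 k z \<rho> = complex_of_real (sqrt (2 * \<rho> / himag k z))"

definition xi ::
    "('n::finite \<Rightarrow> 'n \<Rightarrow> 'n \<Rightarrow> real) \<Rightarrow> 'n tpoint \<Rightarrow> complex^('n option)" where
  "xi k = (\<lambda>((z, \<rho>, \<zeta>t, \<zeta>, \<sigma>), t). \<chi> i. complex_of_real (\<zeta> $ i)
     - \<i> * tau2 k z \<rho> / 2 * (inverse t * homog z $ i + t * cnj (homog z $ i)))"

definition xi_tilde ::
    "('n::finite \<Rightarrow> 'n \<Rightarrow> 'n \<Rightarrow> real) \<Rightarrow> 'n tpoint \<Rightarrow> complex^('n option)" where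
  "xi_tilde k = (\<lambda>((z, \<rho>, \<zeta>t, \<zeta>, \<sigma>), t). \<chi> i. complex_of_real (\<zeta>t $ i)
     - \<i> * tau2 k z \<rho> / 2 *
         (inverse t * dprepot k (homog z) $ i + t * cnj (dprepot k (homog z) $ i)))"

definition alpha :: "('n::finite \<Rightarrow> 'n \<Rightarrow> 'n \<Rightarrow> real) \<Rightarrow> 'n tpoint \<Rightarrow> complex" where
  "alpha k = (\<lambda>((z, \<rho>, \<zeta>t, \<zeta>, \<sigma>), t). complex_of_real \<sigma>
     - \<i> * tau2 k z \<rho> / 2 *
         (inverse t * pairing (Ztilde k z) (cvec \<zeta>t, cvec \<zeta>)
          + t * pairing (map_prod cnjvec cnjvec (Ztilde k z)) (cvec \<zeta>t, cvec \<zeta>)))"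

end

theory Submission
  imports Defs
begin

text \<open>
  Lifted to the space of \<open>(z, w, Z, \<zeta>', \<sigma>')\<close>, the functions of the claim are
  \<open>\<xi> = - \<zeta>' - \<i>\<pi> (s Z + s\<inverse> cnj Z)\<close>, \<open>\<xi>~ = \<zeta>'~ - \<i>\<pi> (s F + s\<inverse> cnj F)\<close> with \<open>s = z / w\<close>, where no square root
  is left; there the formula for \<open>\<lambda>\<close> is an algebraic identity that uses only \<open>F\<^sub>i = \<tau>\<^sub>i\<^sub>j Z\<^sup>j\<close>,
  \<open>dF\<^sub>i = \<tau>\<^sub>i\<^sub>j dZ\<^sup>j\<close> and the symmetry of \<open>\<tau>\<close>.

  The real matrix \<open>Im \<tau>\<close> is nondegenerate because the Hessian of the cubic is definite on the tangent spaces of the PSR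
  manifold. Hence the imaginary parts of \<open>\<xi>, \<xi>~\<close> are local coordinates of a point of the special Kaehler cone, the
  imaginary part of \<open>\<alpha>\<close> then determines \<open>\<bar>t\<bar>\<close>, and the real parts determine \<open>\<zeta>, \<zeta>~, \<sigma>\<close>. So the differential of
  \<open>(\<xi>, \<xi>~, \<alpha>)\<close> is invertible. Since \<open>\<lambda> = zw (d\<alpha> + \<langle>\<xi>, d\<xi>\<rangle>) / 8\<i>\<close> is the standard
  homogeneous contact form in the independent functions \<open>zw, \<xi>, \<xi>~, \<alpha>\<close>, the kernel of \<open>d\<lambda>\<close> is exactly the common
  kernel of their differentials, which makes them holomorphic.
\<close>

text \<open>Two obstacles shape the proof. Points of the twistor space are sets of orbits and
  \<open>proj\<close> is built from \<open>the_elem\<close>, so it cannot be differentiated as it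
  stands. On open sets it agrees with the closed form \<open>projf\<close>, and \<open>sec\<close>
  is a section of \<open>projf\<close>; moved by the linear maps \<open>flow s\<close> and
  \<open>act x\<close>, this section passes through any given point over the locus t \<noteq> 0,
  \<infinity>. Derivatives on the twistor space are taken through these two maps. Secondly, the
  Jacobian matrix of (\<xi>, \<xi>~, \<alpha>) is never formed. Instead a vector in the kernel of
  the three differentials is fixed, and one enlarges the set of functions whose derivative in this
  direction is zero; this set is closed under algebraic operations and conjugation. The one step
  that is not algebraic, from the imaginary parts of \<xi> and \<xi>~ to a point of the cone, is
  where the nondegeneracy of Im \<tau> enters. Finally, these coordinates say nothing about the
  points with z w = 0, where the section s also has to be holomorphic; \<open>holomorphic_zw\<close>
  uses a symmetry of \<open>lambda_tilde\<close> there.\<close>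

section \<open>Twice differentiable maps\<close>

text \<open>The symmetry of the second derivative is part of the definition; it is inherited by all the constructions
  below, so that Schwarz' theorem is not needed.\<close>

definition C2 :: "'a::real_normed_vector set \<Rightarrow> ('a \<Rightarrow> 'b::real_normed_vector) \<Rightarrow> bool" where
  "C2 S f \<longleftrightarrow> (\<exists>f' f''. \<forall>x\<in>S. (f has_derivative f' x) (at x) \<and>
     (\<forall>v. ((\<lambda>y. f' y v) has_derivative (\<lambda>u. f'' x u v)) (at x)) \<and>
     (\<forall>u v. f'' x u v = f'' x v u))"

lemma C2I:
  assumes "\<And>x. x \<in> S \<Longrightarrow> (f has_derivative f' x) (at x)"
    and "\<And>x v. x \<in> S \<Longrightarrow> ((\<lambda>y. f' y v) has_derivative (\<lambda>u. f'' x u v)) (at x)"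
    and "\<And>x u v. x \<in> S \<Longrightarrow> f'' x u v = f'' x v u"
  shows "C2 S f"
  unfolding C2_def using assms by blast

lemma C2_bounded_linear: "bounded_linear f \<Longrightarrow> C2 S f"
  by (rule C2I[where f' = "\<lambda>_. f" and f'' = "\<lambda>_ _ _. 0"])
     (auto intro: bounded_linear_imp_has_derivative)

lemma C2_const [intro]: "C2 S (\<lambda>x. c)"
  by (rule C2I[where f' = "\<lambda>_ _. 0" and f'' = "\<lambda>_ _ _. 0"]) auto

lemma C2_linear_compose:
  assumes h: "bounded_linear h" and f: "C2 S f"
  shows "C2 S (\<lambda>x. h (f x))"
proof -
  obtain f' f'' where "\<forall>x\<in>S. (f has_derivative f' x) (at x) \<and>
     (\<forall>v. ((\<lambda>y. f' y v) has_derivative (\<lambda>u. f'' x u v)) (at x)) \<and>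
     (\<forall>u v. f'' x u v = f'' x v u)"
    using f unfolding C2_def by blast
  then show ?thesis
    by (intro C2I[where f' = "\<lambda>x v. h (f' x v)" and f'' = "\<lambda>x u v. h (f'' x u v)"])
       (rule bounded_linear.has_derivative[OF h], blast, rule bounded_linear.has_derivative[OF h], blast, simp)
qed

lemma C2_bilinear:
  assumes h: "bounded_bilinear h" and f: "C2 S f" and g: "C2 S g"
  shows "C2 S (\<lambda>x. h (f x) (g x))"
proof -
  obtain f' f'' where F: "\<forall>x\<in>S. (f has_derivative f' x) (at x) \<and>
     (\<forall>v. ((\<lambda>y. f' y v) has_derivative (\<lambda>u. f'' x u v)) (at x)) \<and>
     (\<forall>u v. f'' x u v = f'' x v u)"
    using f unfolding C2_def by blast
  obtain g' g'' where G: "\<forall>x\<in>S. (g has_derivative g' x) (at x) \<and>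
     (\<forall>v. ((\<lambda>y. g' y v) has_derivative (\<lambda>u. g'' x u v)) (at x)) \<and>
     (\<forall>u v. g'' x u v = g'' x v u)"
    using g unfolding C2_def by blast
  show ?thesis
  proof (rule C2I[where f' = "\<lambda>x v. h (f x) (g' x v) + h (f' x v) (g x)" and
        f'' = "\<lambda>x u v. (h (f x) (g'' x u v) + h (f' x u) (g' x v)) +
                       (h (f' x v) (g' x u) + h (f'' x u v) (g x))"])
    fix x u v assume x: "x \<in> S"
    show "((\<lambda>x. h (f x) (g x)) has_derivative (\<lambda>v. h (f x) (g' x v) + h (f' x v) (g x))) (at x)"
      using F G x by (intro bounded_bilinear.FDERIV[OF h]) auto
    show "((\<lambda>y. h (f y) (g' y v) + h (f' y v) (g y)) has_derivative
      (\<lambda>u. (h (f x) (g'' x u v) + h (f' x u) (g' x v)) +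
                       (h (f' x v) (g' x u) + h (f'' x u v) (g x)))) (at x)"
      using F G x by (intro has_derivative_add bounded_bilinear.FDERIV[OF h]) auto
    have "f'' x u v = f'' x v u" "g'' x u v = g'' x v u" using F G x by auto
    then show "(h (f x) (g'' x u v) + h (f' x u) (g' x v)) +
                       (h (f' x v) (g' x u) + h (f'' x u v) (g x)) =
              (h (f x) (g'' x v u) + h (f' x v) (g' x u)) +
                       (h (f' x u) (g' x v) + h (f'' x v u) (g x))"
      by simp
  qed
qed

lemma C2_Pair:
  assumes f: "C2 S f" and g: "C2 S g"
  shows "C2 S (\<lambda>x. (f x, g x))"
proof -
  obtain f' f'' where F: "\<forall>x\<in>S. (f has_derivative f' x) (at x) \<and>
     (\<forall>v. ((\<lambda>y. f' y v) has_derivative (\<lambda>u. f'' x u v)) (at x)) \<and>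
     (\<forall>u v. f'' x u v = f'' x v u)"
    using f unfolding C2_def by blast
  obtain g' g'' where G: "\<forall>x\<in>S. (g has_derivative g' x) (at x) \<and>
     (\<forall>v. ((\<lambda>y. g' y v) has_derivative (\<lambda>u. g'' x u v)) (at x)) \<and>
     (\<forall>u v. g'' x u v = g'' x v u)"
    using g unfolding C2_def by blast
  show ?thesis
    using F G by (intro C2I[where f' = "\<lambda>x v. (f' x v, g' x v)" and f'' = "\<lambda>x u v. (f'' x u v, g'' x u v)"])
      (rule has_derivative_Pair, blast, blast, rule has_derivative_Pair, blast, blast, simp)
qed

lemma C2_add: "C2 S f \<Longrightarrow> C2 S g \<Longrightarrow> C2 S (\<lambda>x. f x + g x)"
  using C2_linear_compose[OF bounded_linear_add[OF bounded_linear_fst bounded_linear_snd] C2_Pair, of S f g]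
  by simp

lemma C2_diff: "C2 S f \<Longrightarrow> C2 S g \<Longrightarrow> C2 S (\<lambda>x. f x - g x)"
  using C2_linear_compose[OF bounded_linear_sub[OF bounded_linear_fst bounded_linear_snd] C2_Pair, of S f g]
  by simp

lemma C2_minus: "C2 S f \<Longrightarrow> C2 S (\<lambda>x. - f x)"
  by (rule C2_linear_compose[OF bounded_linear_minus[OF bounded_linear_ident]])

lemma C2_sum: "(\<And>i. i \<in> I \<Longrightarrow> C2 S (f i)) \<Longrightarrow> C2 S (\<lambda>x. \<Sum>i\<in>I. f i x)"
  by (induction I rule: infinite_finite_induct) (auto intro: C2_add)

lemma C2_mult: "C2 S f \<Longrightarrow> C2 S g \<Longrightarrow> C2 S (\<lambda>x. f x * g x :: 'b::real_normed_algebra)"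
  by (rule C2_bilinear[OF bounded_bilinear_mult])

lemma C2_vec:
  fixes f :: "'i::finite \<Rightarrow> 'a::real_normed_vector \<Rightarrow> 'b::euclidean_space"
  assumes "\<And>i. C2 S (f i)"
  shows "C2 S (\<lambda>x. \<chi> i. f i x)"
proof -
  have "bounded_linear (axis i :: 'b \<Rightarrow> 'b^'i)" for i
    by (intro linear_conv_bounded_linear[THEN iffD1] linearI) (auto simp: axis_def vec_eq_iff)
  moreover have "(\<chi> i. f i x) = (\<Sum>i\<in>UNIV. axis i (f i x))" for x
    by (simp add: vec_eq_iff axis_def if_distrib sum.If_cases cong: if_cong)
  ultimately show ?thesis using assms by (auto intro!: C2_sum C2_linear_compose[where h = "axis _"])
qed

text \<open>The new term of the second derivative is \<open>g''\<close> times a product of two first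
  derivatives of \<open>f\<close>, hence symmetric. Derivatives of \<open>g\<close> are asked for
  only at values of \<open>f\<close>, which admits \<open>inverse\<close> and
  \<open>sqrt\<close>.\<close>

lemma C2_scalar:
  fixes f :: "'a::real_normed_vector \<Rightarrow> 'b::real_normed_field"
  assumes f: "C2 S f"
    and g: "\<And>x. x \<in> S \<Longrightarrow> (g has_field_derivative g' (f x)) (at (f x))"
    and g': "\<And>x. x \<in> S \<Longrightarrow> (g' has_field_derivative g'' (f x)) (at (f x))"
  shows "C2 S (\<lambda>x. g (f x))"
proof -
  obtain f' f'' where F: "\<forall>x\<in>S. (f has_derivative f' x) (at x) \<and>
     (\<forall>v. ((\<lambda>y. f' y v) has_derivative (\<lambda>u. f'' x u v)) (at x)) \<and>
     (\<forall>u v. f'' x u v = f'' x v u)"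
    using f unfolding C2_def by blast
  show ?thesis
  proof (rule C2I[where f' = "\<lambda>x v. g' (f x) * f' x v" and
        f'' = "\<lambda>x u v. g' (f x) * f'' x u v + (g'' (f x) * f' x u) * f' x v"])
    fix x u v assume x: "x \<in> S"
    show "((\<lambda>x. g (f x)) has_derivative (\<lambda>v. g' (f x) * f' x v)) (at x)"
      using F x g has_derivative_compose[of f "f' x" x UNIV g] by (auto simp: has_field_derivative_def)
    have "((\<lambda>x. g' (f x)) has_derivative (\<lambda>v. g'' (f x) * f' x v)) (at x)"
      using F x g' has_derivative_compose[of f "f' x" x UNIV g'] by (auto simp: has_field_derivative_def)
    then show "((\<lambda>y. g' (f y) * f' y v) has_derivative
      (\<lambda>u. g' (f x) * f'' x u v + (g'' (f x) * f' x u) * f' x v)) (at x)"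
      using F x by (intro has_derivative_mult) auto
    show "g' (f x) * f'' x u v + (g'' (f x) * f' x u) * f' x v
       = g' (f x) * f'' x v u + (g'' (f x) * f' x v) * f' x u"
      using F x by simp
  qed
qed

lemma C2_inverse:
  fixes f :: "'a::real_normed_vector \<Rightarrow> 'b::real_normed_field"
  assumes "C2 S f" "\<And>x. x \<in> S \<Longrightarrow> f x \<noteq> 0"
  shows "C2 S (\<lambda>x. inverse (f x))"
  by (rule C2_scalar[OF assms(1), where g' = "\<lambda>y. - (inverse y * inverse y)" and
        g'' = "\<lambda>y. 2 * (inverse y * inverse y * inverse y)"])
     (use assms(2) in \<open>auto intro!: derivative_eq_intros simp: field_simps\<close>)

lemma C2_divide:
  fixes f :: "'a::real_normed_vector \<Rightarrow> 'b::real_normed_field"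
  assumes "C2 S f" "C2 S g" "\<And>x. x \<in> S \<Longrightarrow> g x \<noteq> 0"
  shows "C2 S (\<lambda>x. f x / g x)"
  unfolding divide_inverse using assms by (intro C2_mult C2_inverse)

lemma C2_sqrt:
  fixes f :: "'a::real_normed_vector \<Rightarrow> real"
  assumes "C2 S f" "\<And>x. x \<in> S \<Longrightarrow> f x > 0"
  shows "C2 S (\<lambda>x. sqrt (f x))"
  by (rule C2_scalar[OF assms(1), where g' = "\<lambda>y. inverse (sqrt y) / 2" and
        g'' = "\<lambda>y. - (inverse (sqrt y) * inverse (sqrt y) * (inverse (sqrt y) / 2)) / 2"])
     (use assms(2) in \<open>force intro!: derivative_eq_intros simp: field_simps\<close>)+

lemma C2_power: "C2 S f \<Longrightarrow> C2 S (\<lambda>x. f x ^ n :: 'b::real_normed_algebra_1)"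
  by (induction n) (auto intro: C2_mult)

lemma C2_cong:
  assumes f: "C2 S f" and "open S" and eq: "\<And>x. x \<in> S \<Longrightarrow> f x = g x"
  shows "C2 S g"
proof -
  obtain f' f'' where F: "\<forall>x\<in>S. (f has_derivative f' x) (at x) \<and>
     (\<forall>v. ((\<lambda>y. f' y v) has_derivative (\<lambda>u. f'' x u v)) (at x)) \<and>
     (\<forall>u v. f'' x u v = f'' x v u)"
    using f unfolding C2_def by blast
  then show ?thesis unfolding C2_def
    by (intro exI[of _ f'] exI[of _ f'']) (auto intro: has_derivative_transform_within_open[OF _ \<open>open S\<close> _ eq])
qed

lemma C2_has_derivative: "C2 S f \<Longrightarrow> x \<in> S \<Longrightarrow> (f has_derivative D f x) (at x)"
  unfolding C2_def by (metis frechet_derivative_at)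

text \<open>Since \<open>S\<close> is open, the witness derivative in \<open>C2\<close> may be
  replaced by \<open>D f\<close> in a neighbourhood of \<open>x\<close>, and can then be
  differentiated once more.\<close>

lemma C2_second_derivative:
  assumes "C2 S f" "open S" "x \<in> S"
  shows "((\<lambda>y. D f y v) has_derivative D (\<lambda>y. D f y v) x) (at x)"
    and "D (\<lambda>y. D f y v) x u = D (\<lambda>y. D f y u) x v"
proof -
  obtain f' f'' where F: "\<forall>x\<in>S. (f has_derivative f' x) (at x) \<and>
     (\<forall>v. ((\<lambda>y. f' y v) has_derivative (\<lambda>u. f'' x u v)) (at x)) \<and>
     (\<forall>u v. f'' x u v = f'' x v u)"
    using assms unfolding C2_def by blast
  have eq: "f' y v = D f y v" if "y \<in> S" for y v
    using F that frechet_derivative_at by metis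
  have "((\<lambda>y. D f y v) has_derivative (\<lambda>u. f'' x u v)) (at x)" for v
    by (rule has_derivative_transform_within_open[OF _ assms(2,3), of "\<lambda>y. f' y v"]) (use F assms eq in auto)
  then have "(\<lambda>u. f'' x u v) = D (\<lambda>y. D f y v) x" for v by (rule frechet_derivative_at)
  with F assms(3) show "D (\<lambda>y. D f y v) x u = D (\<lambda>y. D f y u) x v" by metis
  show "((\<lambda>y. D f y v) has_derivative D (\<lambda>y. D f y v) x) (at x)"
    using \<open>\<And>v. ((\<lambda>y. D f y v) has_derivative (\<lambda>u. f'' x u v)) (at x)\<close> frechet_derivative_at by metis
qed

lemmas C2_fst = C2_linear_compose[OF bounded_linear_fst]
lemmas C2_snd = C2_linear_compose[OF bounded_linear_snd]
lemmas C2_nth = C2_linear_compose[OF bounded_linear_vec_nth]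
lemmas C2_of_real = C2_linear_compose[OF bounded_linear_of_real]
lemmas C2_cnj = C2_linear_compose[OF bounded_linear_cnj]
lemmas C2_Re = C2_linear_compose[OF bounded_linear_Re]
lemmas C2_Im = C2_linear_compose[OF bounded_linear_Im]
lemmas C2_id = C2_bounded_linear[OF bounded_linear_ident]

text \<open>The inverse function theorem invoked below concerns maps of a space to itself. Composing
  \<open>f\<close> with a linear inverse \<open>h\<close> of its differential at \<open>b\<close>
  gives such a map, and the conclusions pass back to \<open>f\<close> because \<open>h\<close> is
  bijective.\<close>

lemma C2_local_inverse:
  fixes f :: "'a::euclidean_space \<Rightarrow> 'b::euclidean_space"
  assumes f: "C2 S f" and S: "open S" and b: "b \<in> S" and inj: "inj (D f b)"
    and dim: "DIM('a) = DIM('b)"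
  shows "\<exists>W. open W \<and> b \<in> W \<and> W \<subseteq> S \<and> inj_on f W \<and> open (f ` W) \<and>
           f differentiable_on W \<and> inv_into W f differentiable_on (f ` W)"
proof -
  have blD: "bounded_linear (D f x)" if "x \<in> S" for x
    using C2_has_derivative[OF f that] by (rule has_derivative_bounded_linear)
  obtain h where h: "linear h" "h \<circ> D f b = id"
    using linear_injective_left_inverse[OF _ inj] blD[OF b] bounded_linear.linear by blast
  then have "surj h" by (metis comp_id fun.map_comp id_o surjI o_def id_apply)
  \<comment> \<open>Equal dimensions make \<open>D f b\<close> onto, so its left inverse is
    two-sided.\<close>
  have injh: "inj h"
  proof -
    have "dim (range (D f b)) = DIM('b)"
      using dim_image_eq[OF bounded_linear.linear[OF blD[OF b]] inj_on_subset[OF inj]] dim by (auto simp: dim_UNIV)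
    then have "surj (D f b)"
      by (metis dim_eq_full bounded_linear.linear[OF blD[OF b]] linear_subspace_image span_eq_iff subspace_UNIV)
    then show ?thesis using h(2) by (metis injI o_apply id_apply surjD)
  qed
  obtain k where k: "linear k" "k \<circ> h = id"
    using linear_injective_left_inverse[OF h(1) injh] by blast
  have kh: "k (h y) = y" for y using k(2) by (metis o_apply id_apply)
  have bl: "bounded_linear h" "bounded_linear k" using h k by (auto simp: linear_conv_bounded_linear)
  define F where "F = (\<lambda>x. h (f x))"
  define F' where "F' = (\<lambda>x. Blinfun (\<lambda>v. h (D f x v)))"
  have F'a: "blinfun_apply (F' x) = (\<lambda>v. h (D f x v))" if "x \<in> S" for x
    unfolding F'_def by (intro bounded_linear_Blinfun_apply bounded_linear_compose[OF bl(1)] blD that)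
  have dF: "(F has_derivative blinfun_apply (F' x)) (at x)" if "x \<in> S" for x
    unfolding F_def F'a[OF that]
    by (intro bounded_linear.has_derivative[OF bl(1)] C2_has_derivative[OF f] that)
  have cF: "continuous_on S F'"
  proof (rule continuous_on_blinfun_componentwise)
    fix i :: 'a
    have "continuous_on S (\<lambda>x. D f x i)"
      by (intro continuous_at_imp_continuous_on ballI)
         (rule has_derivative_continuous[OF C2_second_derivative(1)[OF f S]])
    then have "continuous_on S (\<lambda>x. h (D f x i))"
      by (rule bounded_linear.continuous_on[OF bl(1)])
    then show "continuous_on S (\<lambda>x. blinfun_apply (F' x) i)"
      by (rule continuous_on_eq) (simp add: F'a)
  qed
  \<comment> \<open>The differential of \<open>F\<close> at \<open>b\<close> is the identity, which
    is therefore its own inverse.\<close>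
  have "id_blinfun o\<^sub>L F' b = id_blinfun"
    using h(2) by (intro blinfun_eqI) (simp add: F'a[OF b] fun_eq_iff)
  then obtain U V g g' where U: "open U" "U \<subseteq> S" "b \<in> U" and V: "open V" "F b \<in> V"
    and hom: "homeomorphism U V F g" and dg: "\<And>y. y \<in> V \<Longrightarrow> (g has_derivative (g' y)) (at y)"
    using inverse_function_theorem[OF S dF cF b, of id_blinfun] by metis
  have gF: "g (F x) = x" "F x \<in> V" if "x \<in> U" for x using hom that by (auto simp: homeomorphism_def)
  have Fg: "F (g y) = y" "g y \<in> U" if "y \<in> V" for y using hom that by (auto simp: homeomorphism_def)
  have inj': "inj_on f U" by (metis F_def gF(1) inj_onI)
  have im: "f ` U = h -` V"
  proof (intro equalityI subsetI)
    fix y assume "y \<in> h -` V"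
    then have "F (g (h y)) = h y" "g (h y) \<in> U" using Fg by auto
    then show "y \<in> f ` U" unfolding F_def by (metis imageI kh)
  qed (use gF in \<open>auto simp: F_def\<close>)
  have op: "open (f ` U)"
    unfolding im using V bl(1) by (intro open_vimage linear_continuous_on)
  have "inv_into U f y = g (h y)" if "y \<in> f ` U" for y
    using that by (auto simp: inv_into_f_f[OF inj'] gF(1)[unfolded F_def])
  moreover have "(\<lambda>y. g (h y)) differentiable (at y)" if "y \<in> f ` U" for y
  proof -
    have "(g has_derivative g' (h y)) (at (h y))" using dg that im by auto
    then show ?thesis
      using has_derivative_compose[OF bounded_linear_imp_has_derivative[OF bl(1)]] unfolding differentiable_def by blast
  qed
  ultimately have "inv_into U f differentiable_on (f ` U)"
    unfolding differentiable_on_def differentiable_def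
    by (metis has_derivative_transform has_derivative_at_withinI)
  moreover have "f differentiable_on U"
    unfolding differentiable_on_def differentiable_def
    using C2_has_derivative[OF f] U has_derivative_at_withinI by blast
  ultimately show ?thesis using U inj' op by blast
qed

section \<open>The cubic prepotential\<close>

text \<open>The polarization of \<open>6 * cubic k\<close>. It is generic in the field because it is
  evaluated both on complex vectors and on their real and imaginary parts.\<close>

definition trilin :: "('n::finite \<Rightarrow> 'n \<Rightarrow> 'n \<Rightarrow> real) \<Rightarrow> 'a::real_normed_field^'n \<Rightarrow> 'a^'n \<Rightarrow> 'a^'n \<Rightarrow> 'a" where
  "trilin k x y w = (\<Sum>a\<in>UNIV. \<Sum>b\<in>UNIV. \<Sum>c\<in>UNIV. of_real (k a b c) * x $ a * y $ b * w $ c)"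

lemma cubic_eq_trilin: "cubic k x = trilin k x x x / 6"
  by (simp add: cubic_def trilin_def)

lemma trilin_add:
  "trilin k (x + x') y w = trilin k x y w + trilin k x' y w"
  "trilin k x (y + y') w = trilin k x y w + trilin k x y' w"
  "trilin k x y (w + w') = trilin k x y w + trilin k x y w'"
  by (simp_all add: trilin_def algebra_simps sum.distrib)

lemma trilin_diff:
  "trilin k (x - x') y w = trilin k x y w - trilin k x' y w"
  "trilin k x (y - y') w = trilin k x y w - trilin k x y' w"
  "trilin k x y (w - w') = trilin k x y w - trilin k x y w'"
  by (simp_all add: trilin_def algebra_simps sum_subtractf)

lemma trilin_scale:
  "trilin k (c *s x) y w = c * trilin k x y w"
  "trilin k x (c *s y) w = c * trilin k x y w"
  "trilin k x y (c *s w) = c * trilin k x y w"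
  by (simp_all add: trilin_def sum_distrib_left mult_ac)

lemma trilin_zero [simp]: "trilin k 0 y w = 0" "trilin k x 0 w = 0" "trilin k x y 0 = 0"
  by (simp_all add: trilin_def)

lemma trilin_cvec: "trilin k (cvec x) (cvec y) (cvec w) = of_real (trilin k x y w)"
  by (simp add: trilin_def cvec_def)

lemma trilin_has_derivative [derivative_intros]:
  assumes "(f has_derivative f') (at x)" "(g has_derivative g') (at x)" "(h has_derivative h') (at x)"
  shows "((\<lambda>x. trilin k (f x) (g x) (h x)) has_derivative
     (\<lambda>v. trilin k (f' v) (g x) (h x) + trilin k (f x) (g' v) (h x) + trilin k (f x) (g x) (h' v))) (at x)"
proof -
  have n: "((\<lambda>x. f x $ a) has_derivative (\<lambda>v. f' v $ a)) (at x)" 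
    "((\<lambda>x. g x $ a) has_derivative (\<lambda>v. g' v $ a)) (at x)"
    "((\<lambda>x. h x $ a) has_derivative (\<lambda>v. h' v $ a)) (at x)" for a
    using assms by (auto intro: bounded_linear.has_derivative[OF bounded_linear_vec_nth])
  have "((\<lambda>x. of_real (k a b c) * f x $ a * g x $ b * h x $ c) has_derivative
     (\<lambda>v. of_real (k a b c) * f' v $ a * g x $ b * h x $ c + of_real (k a b c) * f x $ a * g' v $ b * h x $ c
        + of_real (k a b c) * f x $ a * g x $ b * h' v $ c)) (at x)" for a b c
    by (rule derivative_eq_intros n refl | simp add: algebra_simps)+
  then show ?thesis unfolding trilin_def sum.distrib[symmetric]
    by (intro has_derivative_sum)
qed

lemma C2_trilin:
  fixes f g h :: "'a::real_normed_vector \<Rightarrow> 'b::real_normed_field^'n"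
  assumes "\<And>a. C2 S (\<lambda>x. f x $ a)" "\<And>a. C2 S (\<lambda>x. g x $ a)" "\<And>a. C2 S (\<lambda>x. h x $ a)"
  shows "C2 S (\<lambda>x. trilin k (f x) (g x) (h x))"
  unfolding trilin_def using assms by (intro C2_sum C2_mult C2_const)

definition symmetric3 :: "('n \<Rightarrow> 'n \<Rightarrow> 'n \<Rightarrow> real) \<Rightarrow> bool" where
  "symmetric3 k \<longleftrightarrow> (\<forall>a b c. k a b c = k b a c \<and> k a b c = k a c b)"

lemma trilin_commute:
  assumes "symmetric3 k"
  shows "trilin k x y w = trilin k y x w" "trilin k x y w = trilin k x w y"
proof -
  have sw: "k a b c = k a c b" for a b c using assms by (simp add: symmetric3_def)
  have "trilin k x y w = (\<Sum>b\<in>UNIV. \<Sum>a\<in>UNIV. \<Sum>c\<in>UNIV. of_real (k a b c) * x $ a * y $ b * w $ c)"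
    unfolding trilin_def by (rule sum.swap)
  also have "\<dots> = trilin k y x w"
    unfolding trilin_def using assms by (intro sum.cong refl) (simp add: symmetric3_def mult_ac)
  finally show "trilin k x y w = trilin k y x w" .
  have "trilin k x y w = (\<Sum>a\<in>UNIV. \<Sum>c\<in>UNIV. \<Sum>b\<in>UNIV. of_real (k a b c) * x $ a * y $ b * w $ c)"
    unfolding trilin_def by (intro sum.cong[OF refl] sum.swap)
  also have "\<dots> = trilin k x w y"
    unfolding trilin_def using sw by (intro sum.cong refl) (simp add: mult_ac)
  finally show "trilin k x y w = trilin k x w y" .
qed

section \<open>First and second derivatives of the prepotential\<close>

definition tail :: "'a^('n::finite option) \<Rightarrow> 'a^'n" where
  "tail X = (\<chi> a. X $ Some a)"

lemma tail_simps [simp]: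
  "tail (x + y) = tail x + tail y" "tail (x - y) = tail x - tail y" "tail (c *s u) = c *s tail u"
  "tail (cnjvec v) = cnjvec (tail v)" "tail (cvec r) = cvec (tail r)" "tail (homog z) = z"
  "tail (axis (Some a) p) = axis a p" "tail (axis None p) = 0"
  by (simp_all add: tail_def vec_eq_iff cnjvec_def cvec_def homog_def axis_def)

lemma cnjvec_nth [simp]: "cnjvec x $ i = cnj (x $ i)"
  by (simp add: cnjvec_def)

lemma homog_None [simp]: "homog z $ None = 1"
  by (simp add: homog_def)

lemma tail_has_derivative [derivative_intros]:
  fixes f :: "'a::real_normed_vector \<Rightarrow> 'b::real_normed_vector^('n::finite option)"
  assumes "(f has_derivative f') F"
  shows "((\<lambda>x. tail (f x)) has_derivative (\<lambda>v. tail (f' v))) F"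
proof -
  have "bounded_linear (tail :: 'b^('n option) \<Rightarrow> 'b^'n)"
  proof (rule bounded_linear_intro[where K = 1])
    show "norm (tail (x::'b^('n option))) \<le> norm x * 1" for x
      unfolding norm_vec_def tail_def L2_set_def
      by (auto intro!: real_sqrt_le_mono simp: UNIV_option_conv sum.reindex intro: add_nonneg_nonneg)
  qed (auto simp: tail_def vec_eq_iff)
  then show ?thesis by (rule bounded_linear.has_derivative[OF _ assms])
qed

text \<open>\<open>cpartial\<close> is a derivative in one complex variable, whereas
  \<open>has_derivative\<close> is only real-linear; the second assumption supplies complex
  linearity along the \<open>i\<close>-th axis.\<close>

lemma cpartial_eq:
  assumes "(\<Phi> has_derivative \<Phi>') (at X)" "\<And>x. \<Phi>' (axis i x) = c * x"
  shows "cpartial i \<Phi> X = c"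
proof -
  have "bounded_linear (axis i :: complex \<Rightarrow> complex^'a)"
    by (intro linear_conv_bounded_linear[THEN iffD1] linearI) (auto simp: axis_def vec_eq_iff)
  then have "((\<lambda>x. X + axis i x) has_derivative axis i) (at 0)"
    by (auto intro!: derivative_eq_intros bounded_linear_imp_has_derivative)
  moreover have "X + axis i 0 = X" by (simp add: axis_def vec_eq_iff)
  then have "(\<Phi> has_derivative \<Phi>') (at (X + axis i 0))" using assms(1) by metis
  ultimately have "((\<lambda>x. \<Phi> (X + axis i x)) has_derivative (\<lambda>x. \<Phi>' (axis i x))) (at 0)"
    by (rule has_derivative_compose)
  then have "((\<lambda>x. \<Phi> (X + axis i x)) has_field_derivative c) (at 0)"
    unfolding has_field_derivative_def using assms(2) by simp
  then show ?thesis unfolding cpartial_def by (rule DERIV_imp_deriv)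
qed

text \<open>This is the vector \<open>\<tau>\<^sub>i\<^sub>j V\<^sup>j\<close> in closed form, as
  \<open>dot_dF_tau\<close> confirms. As a linear map in \<open>V\<close> it replaces the matrix
  \<open>tau\<close> nearly everywhere.\<close>

definition dF :: "('n::finite \<Rightarrow> 'n \<Rightarrow> 'n \<Rightarrow> real) \<Rightarrow> complex^('n option) \<Rightarrow> complex^('n option) \<Rightarrow> complex^('n option)" where
  "dF k Z V = (\<chi> i. case i of
     None \<Rightarrow> trilin k (tail Z) (tail Z) (tail V) / (2 * (Z $ None)\<^sup>2) - trilin k (tail Z) (tail Z) (tail Z) * V $ None / (3 * (Z $ None)^3)
   | Some a \<Rightarrow> trilin k (tail Z) (tail Z) (axis a 1) * V $ None / (2 * (Z $ None)\<^sup>2) - trilin k (tail Z) (tail V) (axis a 1) / Z $ None)"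

text \<open>Complex bilinear without conjugation; Hermitian expressions conjugate an argument
  explicitly by \<open>cnjvec\<close>.\<close>

definition dot :: "complex^'m::finite \<Rightarrow> complex^'m \<Rightarrow> complex" where
  "dot x y = (\<Sum>i\<in>UNIV. x $ i * y $ i)"

lemma prepot_has_derivative:
  assumes k: "symmetric3 k" and Z: "Z $ None \<noteq> 0"
  shows "(prepot k has_derivative (\<lambda>V. trilin k (tail Z) (tail Z) (tail Z) * V $ None / (6 * (Z $ None)\<^sup>2)
           - trilin k (tail Z) (tail Z) (tail V) / (2 * Z $ None))) (at Z)"
proof -
  have eq: "prepot k = (\<lambda>Z. - trilin k (tail Z) (tail Z) (tail Z) / (6 * Z $ None))"
    by (simp add: prepot_def cubic_eq_trilin tail_def fun_eq_iff)
  have s: "trilin k (tail V) (tail Z) (tail Z) = trilin k (tail Z) (tail Z) (tail V)"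
     "trilin k (tail Z) (tail V) (tail Z) = trilin k (tail Z) (tail Z) (tail V)" for V
    by (metis trilin_commute[OF k])+
  have t: "(tail has_derivative tail) (at Z)" "((\<lambda>Z. Z $ None) has_derivative (\<lambda>V. V $ None)) (at Z)"
    using tail_has_derivative[OF has_derivative_ident]
    by (auto intro: bounded_linear_imp_has_derivative bounded_linear_vec_nth)
  have "((\<lambda>Z. - trilin k (tail Z) (tail Z) (tail Z)) has_derivative (\<lambda>V. - (3 * trilin k (tail Z) (tail Z) (tail V)))) (at Z)"
    by (rule has_derivative_eq_rhs[OF has_derivative_minus[OF trilin_has_derivative[OF t(1) t(1) t(1)]]])
       (simp add: s fun_eq_iff)
  note has_derivative_divide'[OF this has_derivative_mult_right[OF t(2), of 6]]
  then show ?thesis unfolding eq using Z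
    by (auto elim!: has_derivative_eq_rhs simp: fun_eq_iff field_simps power2_eq_square)
qed

lemma sum_option: "(\<Sum>i\<in>UNIV. f i) = f None + (\<Sum>a\<in>UNIV. f (Some a))" for f :: "'n::finite option \<Rightarrow> 'b::comm_monoid_add"
  by (simp add: UNIV_option_conv sum.reindex)

lemma dot_option: "dot x y = x $ None * y $ None + dot (tail x) (tail y)"
  by (simp add: dot_def sum_option tail_def)

lemma vec_axis_sum: "(\<Sum>a\<in>UNIV. u $ a *s axis a 1) = (u :: complex^'n::finite)"
  by (simp add: vec_eq_iff axis_def if_distrib sum.If_cases cong: if_cong)

lemma trilin_sum: "trilin k x y (\<Sum>a\<in>A. f a) = (\<Sum>a\<in>A. trilin k x y (f a))"
  by (induction A rule: infinite_finite_induct) (auto simp: trilin_add)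

lemma trilin_axis: "(\<Sum>a\<in>UNIV. u $ a * trilin k x y (axis a 1)) = trilin k x y (u :: complex^'n::finite)"
proof -
  have "(\<Sum>a\<in>UNIV. u $ a * trilin k x y (axis a 1)) = trilin k x y (\<Sum>a\<in>UNIV. u $ a *s axis a 1)"
    by (simp add: trilin_sum trilin_scale)
  then show ?thesis by (simp only: vec_axis_sum)
qed

lemma dprepot_eq:
  assumes k: "symmetric3 k" and Z: "Z $ None \<noteq> 0"
  shows "dprepot k Z = (\<chi> i. case i of
     None \<Rightarrow> trilin k (tail Z) (tail Z) (tail Z) / (6 * (Z $ None)\<^sup>2)
   | Some a \<Rightarrow> - trilin k (tail Z) (tail Z) (axis a 1) / (2 * Z $ None))"
proof -
  have ax: "axis a x = x *s axis a 1" for a :: "'b::finite" and x :: complex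
    by (simp add: vec_eq_iff axis_def)
  have tax: "tail (axis (Some a) x) = x *s axis a 1" for a :: 'a and x :: complex
    by (simp, rule ax)
  have None: "cpartial None (prepot k) Z = trilin k (tail Z) (tail Z) (tail Z) / (6 * (Z $ None)\<^sup>2)"
    by (rule cpartial_eq[OF prepot_has_derivative[OF k Z]]) simp
  have Some: "cpartial (Some a) (prepot k) Z = - trilin k (tail Z) (tail Z) (axis a 1) / (2 * Z $ None)" for a
    by (rule cpartial_eq[OF prepot_has_derivative[OF k Z]])
       (simp only: tax trilin_scale, simp add: axis_def)
  show ?thesis
    unfolding dprepot_def by (auto simp: vec_eq_iff None Some split: option.split)
qed

lemma dot_dprepot:
  assumes k: "symmetric3 k" and Z: "Z $ None \<noteq> 0"
  shows "dot U (dprepot k Z) = U $ None * trilin k (tail Z) (tail Z) (tail Z) / (6 * (Z $ None)\<^sup>2)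
     - trilin k (tail Z) (tail Z) (tail U) / (2 * Z $ None)"
proof -
  have "dot (tail U) (tail (dprepot k Z)) = - (\<Sum>a\<in>UNIV. tail U $ a * trilin k (tail Z) (tail Z) (axis a 1)) / (2 * Z $ None)"
    by (simp add: dot_def tail_def dprepot_eq[OF k Z] sum_divide_distrib sum_negf)
  then show ?thesis
    unfolding dot_option trilin_axis by (simp add: dprepot_eq[OF k Z])
qed

lemma dot_dF:
  shows "dot U (dF k Z V) = U $ None * (trilin k (tail Z) (tail Z) (tail V) / (2 * (Z $ None)\<^sup>2) - trilin k (tail Z) (tail Z) (tail Z) * V $ None / (3 * (Z $ None)^3))
     + (trilin k (tail Z) (tail Z) (tail U) * V $ None / (2 * (Z $ None)\<^sup>2) - trilin k (tail Z) (tail V) (tail U) / Z $ None)"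
proof -
  have "dot (tail U) (tail (dF k Z V)) = (\<Sum>a\<in>UNIV. tail U $ a * trilin k (tail Z) (tail Z) (axis a 1)) * V $ None / (2 * (Z $ None)\<^sup>2)
     - (\<Sum>a\<in>UNIV. tail U $ a * trilin k (tail Z) (tail V) (axis a 1)) / Z $ None"
    by (simp add: dot_def tail_def dF_def sum_divide_distrib sum_distrib_right sum_subtractf right_diff_distrib mult.assoc)
  then show ?thesis
    unfolding dot_option trilin_axis by (simp add: dF_def)
qed

lemma dot_commute: "dot x y = dot y x"
  by (simp add: dot_def mult.commute)

text \<open>This is the symmetry of \<tau>: in \<open>dot_dF\<close> the two mixed terms are
  exchanged and the other two are symmetric.\<close>

lemma dot_dF_commute: "symmetric3 k \<Longrightarrow> dot U (dF k Z V) = dot V (dF k Z U)"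
  unfolding dot_dF by (simp add: trilin_commute(2)[of k _ "tail V" "tail U"] algebra_simps)

text \<open>Euler's relation for the first derivatives of the prepotential, which are homogeneous of
  degree 1.\<close>

lemma dF_euler: "symmetric3 k \<Longrightarrow> Z $ None \<noteq> 0 \<Longrightarrow> dF k Z Z = dprepot k Z"
  by (auto simp: dprepot_eq dF_def vec_eq_iff field_simps power2_eq_square power3_eq_cube split: option.split)

lemma dprepot_scale: 
  assumes "symmetric3 k" "Z $ None \<noteq> 0" "c \<noteq> 0" shows "dprepot k (c *s Z) = c *s dprepot k Z"
  using assms by (auto simp: dprepot_eq vec_eq_iff trilin_scale field_simps power2_eq_square split: option.split)

lemma dF_scale: 
  assumes "c \<noteq> 0" shows "dF k (c *s Z) V = dF k Z V"
  using assms by (auto simp: dF_def vec_eq_iff trilin_scale field_simps power2_eq_square power3_eq_cube split: option.split)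

lemma has_derivative_vecI:
  fixes f :: "'a::real_normed_vector \<Rightarrow> 'b::euclidean_space^'i::finite"
  assumes "\<And>i. ((\<lambda>x. f x $ i) has_derivative (\<lambda>v. f' v $ i)) F"
  shows "(f has_derivative f') F"
proof -
  have bl: "bounded_linear (axis i :: 'b \<Rightarrow> 'b^'i)" for i
    by (intro linear_conv_bounded_linear[THEN iffD1] linearI) (auto simp: axis_def vec_eq_iff)
  have eq: "x = (\<Sum>i\<in>UNIV. axis i (x $ i))" for x :: "'b^'i"
    by (simp add: vec_eq_iff axis_def if_distrib sum.If_cases cong: if_cong)
  have "((\<lambda>x. \<Sum>i\<in>UNIV. axis i (f x $ i)) has_derivative (\<lambda>v. \<Sum>i\<in>UNIV. axis i (f' v $ i))) F"
    by (intro has_derivative_sum bounded_linear.has_derivative[OF bl] assms)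
  then show ?thesis by (simp only: eq[symmetric])
qed

lemma open_None: "open {Z :: complex^('n::finite option). Z $ None \<noteq> 0}"
  by (intro open_Collect_neq continuous_intros)

lemma dprepot_has_derivative:
  assumes k: "symmetric3 k" and Z: "Z $ None \<noteq> 0"
  shows "(dprepot k has_derivative dF k Z) (at Z)"
proof (rule has_derivative_vecI)
  fix i
  have t: "(tail has_derivative tail) (at Z)" "((\<lambda>Z. Z $ None) has_derivative (\<lambda>V. V $ None)) (at Z)"
    using tail_has_derivative[OF has_derivative_ident]
    by (auto intro: bounded_linear_imp_has_derivative bounded_linear_vec_nth)
  have s: "trilin k (tail V) (tail Z) (tail Z) = trilin k (tail Z) (tail Z) (tail V)"
     "trilin k (tail Z) (tail V) (tail Z) = trilin k (tail Z) (tail Z) (tail V)" for V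
    by (metis trilin_commute[OF k])+
  have sq: "((\<lambda>Z. (Z $ None)\<^sup>2) has_derivative (\<lambda>V. 2 * Z $ None * V $ None)) (at Z)"
    by (rule has_derivative_eq_rhs[OF has_derivative_power[OF t(2)]]) (simp add: mult_ac)
  show "((\<lambda>Z. dprepot k Z $ i) has_derivative (\<lambda>V. dF k Z V $ i)) (at Z)"
  proof (cases i)
    case None
    have N: "((\<lambda>Z. trilin k (tail Z) (tail Z) (tail Z)) has_derivative (\<lambda>V. 3 * trilin k (tail Z) (tail Z) (tail V))) (at Z)"
      by (rule has_derivative_eq_rhs[OF trilin_has_derivative[OF t(1) t(1) t(1)]])
         (simp add: s fun_eq_iff)
    have "((\<lambda>Z. trilin k (tail Z) (tail Z) (tail Z) / (6 * (Z $ None)\<^sup>2)) has_derivative (\<lambda>V. dF k Z V $ i)) (at Z)"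
      using has_derivative_divide'[OF N has_derivative_mult_right[OF sq, of 6]] Z
      by (auto elim!: has_derivative_eq_rhs simp: fun_eq_iff field_simps power2_eq_square power3_eq_cube dF_def None)
    \<comment> \<open>The closed form of \<open>dprepot\<close> holds only for nonzero
      \<open>Z $ None\<close>, an open condition, so the derivative can be transferred.\<close>
    then show ?thesis
      by (rule has_derivative_transform_within_open[OF _ open_None]) (use Z in \<open>auto simp: dprepot_eq[OF k] None\<close>)
  next
    case (Some a)
    have N: "((\<lambda>Z. - trilin k (tail Z) (tail Z) (axis a 1)) has_derivative (\<lambda>V. - (2 * trilin k (tail Z) (tail V) (axis a 1)))) (at Z)"
      by (rule has_derivative_eq_rhs[OF has_derivative_minus[OF trilin_has_derivative[OF t(1) t(1) has_derivative_const]]])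
         (auto simp: fun_eq_iff intro: trilin_commute(1)[OF k])
    have "((\<lambda>Z. - trilin k (tail Z) (tail Z) (axis a 1) / (2 * Z $ None)) has_derivative (\<lambda>V. dF k Z V $ i)) (at Z)"
      using has_derivative_divide'[OF N has_derivative_mult_right[OF t(2), of 2]] Z
      by (auto elim!: has_derivative_eq_rhs simp: fun_eq_iff field_simps power2_eq_square dF_def Some)
    then show ?thesis
      by (rule has_derivative_transform_within_open[OF _ open_None]) (use Z in \<open>auto simp: dprepot_eq[OF k] Some\<close>)
  qed
qed

lemma dF_add: "dF k Z (U + V) = dF k Z U + dF k Z V"
  and dF_smult: "dF k Z (c *s V) = c *s dF k Z V"
  by (auto simp: dF_def vec_eq_iff trilin_add trilin_scale algebra_simps add_divide_distrib diff_divide_distrib split: option.split)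

lemma dF_zero [simp]: "dF k Z 0 = 0"
  using dF_smult[of k Z 0 0] by simp

lemma dF_sum: "dF k Z (\<Sum>i\<in>A. f i) = (\<Sum>i\<in>A. dF k Z (f i))"
  by (induction A rule: infinite_finite_induct) (simp_all add: dF_add)

lemma tau_eq:
  assumes k: "symmetric3 k" and Z: "Z $ None \<noteq> 0"
  shows "tau k Z i j = dF k Z (axis i 1) $ j"
proof -
  have "((\<lambda>Z. dprepot k Z $ j) has_derivative (\<lambda>V. dF k Z V $ j)) (at Z)"
    by (rule bounded_linear.has_derivative[OF bounded_linear_vec_nth dprepot_has_derivative[OF k Z]])
  then have "((\<lambda>Z. cpartial j (prepot k) Z) has_derivative (\<lambda>V. dF k Z V $ j)) (at Z)"
    by (simp add: dprepot_def)
  moreover have "dF k Z (axis i x) $ j = dF k Z (axis i 1) $ j * x" for x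
  proof -
    have "axis i x = x *s axis i 1" by (simp add: vec_eq_iff axis_def)
    then have "dF k Z (axis i x) = x *s dF k Z (axis i 1)" by (simp only: dF_smult)
    then show ?thesis by simp
  qed
  ultimately show ?thesis
    unfolding tau_def by (rule cpartial_eq)
qed

section \<open>The metric \<open>gM\<close> and the function \<open>rsq\<close> as bilinear
  expressions\<close>

lemma dot_dF_tau:
  assumes k: "symmetric3 k" and Z: "Z $ None \<noteq> 0"
  shows "dot U (dF k Z V) = (\<Sum>i\<in>UNIV. \<Sum>j\<in>UNIV. tau k Z i j * U $ i * V $ j)"
proof -
  have "dot U (dF k Z V) = dot V (dF k Z U)" by (rule dot_dF_commute[OF k])
  also have "dF k Z U = dF k Z (\<Sum>i\<in>UNIV. U $ i *s axis i 1)" by (simp only: vec_axis_sum)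
  also have "dot V \<dots> = (\<Sum>j\<in>UNIV. \<Sum>i\<in>UNIV. tau k Z i j * U $ i * V $ j)"
    by (simp add: dot_def dF_sum dF_smult tau_eq[OF k Z] sum_distrib_left mult_ac)
  finally show ?thesis by (subst sum.swap)
qed

text \<open>Conjugating the second pairing replaces \<tau> by its conjugate. The difference of the
  first pairing and this conjugate thus has the coefficients 2\<i> Im \<tau>, and its imaginary part
  picks out the real part used in \<open>gM\<close>.\<close>

lemma gM_eq:
  assumes k: "symmetric3 k" and Z: "Z $ None \<noteq> 0"
  shows "gM k Z u v = - Im (dot u (dF k Z (cnjvec v)) + dot (cnjvec u) (dF k Z v)) / 2"
proof -
  let ?X = "dot u (dF k Z (cnjvec v))" and ?Y = "dot (cnjvec u) (dF k Z v)"
  have "?X - cnj ?Y = (\<Sum>i\<in>UNIV. \<Sum>j\<in>UNIV. (tau k Z i j - cnj (tau k Z i j)) * u $ i * cnj (v $ j))"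
    by (simp add: dot_dF_tau[OF k Z] cnjvec_def algebra_simps sum_subtractf)
  also have "\<dots> = - 2 * \<i> * (\<Sum>i\<in>UNIV. \<Sum>j\<in>UNIV. complex_of_real (- Im (tau k Z i j)) * u $ i * cnj (v $ j))"
    by (simp add: sum_distrib_left complex_diff_cnj algebra_simps)
  finally have "Im (?X - cnj ?Y) = Im (- 2 * \<i> * (\<Sum>i\<in>UNIV. \<Sum>j\<in>UNIV. complex_of_real (- Im (tau k Z i j)) * u $ i * cnj (v $ j)))"
    by (rule arg_cong)
  also have "\<dots> = - 2 * gM k Z u v"
    unfolding gM_def by simp
  finally show ?thesis by simp
qed

lemma dot_simps:
  "dot (x + x') y = dot x y + dot x' y" "dot x (y + y') = dot x y + dot x y'"
  "dot (x - x') y = dot x y - dot x' y" "dot x (y - y') = dot x y - dot x y'"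
  "dot (- x) y = - dot x y" "dot x (- y) = - dot x y"
  "dot (c *s x) y = c * dot x y" "dot x (c *s y) = c * dot x y"
  by (simp_all add: dot_def algebra_simps sum.distrib sum_subtractf sum_negf sum_distrib_left)

lemma dot_cnjvec: "dot (cnjvec x) (cnjvec y) = cnj (dot x y)"
  by (simp add: dot_def cnjvec_def)

lemma rsq_eq_dot:
  assumes k: "symmetric3 k" and Z: "Z $ None \<noteq> 0"
  shows "rsq k Z = - Im (dot (cnjvec Z) (dprepot k Z))"
  by (simp add: rsq_def euler_def gM_eq[OF k Z] dot_dF_commute[OF k, of Z] dF_euler[OF k Z])

text \<open>Origin of the 4: for z = b + \<i>t all terms containing b drop out of the imaginary part
  of \<open>dot (cnjvec (homog z)) (dprepot k (homog z))\<close>. There remains - (1/6 + 1/2)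
  \<open>trilin k t t t\<close>, and \<open>trilin k t t t\<close> is 6 h(t).\<close>

lemma rsq_homog:
  assumes k: "symmetric3 k" and c: "c \<noteq> 0"
  shows "rsq k (c *s homog z) = 4 * himag k z * (norm c)\<^sup>2"
proof -
  define b t where "b = (\<chi> a. Re (z $ a))" and "t = (\<chi> a. Im (z $ a))"
  have z: "z = cvec b + \<i> *s cvec t" and z': "cnjvec z = cvec b - \<i> *s cvec t"
    by (auto simp: vec_eq_iff b_def t_def cvec_def cnjvec_def complex_eq_iff)
  have s: "trilin k t b b = trilin k b b t" "trilin k b t b = trilin k b b t" 
     "trilin k t b t = trilin k b t t" "trilin k t t b = trilin k b t t"
    by (metis trilin_commute[OF k])+
  have "dot (cnjvec (c *s homog z)) (dprepot k (c *s homog z)) = (norm c)\<^sup>2 * dot (cnjvec (homog z)) (dprepot k (homog z))"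
  proof -
    have "cnjvec (c *s homog z) = cnj c *s cnjvec (homog z)" by (simp add: vec_eq_iff cnjvec_def)
    then show ?thesis
      using complex_norm_square[of c] by (simp add: dprepot_scale[OF k _ c] dot_simps mult_ac)
  qed
  moreover have "Im (dot (cnjvec (homog z)) (dprepot k (homog z))) = - 4 * himag k z"
    by (simp add: dot_dprepot[OF k] himag_def cubic_eq_trilin t_def[symmetric])
       (simp only: z', simp only: z trilin_add trilin_diff trilin_scale trilin_cvec s, simp add: algebra_simps, simp add: field_simps)
  ultimately show ?thesis
    using c by (simp add: rsq_eq_dot[OF k])
qed

lemma C2_dprepot:
  assumes k: "symmetric3 k" and S: "open S" and f: "\<And>i. C2 S (\<lambda>x. f x $ i)" and nz: "\<And>x. x \<in> S \<Longrightarrow> f x $ None \<noteq> 0"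
  shows "C2 S (\<lambda>x. dprepot k (f x) $ i)"
proof (cases i)
  case None
  have "C2 S (\<lambda>x. trilin k (tail (f x)) (tail (f x)) (tail (f x)) / (6 * (f x $ None)\<^sup>2))"
    using nz by (intro C2_divide C2_trilin C2_mult C2_const C2_power f) (auto simp: tail_def f)
  then show ?thesis by (rule C2_cong[OF _ S]) (simp add: None dprepot_eq[OF k nz])
next
  case (Some a)
  have "C2 S (\<lambda>x. - trilin k (tail (f x)) (tail (f x)) (axis a 1) / (2 * (f x $ None)))"
    using nz by (intro C2_divide C2_minus C2_trilin C2_mult C2_const C2_power f) (auto simp: tail_def f)
  then show ?thesis by (rule C2_cong[OF _ S]) (simp add: Some dprepot_eq[OF k nz])
qed

section \<open>Projective special real manifolds\<close>

text \<open>Provides a direction transversal to two hypersurfaces at once; if \<open>a\<close> and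
  \<open>b\<close> are orthogonal, their sum serves.\<close>

lemma two_nonzero_functionals:
  fixes a b :: "'a::real_inner"
  assumes "a \<noteq> 0" "b \<noteq> 0"
  obtains e where "a \<bullet> e > 0" "b \<bullet> e \<noteq> 0"
proof (cases "a \<bullet> b = 0")
  case False
  then show ?thesis using that[of a] assms by (simp add: inner_commute)
next
  case True
  then have "a \<bullet> (a + b) > 0" "b \<bullet> (a + b) \<noteq> 0"
    using assms by (auto simp: inner_add_right inner_commute)
  then show ?thesis by (rule that)
qed

text \<open>Rolle's theorem without an order between \<open>a\<close> and \<open>b\<close>: the
  parameter to which it is applied comes from the intermediate value theorem and may have either
  sign.\<close>

lemma deriv_nonzero_strict:
  fixes f :: "real \<Rightarrow> real"
  assumes "\<And>x. x \<in> {min a b..max a b} \<Longrightarrow> (f has_real_derivative f' x) (at x)"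
    and "\<And>x. x \<in> {min a b..max a b} \<Longrightarrow> f' x \<noteq> 0" and "f a = f b"
  shows "a = b"
proof (rule ccontr)
  assume ne: "a \<noteq> b"
  define l u where "l = min a b" and "u = max a b"
  have lu: "l < u" "f l = f u" using ne \<open>f a = f b\<close> by (auto simp: l_def u_def min_def max_def)
  have "\<exists>z>l. z < u \<and> f u - f l = (u - l) * f' z"
    using assms(1) lu(1) by (intro MVT2) (auto simp: l_def u_def)
  then show False using lu assms(2) by (force simp: l_def u_def)
qed

text \<open>Near a point of \<open>S\<close> the lines in a direction \<open>e\<close> transversal to both level sets meet \<open>S\<close> by the
  intermediate value theorem for the defining function of \<open>S\<close>, and meet the level set of \<open>h\<close> only once.\<close>

lemma hypersurface_open_in_level_set:
  fixes h :: "real^'n::finite \<Rightarrow> real"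
  assumes S: "hypersurface S" and p: "p \<in> S" and Sh: "S \<subseteq> {x. h x = 1}"
    and h: "\<And>x. (h has_derivative (\<lambda>v. Gh x \<bullet> v)) (at x)" and Ghc: "continuous_on UNIV Gh" and Ghp: "Gh p \<noteq> 0"
  shows "\<exists>V. open V \<and> p \<in> V \<and> (\<forall>x\<in>V. h x = 1 \<longrightarrow> x \<in> S)"
proof -
  obtain V g G where V: "open V" "p \<in> V" and g: "\<And>x. x \<in> V \<Longrightarrow> (g has_derivative (\<lambda>v. G x \<bullet> v)) (at x)" "\<And>x. x \<in> V \<Longrightarrow> G x \<noteq> 0"
    and Gc: "continuous_on V G" and SV: "S \<inter> V = {x \<in> V. g x = (0::real)}"
  proof -
    from S p have "\<exists>V g G. open V \<and> p \<in> V \<and>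
        (\<forall>x\<in>V. (g has_derivative (\<lambda>v. G x \<bullet> v)) (at x) \<and> G x \<noteq> 0) \<and>
        continuous_on V G \<and> S \<inter> V = {x \<in> V. g x = (0::real)}"
      unfolding hypersurface_def by (rule bspec)
    then show ?thesis by (elim exE conjE) (rule that, auto)
  qed
  obtain e where e: "G p \<bullet> e > 0" "Gh p \<bullet> e \<noteq> 0"
    using two_nonzero_functionals g(2)[OF V(2)] Ghp by metis
  have "continuous (at p) G" using Gc V continuous_on_eq_continuous_at by blast
  then have "((\<lambda>x. G x \<bullet> e) \<longlongrightarrow> G p \<bullet> e) (at p)" by (auto intro!: tendsto_intros simp: continuous_at)
  then have ev1: "\<forall>\<^sub>F x in nhds p. G x \<bullet> e > 0"
    using e(1) by (simp add: order_tendstoD(1) eventually_nhds_conv_at)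
  have "continuous (at p) Gh" using Ghc continuous_on_eq_continuous_at[OF open_UNIV] by blast
  then have "((\<lambda>x. Gh x \<bullet> e) \<longlongrightarrow> Gh p \<bullet> e) (at p)" by (auto intro!: tendsto_intros simp: continuous_at)
  then have ev2: "\<forall>\<^sub>F x in nhds p. Gh x \<bullet> e \<noteq> 0"
    using e(2) by (simp add: tendsto_imp_eventually_ne eventually_nhds_conv_at)
  have "\<forall>\<^sub>F x in nhds p. x \<in> V" using V eventually_nhds by blast
  with ev1 ev2 have "\<forall>\<^sub>F x in nhds p. x \<in> V \<and> G x \<bullet> e > 0 \<and> Gh x \<bullet> e \<noteq> 0" by eventually_elim auto
  then obtain r where r: "r > 0" "\<And>x. dist x p < r \<Longrightarrow> x \<in> V \<and> G x \<bullet> e > 0 \<and> Gh x \<bullet> e \<noteq> 0"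
    unfolding eventually_nhds_metric by blast
  \<comment> \<open>The \<open>+ 1\<close> makes the bound \<open>d * norm e < d * m\<close> in
    \<open>near\<close> strict.\<close>
  define m where "m = norm e + 1"
  have m: "m > 0" unfolding m_def by (intro add_nonneg_pos) auto
  define d where "d = r / (2 * m)"
  have d: "d > 0" using r m by (simp add: d_def)
  have near: "dist (y + s *\<^sub>R e) p < r" if "dist y p < r / 2" "\<bar>s\<bar> \<le> d" for y s
  proof -
    have "norm (s *\<^sub>R e) \<le> d * norm e" using that by (simp add: mult_right_mono)
    also have "\<dots> < d * m" using d by (simp add: m_def)
    also have "\<dots> = r / 2" using m by (simp add: d_def)
    finally have "norm (s *\<^sub>R e) < r / 2" .
    moreover have "dist (y + s *\<^sub>R e) p \<le> dist y p + norm (s *\<^sub>R e)"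
      by (metis add.commute add_diff_eq dist_norm norm_triangle_ineq)
    ultimately show ?thesis using that by linarith
  qed
  have line: "((\<lambda>s. y + s *\<^sub>R e) has_derivative (\<lambda>s. s *\<^sub>R e)) (at s)" for y s
    by (auto intro!: derivative_eq_intros)
  have dg: "((\<lambda>s. g (y + s *\<^sub>R e)) has_real_derivative G (y + s *\<^sub>R e) \<bullet> e) (at s)"
    if "dist y p < r / 2" "\<bar>s\<bar> \<le> d" for y s
    using has_derivative_compose[OF line[of y s] g(1)[of "y + s *\<^sub>R e"]] r(2)[OF near[OF that]]
    by (simp add: has_field_derivative_def mult_commute_abs)
  have dh: "((\<lambda>s. h (y + s *\<^sub>R e)) has_real_derivative Gh (y + s *\<^sub>R e) \<bullet> e) (at s)" for y s
    using has_derivative_compose[OF line[of y s] h[of "y + s *\<^sub>R e"]]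
    by (simp add: has_field_derivative_def mult_commute_abs)
  have pp: "dist p p < r / 2" using r by simp
  have gp: "g p = 0" using SV p V by auto
  have inc: "g (p + s *\<^sub>R e) < g (p + t *\<^sub>R e)" if "s < t" "- d \<le> s" "t \<le> d" for s t
  proof (rule DERIV_pos_imp_increasing[OF that(1)])
    fix x assume "s \<le> x" "x \<le> t"
    then have "\<bar>x\<bar> \<le> d" using that by linarith
    then show "\<exists>y. ((\<lambda>s. g (p + s *\<^sub>R e)) has_real_derivative y) (at x) \<and> y > 0"
      using dg[OF pp] r(2)[OF near[OF pp]] by blast
  qed
  \<comment> \<open>By continuity, this change of sign along the segment through \<open>p\<close>
    persists on the parallel segments through all nearby \<open>y\<close>.\<close>
  have g1: "g (p + d *\<^sub>R e) > 0" and g2: "g (p + (- d) *\<^sub>R e) < 0"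
    using inc[of 0 d] inc[of "- d" 0] d gp by auto
  have cont: "continuous (at y) (\<lambda>y. g (y + s *\<^sub>R e))" if "dist y p < r / 2" "\<bar>s\<bar> \<le> d" for y s
  proof -
    have "((\<lambda>y. y + s *\<^sub>R e) has_derivative (\<lambda>v. v)) (at y)" by (auto intro!: derivative_eq_intros)
    then show ?thesis
      using r(2)[OF near[OF that]] by (intro has_derivative_continuous[OF has_derivative_compose[OF _ g(1)]]) auto
  qed
  have "\<forall>\<^sub>F y in nhds p. g (y + d *\<^sub>R e) > 0"
    using order_tendstoD(1)[OF cont[OF pp, of d, unfolded continuous_at] g1] d g1
    by (simp add: eventually_nhds_conv_at)
  moreover have "\<forall>\<^sub>F y in nhds p. g (y + (- d) *\<^sub>R e) < 0"
    using order_tendstoD(2)[OF cont[OF pp, of "- d", unfolded continuous_at] g2] d g2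
    by (simp add: eventually_nhds_conv_at)
  moreover have "\<forall>\<^sub>F y in nhds p. dist y p < r / 2"
    unfolding eventually_nhds_metric using r(1) by (intro exI[of _ "r / 2"]) auto
  ultimately have "\<forall>\<^sub>F y in nhds p. h y = 1 \<longrightarrow> y \<in> S"
  proof eventually_elim
    case (elim y)
    show ?case
    proof
      assume hy: "h y = 1"
      have "\<exists>s\<ge>- d. s \<le> d \<and> g (y + s *\<^sub>R e) = 0"
        using elim d by (intro IVT) (auto intro!: DERIV_isCont[OF dg])
      then obtain s where "- d \<le> s" "s \<le> d" and s: "g (y + s *\<^sub>R e) = 0" by blast
      then have s: "\<bar>s\<bar> \<le> d" "g (y + s *\<^sub>R e) = 0" by linarith+
      have "y + s *\<^sub>R e \<in> V" using r(2)[OF near[OF elim(3) s(1)]] by blast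
      then have "y + s *\<^sub>R e \<in> S" using s SV by blast
      then have "h (y + s *\<^sub>R e) = 1" using Sh by blast
      \<comment> \<open>The function \<open>h\<close> takes the value 1 at both parameters 0 and
        \<open>s\<close> of the line, and its derivative along \<open>e\<close> has no zero between
        them.\<close>
      have "0 = s"
      proof (rule deriv_nonzero_strict[OF dh])
        fix x assume "x \<in> {min 0 s..max 0 s}"
        then have "\<bar>x\<bar> \<le> d" using s(1) by (auto simp: min_def max_def split: if_splits)
        then show "Gh (y + x *\<^sub>R e) \<bullet> e \<noteq> 0" using r(2)[OF near[OF elim(3)]] by blast
      qed (use hy \<open>h (y + s *\<^sub>R e) = 1\<close> in simp)
      then show "y \<in> S" using \<open>y + s *\<^sub>R e \<in> S\<close> by simp
    qed
  qed
  then show ?thesis unfolding eventually_nhds by blast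
qed

section \<open>Gradient and Hessian of the cubic on real vectors\<close>

lemma trilin_scaleR:
  fixes x :: "real^'n::finite"
  shows "trilin k (s *\<^sub>R x) y w = s * trilin k x y w" "trilin k x (s *\<^sub>R y) w = s * trilin k x y w"
    "trilin k x y (s *\<^sub>R w) = s * trilin k x y w"
  by (simp_all add: trilin_def sum_distrib_left mult_ac)

lemma trilin_real_has_derivative:
  fixes x :: "real^'n::finite"
  assumes k: "symmetric3 k"
  shows "(cubic k has_derivative (\<lambda>v. trilin k x x v / 2)) (at x)"
proof -
  have s: "trilin k v x x = trilin k x x v" "trilin k x v x = trilin k x x v" for v :: "real^'n"
    by (metis trilin_commute[OF k])+
  have "((\<lambda>x. trilin k x x x) has_derivative (\<lambda>v. 3 * trilin k x x v)) (at x)"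
    by (rule has_derivative_eq_rhs[OF trilin_has_derivative[OF has_derivative_ident has_derivative_ident has_derivative_ident]])
       (simp add: s fun_eq_iff)
  from bounded_linear.has_derivative[OF bounded_linear_divide this, of 6]
  have "((\<lambda>x. trilin k x x x / 6) has_derivative (\<lambda>v. trilin k x x v / 2)) (at x)"
    by (rule has_derivative_eq_rhs) (simp add: fun_eq_iff)
  moreover have "cubic k = (\<lambda>x :: real^'n. trilin k x x x / 6)"
    by (rule ext) (rule cubic_eq_trilin)
  ultimately show ?thesis by simp
qed

definition grad :: "('n::finite \<Rightarrow> 'n \<Rightarrow> 'n \<Rightarrow> real) \<Rightarrow> real^'n \<Rightarrow> real^'n" where
  "grad k x = (\<chi> a. trilin k x x (axis a 1) / 2)"

lemma grad_inner: "grad k x \<bullet> v = trilin k x x v / 2"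
proof -
  have "v = (\<Sum>a\<in>UNIV. v $ a *s axis a 1)"
    by (simp add: vec_eq_iff axis_def if_distrib sum.If_cases cong: if_cong)
  moreover have "trilin k x x (\<Sum>a\<in>UNIV. v $ a *s axis a 1) = (\<Sum>a\<in>UNIV. trilin k x x (axis a 1) * v $ a)"
    by (simp add: trilin_sum trilin_scale mult_ac)
  ultimately have "trilin k x x v = (\<Sum>a\<in>UNIV. trilin k x x (axis a 1) * v $ a)" by metis
  then show ?thesis by (simp add: grad_def inner_vec_def sum_divide_distrib)
qed

lemma hessian_cubic:
  fixes x :: "real^'n::finite"
  assumes k: "symmetric3 k"
  shows "D (\<lambda>x. D (cubic k) x v) x v = trilin k x v v"
proof -
  have eq: "(\<lambda>x. D (cubic k) x v) = (\<lambda>x. trilin k x x v / 2)"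
    using frechet_derivative_at[OF trilin_real_has_derivative[OF k]] by (metis)
  have "((\<lambda>x. trilin k x x v) has_derivative (\<lambda>u. 2 * trilin k x u v)) (at x)"
    by (rule has_derivative_eq_rhs[OF trilin_has_derivative[OF has_derivative_ident has_derivative_ident has_derivative_const]])
       (auto simp: fun_eq_iff intro: trilin_commute(1)[OF k])
  from has_derivative_mult_left[OF this, of "1 / 2"]
  have "((\<lambda>x. trilin k x x v / 2) has_derivative (\<lambda>u. trilin k x u v)) (at x)" by simp
  from frechet_derivative_at[OF this, symmetric] show ?thesis unfolding eq by simp
qed

lemma continuous_on_trilin [continuous_intros]:
  fixes f g h :: "'a::topological_space \<Rightarrow> real^'n::finite"
  assumes "continuous_on S f" "continuous_on S g" "continuous_on S h"
  shows "continuous_on S (\<lambda>x. trilin k (f x) (g x) (h x))"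
  unfolding trilin_def using assms by (intro continuous_intros) auto

section \<open>Openness of the cone and nondegeneracy of Im \<tau>\<close>

context
  fixes k :: "'n::finite \<Rightarrow> 'n \<Rightarrow> 'n \<Rightarrow> real" and H :: "(real^'n) set"
  assumes PSR: "PSR_manifold k H"
begin

lemma PSR_sym: "symmetric3 k"
  using PSR by (simp add: PSR_manifold_def symmetric3_def)

lemma PSR_cubic: "p \<in> H \<Longrightarrow> trilin k p p p = 6"
  using PSR by (auto simp: PSR_manifold_def cubic_eq_trilin)

lemma PSR_cubic_1: "p \<in> H \<Longrightarrow> cubic k p = 1"
  by (simp add: cubic_eq_trilin PSR_cubic)

lemma PSR_open_near:
  assumes p: "p \<in> H"
  shows "\<exists>V. open V \<and> p \<in> V \<and> (\<forall>x\<in>V. cubic k x = 1 \<longrightarrow> x \<in> H)"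
proof (rule hypersurface_open_in_level_set[where Gh = "grad k"])
  show "hypersurface H" "p \<in> H" "H \<subseteq> {x. cubic k x = 1}"
    using PSR p by (auto simp: PSR_manifold_def)
  show "(cubic k has_derivative (\<lambda>v. grad k x \<bullet> v)) (at x)" for x
    unfolding grad_inner by (rule trilin_real_has_derivative[OF PSR_sym])
  show "continuous_on UNIV (grad k)"
    unfolding grad_def by (intro continuous_on_vec_lambda continuous_intros) simp
  \<comment> \<open>By Euler's relation the gradient paired with \<open>p\<close> is 3 h(p) =
    3.\<close>
  show "grad k p \<noteq> 0" using PSR_cubic[OF p] grad_inner[of k p p] by auto
qed

lemma cubic_scaleR: "cubic k (s *\<^sub>R p) = s ^ 3 * cubic k (p :: real^'n)"
  by (simp add: cubic_eq_trilin trilin_scaleR power3_eq_cube)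

lemma cone_pos: "x \<in> cone H \<Longrightarrow> cubic k x > 0"
  by (auto simp: cone_def cubic_scaleR PSR_cubic_1)

text \<open>The radial map \<open>r\<close> onto the level set h = 1 is continuous where h > 0. The
  preimage of a neighbourhood in which this level set belongs to \<open>H\<close> is open and
  consists of multiples of points of \<open>H\<close>.\<close>

lemma open_cone: "open (cone H)"
proof (subst open_subopen, intro ballI)
  fix x assume "x \<in> cone H"
  then obtain s p where x: "x = s *\<^sub>R p" "s > 0" "p \<in> H" by (auto simp: cone_def)
  obtain V where V: "open V" "p \<in> V" "\<And>x. x \<in> V \<Longrightarrow> cubic k x = 1 \<Longrightarrow> x \<in> H"
    using PSR_open_near[OF x(3)] by blast
  define r where "r = (\<lambda>y :: real^'n. inverse (root 3 (cubic k y)) *\<^sub>R y)"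
  define P where "P = {y :: real^'n. cubic k y > 0}"
  have cc: "continuous_on A (cubic k)" for A :: "(real^'n) set"
    unfolding cubic_eq_trilin[abs_def] by (intro continuous_intros) simp
  have "open P" unfolding P_def by (intro open_Collect_less continuous_intros cc)
  moreover have "continuous_on P r"
    unfolding r_def by (intro continuous_intros cc) (auto simp: P_def)
  ultimately have "open (P \<inter> r -` V)" using V(1) by (auto intro: continuous_open_preimage)
  moreover have "r x = p"
  proof -
    have "cubic k x = s ^ 3" by (simp add: x cubic_scaleR PSR_cubic_1)
    then have "root 3 (cubic k x) = s" using x(2) by (simp add: real_root_power_cancel)
    then show ?thesis using x by (simp add: r_def)
  qed
  moreover have "x \<in> P" using cone_pos[OF \<open>x \<in> cone H\<close>] by (simp add: P_def)
  moreover have "P \<inter> r -` V \<subseteq> cone H"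
  proof
    fix y assume y: "y \<in> P \<inter> r -` V"
    define c where "c = root 3 (cubic k y)"
    have c: "c > 0" "c ^ 3 = cubic k y" using y by (auto simp: c_def P_def)
    have "cubic k (r y) = 1"
      unfolding r_def c_def[symmetric] cubic_scaleR using c(1) by (simp flip: c(2) add: power_mult_distrib[symmetric])
    then have "r y \<in> H" using y V by blast
    moreover have "y = c *\<^sub>R r y" using c(1) by (simp add: r_def c_def[symmetric])
    ultimately show "y \<in> cone H" unfolding cone_def using c(1) by blast
  qed
  ultimately show "\<exists>T. open T \<and> x \<in> T \<and> T \<subseteq> cone H" using V(2) by blast
qed

text \<open>The line through \<open>p\<close> in the direction \<open>v\<close> is projected
  radially to the level set. As \<open>trilin k p p v\<close> vanishes, the normalizing factor has
  derivative 0 at the parameter 0, and the velocity there is still \<open>v\<close>.\<close>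

lemma kernel_is_tangent:
  assumes p: "p \<in> H" and v: "trilin k p p v = 0"
  shows "v \<in> tangent_vectors H p"
proof -
  obtain V where V: "open V" "p \<in> V" "\<And>x. x \<in> V \<Longrightarrow> cubic k x = 1 \<Longrightarrow> x \<in> H"
    using PSR_open_near[OF p] by blast
  define r where "r = (\<lambda>s. inverse (root 3 (cubic k (p + s *\<^sub>R v))) *\<^sub>R (p + s *\<^sub>R v))"
  have c1: "cubic k p = 1" by (simp add: cubic_eq_trilin PSR_cubic[OF p])
  have dc: "((\<lambda>s. cubic k (p + s *\<^sub>R v)) has_real_derivative trilin k (p + s *\<^sub>R v) (p + s *\<^sub>R v) v / 2) (at s)" for s
  proof -
    have "((\<lambda>s. p + s *\<^sub>R v) has_derivative (\<lambda>s. s *\<^sub>R v)) (at s)" by (auto intro!: derivative_eq_intros)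
    from has_derivative_compose[OF this trilin_real_has_derivative[OF PSR_sym]] show ?thesis
      unfolding has_field_derivative_def
      by (rule has_derivative_eq_rhs) (simp add: trilin_scaleR fun_eq_iff)
  qed
  have isc: "isCont (\<lambda>s. cubic k (p + s *\<^sub>R v)) s" for s using DERIV_isCont[OF dc] .
  have r0: "r 0 = p" by (simp add: r_def c1)
  have "((\<lambda>s. inverse (root 3 (cubic k (p + s *\<^sub>R v)))) has_real_derivative 0) (at 0)"
  proof -
    have "((\<lambda>s. root 3 (cubic k (p + s *\<^sub>R v))) has_real_derivative inverse (real 3 * root 3 (cubic k (p + 0 *\<^sub>R v)) ^ (3 - Suc 0)) * (trilin k (p + 0 *\<^sub>R v) (p + 0 *\<^sub>R v) v / 2)) (at 0)"
      by (rule DERIV_chain2[OF DERIV_real_root dc]) (simp_all add: c1)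
    then have "((\<lambda>s. root 3 (cubic k (p + s *\<^sub>R v))) has_real_derivative 0) (at 0)" using v by simp
    from DERIV_inverse_fun[OF this] show ?thesis by (simp add: c1)
  qed
  then have dr: "(r has_vector_derivative v) (at 0)"
    unfolding r_def
    by (rule has_vector_derivative_eq_rhs[OF has_vector_derivative_scaleR])
       (auto intro!: derivative_eq_intros simp: c1)
  have "continuous (at 0) r" by (rule has_vector_derivative_continuous[OF dr])
  then have "\<forall>\<^sub>F s in nhds 0. r s \<in> V"
    using V r0 by (intro eventually_nhds_conv_at[THEN iffD2]) (auto simp: continuous_at topological_tendstoD)
  moreover have "\<forall>\<^sub>F s in nhds 0. cubic k (p + s *\<^sub>R v) > 0"
    using isc[of 0] c1 by (intro eventually_nhds_conv_at[THEN iffD2]) (auto simp: isCont_def order_tendstoD(1))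
  ultimately have "\<forall>\<^sub>F s in nhds 0. r s \<in> V \<and> cubic k (p + s *\<^sub>R v) > 0" by eventually_elim simp
  then obtain e where e: "e > 0" "\<And>s. \<bar>s\<bar> < e \<Longrightarrow> r s \<in> V \<and> cubic k (p + s *\<^sub>R v) > 0"
    unfolding eventually_nhds_metric by (auto simp: dist_real_def)
  have rH: "r s \<in> H" if "\<bar>s\<bar> < e" for s
  proof -
    define c where "c = root 3 (cubic k (p + s *\<^sub>R v))"
    have c: "c > 0" "c ^ 3 = cubic k (p + s *\<^sub>R v)" using e(2)[OF that] by (auto simp: c_def)
    have "cubic k (r s) = 1"
      unfolding r_def c_def[symmetric] cubic_scaleR using c(1) by (simp flip: c(2) add: power_mult_distrib[symmetric])
    then show ?thesis using e(2)[OF that] V by blast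
  qed
  \<comment> \<open>\<open>tangent_vectors\<close> wants a curve in \<open>H\<close> on the whole
    real line, but \<open>r\<close> is known to lie in \<open>H\<close> only for parameters below
    \<open>e\<close>. A sine of amplitude \<open>e / 2\<close> with slope 1 at 0 keeps the parameter
    in this range.\<close>
  define \<phi> where "\<phi> = (\<lambda>s. e / 2 * sin (2 / e * s))"
  have "(\<phi> has_real_derivative 1) (at 0)"
    unfolding \<phi>_def using e(1) by (auto intro!: derivative_eq_intros)
  then have d\<phi>: "(\<phi> has_vector_derivative 1) (at 0)" by (simp add: has_real_derivative_iff_has_vector_derivative)
  have "\<phi> 0 = 0" by (simp add: \<phi>_def)
  then have "((r \<circ> \<phi>) has_vector_derivative v) (at 0)"
    using vector_diff_chain_at[OF d\<phi>, of r v] dr by simp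
  moreover have "(r \<circ> \<phi>) s \<in> H" for s
  proof -
    have "\<bar>\<phi> s\<bar> \<le> e / 2 * 1"
      unfolding \<phi>_def abs_mult using e(1) by (intro mult_mono) auto
    then show ?thesis using rH[of "\<phi> s"] e(1) by simp
  qed
  moreover have "(r \<circ> \<phi>) 0 = p" by (simp add: r0 \<open>\<phi> 0 = 0\<close>)
  ultimately show ?thesis unfolding tangent_vectors_def by blast
qed

text \<open>The Hessian is known to be definite only on tangent spaces. A vector of its radical is
  however tangent, as taking \<open>u = p\<close> shows, and the Hessian vanishes on it, contrary to
  definiteness.\<close>

lemma cone_nondegenerate:
  assumes t: "t \<in> cone H" and v: "\<And>u. trilin k t u v = 0"
  shows "v = 0"
proof (rule ccontr)
  assume ne: "v \<noteq> 0"
  obtain s p where x: "t = s *\<^sub>R p" "s > 0" "p \<in> H" using t by (auto simp: cone_def)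
  have p: "trilin k p u v = 0" for u
    using v[of u] x by (simp add: trilin_scaleR)
  have "v \<in> tangent_vectors H p" by (rule kernel_is_tangent[OF x(3) p])
  then have "- D (\<lambda>x. D (cubic k) x v) p v > 0"
    using PSR ne x(3) by (auto simp: PSR_manifold_def)
  then show False using p by (simp add: hessian_cubic[OF PSR_sym])
qed

text \<open>By homogeneity \<tau> is evaluated at Z^0 = 1. The components \<open>Some a\<close> say
  that \<open>tail c - c $ None *s b\<close> is in the radical of the Hessian at \<open>t\<close>,
  so \<open>tail c\<close> is a multiple of \<open>b\<close>; then the component \<open>None\<close>
  reduces to \<open>c $ None\<close> times a positive multiple of h(t).\<close>

lemma tau_nondegenerate:
  assumes Z: "Z \<in> csk H" and c: "\<And>i. Im (dF k Z (cvec c) $ i) = 0"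
  shows "c = 0"
proof -
  obtain Z0 z where Zz: "Z = Z0 *s homog z" "Z0 \<noteq> 0" "z \<in> Mbar H" using Z by (auto simp: csk_def)
  define b t where "b = (\<chi> a. Re (z $ a))" and "t = (\<chi> a. Im (z $ a))"
  have z: "z = cvec b + \<i> *s cvec t"
    by (auto simp: vec_eq_iff b_def t_def cvec_def complex_eq_iff)
  have t: "t \<in> cone H" using Zz(3) by (simp add: Mbar_def t_def)
  have dFi: "Im (dF k (homog z) (cvec c) $ i) = 0" for i
    using c[of i] Zz by (simp add: dF_scale)
  have cn: "cvec c $ None = of_real (c $ None)" by (simp add: cvec_def)
  have ax: "axis a (1::complex) = cvec (axis a 1)" for a :: 'n by (auto simp: vec_eq_iff cvec_def axis_def)
  have s: "trilin k t b b = trilin k b b t" "trilin k b t b = trilin k b b t" 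
     "trilin k t b t = trilin k b t t" "trilin k t t b = trilin k b t t"
    by (metis trilin_commute[OF PSR_sym])+
  have d: "trilin k t u (tail c - c $ None *s b) = 0" for u
  proof -
    have "trilin k t (tail c - c $ None *s b) (axis a 1) = 0" for a
      using dFi[of "Some a"] trilin_commute(1)[OF PSR_sym, of b t "axis a 1"]
      unfolding dF_def cn
      by (simp add: ax) (simp add: z trilin_add trilin_diff trilin_scale trilin_cvec algebra_simps)
    then have "(\<chi> a. trilin k t (tail c - c $ None *s b) (axis a 1)) = 0" by (simp add: vec_eq_iff)
    moreover have "trilin k t (tail c - c $ None *s b) u = (\<Sum>a\<in>UNIV. u $ a * trilin k t (tail c - c $ None *s b) (axis a 1))"
    proof -
      have "u = (\<Sum>a\<in>UNIV. u $ a *s axis a 1)"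
        by (simp add: vec_eq_iff axis_def if_distrib sum.If_cases cong: if_cong)
      then have "trilin k t (tail c - c $ None *s b) u = trilin k t (tail c - c $ None *s b) (\<Sum>a\<in>UNIV. u $ a *s axis a 1)" by metis
      then show ?thesis by (simp add: trilin_sum trilin_scale)
    qed
    ultimately have "trilin k t (tail c - c $ None *s b) u = 0" by (simp add: vec_eq_iff)
    then show ?thesis using trilin_commute(2)[OF PSR_sym] by metis
  qed
  then have tc: "tail c = c $ None *s b" using cone_nondegenerate[OF t] by (metis eq_iff_diff_eq_0)
  have "c $ None * trilin k t t t = 0"
    using dFi[of None] unfolding dF_def cn
    by (simp add: tc) (simp add: z vector_smult_assoc trilin_add trilin_scale trilin_cvec s algebra_simps)
  moreover have "trilin k t t t > 0" using cone_pos[OF t] by (simp add: cubic_eq_trilin)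
  ultimately have "c $ None = 0" by simp
  then show ?thesis using tc by (auto simp: vec_eq_iff tail_def) (metis option.exhaust)
qed

lemma rsq_pos: "Z \<in> csk H \<Longrightarrow> rsq k Z > 0"
  using cone_pos by (auto simp: csk_def rsq_homog[OF PSR_sym] himag_def Mbar_def)

lemma open_Mbar: "open (Mbar H)"
proof -
  have "open ((\<lambda>z :: complex^'n. \<chi> a. Im (z $ a)) -` cone H)"
    by (intro open_vimage open_cone continuous_on_vec_lambda continuous_intros)
  then show ?thesis by (simp add: Mbar_def vimage_def)
qed

end

section \<open>The flow and the twistor space as a set of orbits\<close>

lemma cis_has_vector_derivative:
  "((\<lambda>s. cis (r * s)) has_vector_derivative (\<i> * of_real r * cis (r * s))) (at s)"
proof -
  have *: "cis (r * t) = exp (t *\<^sub>R (\<i> * of_real r))" for t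
    by (simp add: cis_conv_exp scaleR_conv_of_real mult_ac)
  show ?thesis
    using exp_scaleR_has_vector_derivative_right[of "\<i> * of_real r" s UNIV] unfolding * by (simp add: mult_ac)
qed

text \<open>Uniqueness by the integrating factor \<open>cis (- (r * s))\<close>, whose product with
  \<open>f\<close> is constant.\<close>

lemma linear_ode:
  assumes "\<And>s. (f has_vector_derivative (\<i> * of_real r * f s)) (at s)"
  shows "f s = cis (r * s) * f (0::real)"
proof -
  have "((\<lambda>s. cis (- (r * s)) * f s) has_derivative (\<lambda>h. 0)) (at s within UNIV)" for s
  proof -
    have "((\<lambda>s. cis (- (r * s))) has_vector_derivative (- \<i> * of_real r * cis (- (r * s)))) (at s)"
      using cis_has_vector_derivative[of "- r" s] by simp
    from has_vector_derivative_mult[OF this assms[of s]]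
    show ?thesis unfolding has_vector_derivative_def by (simp add: algebra_simps)
  qed
  then obtain c where c: "\<And>s. cis (- (r * s)) * f s = c"
    using has_derivative_zero_constant[of UNIV "\<lambda>s. cis (- (r * s)) * f s"] by auto
  have "f s = cis (r * s) * (cis (- (r * s)) * f s)" by (simp add: mult.assoc[symmetric] cis_mult)
  also have "\<dots> = cis (r * s) * f 0" using c[of s] c[of 0] by simp
  finally show ?thesis .
qed

text \<open>The weights 1, - 1, - 2 of z, w, Z are those of \<open>V3L\<close>; the last comes from
  the factor 2 in \<open>V3\<close>.\<close>

definition flow :: "real \<Rightarrow> 'n::finite npoint \<Rightarrow> 'n npoint" where
  "flow s = (\<lambda>(z, w, Z, p). (cis s * z, cis (- s) * w, cis (- 2 * s) *s Z, p))"

definition orbit :: "'n::finite npoint \<Rightarrow> 'n npoint set" where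
  "orbit q = range (\<lambda>s. flow s q)"

lemma flow_0 [simp]: "flow 0 q = q"
  by (cases q) (simp add: flow_def)

lemma flow_add: "flow s (flow t q) = flow (s + t) q"
proof -
  have "cis (s + t) = cis s * cis t" "cis (- (s + t)) = cis (- s) * cis (- t)"
    "cis (- 2 * (s + t)) = cis (- 2 * s) * cis (- 2 * t)"
    by (simp_all add: cis_mult algebra_simps)
  then show ?thesis
    by (cases q) (simp only: flow_def prod.case vector_smult_assoc mult.assoc)
qed

lemma act_flow: "act x (flow s q) = flow s (act x q)"
  by (cases q) (simp add: flow_def act_def algebra_simps)

lemma act_act: "act x (act y q) = act (x * y) q"
  by (cases q) (simp add: act_def mult.assoc)

lemma act_1 [simp]: "act 1 q = q"
  by (cases q) (simp add: act_def)

lemma mem_csk: "Z \<in> csk H \<longleftrightarrow> Z $ None \<noteq> 0 \<and> (\<chi> a. Z $ Some a / Z $ None) \<in> Mbar H"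
proof
  assume "Z \<in> csk H"
  then obtain Z0 z where "Z0 \<noteq> 0" "z \<in> Mbar H" "Z = Z0 *s homog z" by (auto simp: csk_def)
  moreover from this have "(\<chi> a. Z $ Some a / Z $ None) = z" by (simp add: vec_eq_iff homog_def)
  ultimately show "Z $ None \<noteq> 0 \<and> (\<chi> a. Z $ Some a / Z $ None) \<in> Mbar H"
    by (simp add: homog_def)
next
  assume *: "Z $ None \<noteq> 0 \<and> (\<chi> a. Z $ Some a / Z $ None) \<in> Mbar H"
  have "Z = (Z $ None) *s homog (\<chi> a. Z $ Some a / Z $ None)"
    using * by (auto simp: vec_eq_iff homog_def split: option.split)
  then show "Z \<in> csk H" unfolding csk_def mem_Collect_eq using * by (intro exI conjI) auto
qed

lemma csk_scale: "c \<noteq> 0 \<Longrightarrow> c *s Z \<in> csk H \<longleftrightarrow> Z \<in> csk H"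
  by (simp add: mem_csk)

lemma flow_Ntilde: "flow s q \<in> Ntilde H \<longleftrightarrow> q \<in> Ntilde H"
  by (cases q) (auto simp: flow_def Ntilde_def csk_scale)

lemma act_Ntilde: "x \<noteq> 0 \<Longrightarrow> act x q \<in> Ntilde H \<longleftrightarrow> q \<in> Ntilde H"
  by (cases q) (auto simp: act_def Ntilde_def)

lemma flow_has_vector_derivative:
  "((\<lambda>s. flow s q) has_vector_derivative V3L (flow s q)) (at s)"
proof -
  obtain z w Z zt y \<sigma> where q: "q = (z, w, Z, zt, y, \<sigma>)" by (cases q)
  have cis: "((\<lambda>s. cis (r * s) * c) has_vector_derivative (\<i> * of_real r * (cis (r * s) * c))) (at s)" for r c
    using bounded_linear.has_vector_derivative[OF bounded_linear_mult_left cis_has_vector_derivative]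
    by (simp add: mult.assoc)
  have "bounded_linear (\<lambda>c. c *s Z)"
    by (auto simp: linear_conv_bounded_linear[symmetric] vec_eq_iff algebra_simps intro!: linearI)
  from bounded_linear.has_vector_derivative[OF this cis_has_vector_derivative[of "-2" s]]
  have "((\<lambda>s. cis (- 2 * s) *s Z) has_vector_derivative - V3 (cis (- 2 * s) *s Z)) (at s)"
    by (simp add: V3_def vector_smult_assoc mult_ac)
  then show ?thesis
    unfolding q flow_def V3L_def using cis[of 1 z] cis[of "-1" w]
    by (auto intro!: has_vector_derivative_Pair)
qed

lemma integral_curve_eq_flow:
  assumes "\<And>s. (\<gamma> has_vector_derivative V3L (\<gamma> s)) (at s)"
  shows "\<gamma> s = flow s (\<gamma> 0)"
proof -
  have comp: "((\<lambda>s. h (\<gamma> s)) has_vector_derivative h (V3L (\<gamma> s))) (at s)" if "bounded_linear h" for h :: "'a npoint \<Rightarrow> 'b::real_normed_vector" and s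
    using bounded_linear.has_vector_derivative[OF that assms] .
  have V: "fst (V3L q) = \<i> * fst q" "fst (snd (V3L q)) = - \<i> * fst (snd q)"
     "fst (snd (snd (V3L q))) $ i = - 2 * \<i> * fst (snd (snd q)) $ i" "snd (snd (snd (V3L q))) = 0" for q :: "'a npoint" and i
    unfolding V3L_def V3_def case_prod_beta by (simp_all add: prod_eq_iff)
  have c: "\<i> * of_real (- 1) = - \<i>" "\<i> * of_real (- 2) = - 2 * \<i>" by simp_all
  have "((\<lambda>s. fst (\<gamma> s)) has_vector_derivative \<i> * of_real 1 * fst (\<gamma> s)) (at s)" for s
    using comp[OF bounded_linear_fst, of s] unfolding V of_real_1 mult_1_right .
  from linear_ode[OF this, of s] have 1: "fst (\<gamma> s) = cis s * fst (\<gamma> 0)" by simp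
  have "((\<lambda>s. fst (snd (\<gamma> s))) has_vector_derivative \<i> * of_real (- 1) * fst (snd (\<gamma> s))) (at s)" for s
    using comp[OF bounded_linear_fst_comp[OF bounded_linear_snd], of s] unfolding V c(1) .
  from linear_ode[OF this, of s] have 2: "fst (snd (\<gamma> s)) = cis (-s) * fst (snd (\<gamma> 0))" by simp
  have "((\<lambda>s. fst (snd (snd (\<gamma> s))) $ i) has_vector_derivative
      \<i> * of_real (- 2) * fst (snd (snd (\<gamma> s))) $ i) (at s)" for s i
    using comp[OF bounded_linear_compose[OF bounded_linear_vec_nth
        bounded_linear_fst_comp[OF bounded_linear_snd_comp[OF bounded_linear_snd]]], of i s]
    unfolding V c(2) .
  from linear_ode[OF this] have 3: "fst (snd (snd (\<gamma> s))) $ i = cis (- 2 * s) * fst (snd (snd (\<gamma> 0))) $ i" for i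
    by metis
  have 4: "snd (snd (snd (\<gamma> s))) = snd (snd (snd (\<gamma> 0)))"
    using has_vector_derivative_zero_constant[of UNIV "\<lambda>s. snd (snd (snd (\<gamma> s)))"] comp[of "\<lambda>x. snd (snd (snd x))"]
    by (force simp: V bounded_linear_snd_comp bounded_linear_ident)
  have 3: "fst (snd (snd (\<gamma> s))) = cis (- 2 * s) *s fst (snd (snd (\<gamma> 0)))"
    using 3 by (simp add: vec_eq_iff)
  show ?thesis
    unfolding flow_def case_prod_beta using 1 2 3 4 by (simp add: prod_eq_iff)
qed

lemma Nhat_eq: "Nhat H = orbit ` Ntilde H"
proof (intro equalityI subsetI)
  fix c assume "c \<in> Nhat H"
  then obtain \<gamma> where \<gamma>: "c = range \<gamma>" "\<And>s. \<gamma> s \<in> Ntilde H" "\<And>s. (\<gamma> has_vector_derivative V3L (\<gamma> s)) (at s)"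
    by (auto simp: Nhat_def integral_curves_def)
  have "c = orbit (\<gamma> 0)"
    unfolding orbit_def \<gamma>(1) by (rule arg_cong[where f = range]) (rule ext, rule integral_curve_eq_flow[OF \<gamma>(3)])
  then show "c \<in> orbit ` Ntilde H" using \<gamma> by blast
next
  fix c assume "c \<in> orbit ` Ntilde H"
  then show "c \<in> Nhat H"
    unfolding Nhat_def integral_curves_def orbit_def
    using flow_has_vector_derivative flow_Ntilde by blast
qed

lemma orbit_self: "q \<in> orbit q"
  unfolding orbit_def by (metis flow_0 rangeI)

lemma orbit_flow: "orbit (flow s q) = orbit q"
proof -
  have "flow t q = flow (t - s) (flow s q)" for t by (simp add: flow_add)
  then show ?thesis unfolding orbit_def flow_add by blast
qed

lemma orbit_eq: "p \<in> orbit q \<Longrightarrow> orbit p = orbit q"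
  by (auto simp: orbit_def[of q] orbit_flow)

lemma act_orbit: "act x ` orbit q = orbit (act x q)"
  by (simp add: orbit_def image_image act_flow)

lemma curve_through_eq: "q \<in> Ntilde H \<Longrightarrow> curve_through H q = orbit q"
proof -
  assume q: "q \<in> Ntilde H"
  have "{c \<in> Nhat H. q \<in> c} = {orbit q}"
    unfolding Nhat_eq using orbit_eq orbit_self q by blast
  then show ?thesis by (simp add: curve_through_def)
qed

section \<open>Orbits of the action of the nonzero complex numbers and elements of the line
  bundle\<close>

definition tw_class :: "'n::finite npoint \<Rightarrow> 'n npoint set set" where
  "tw_class q = {orbit (act x q) |x. x \<noteq> 0}"

lemma tw_class_altdef: "tw_class q = {act x ` orbit q |x. x \<noteq> 0}"
  by (simp add: tw_class_def act_orbit)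

lemma twistor_space_eq: "twistor_space H = tw_class ` Ntilde H"
  unfolding twistor_space_def Nhat_eq tw_class_altdef[abs_def] by blast

lemma mem_tw_class: "p \<in> \<Union>(tw_class q) \<longleftrightarrow> (\<exists>x s. x \<noteq> 0 \<and> p = act x (flow s q))"
  unfolding tw_class_altdef orbit_def by blast

lemma tw_class_act: 
  assumes x: "x \<noteq> 0" shows "tw_class (act x q) = tw_class q"
proof (intro equalityI subsetI)
  fix c assume "c \<in> tw_class q"
  then obtain y where "y \<noteq> 0" "c = orbit (act y q)" by (auto simp: tw_class_def)
  then have "c = orbit (act (y / x) (act x q))" "y / x \<noteq> 0" using x by (auto simp: act_act)
  then show "c \<in> tw_class (act x q)" unfolding tw_class_def by blast
next
  fix c assume "c \<in> tw_class (act x q)"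
  then obtain y where "y \<noteq> 0" "c = orbit (act (y * x) q)" by (auto simp: tw_class_def act_act)
  then show "c \<in> tw_class q" unfolding tw_class_def using x by (auto intro!: exI[of _ "y * x"])
qed

lemma tw_class_flow: "tw_class (flow s q) = tw_class q"
  by (simp add: tw_class_def act_flow orbit_flow)

lemma tw_class_eq: "p \<in> \<Union>(tw_class q) \<Longrightarrow> tw_class p = tw_class q"
  unfolding mem_tw_class by (auto simp: tw_class_act tw_class_flow)

lemma tw_class_self: "q \<in> \<Union>(tw_class q)"
  unfolding mem_tw_class by (metis act_1 flow_0 zero_neq_one)

lemma twistor_class_eq: "q \<in> Ntilde H \<Longrightarrow> twistor_class H q = tw_class q"
proof -
  assume q: "q \<in> Ntilde H"
  have "{P \<in> twistor_space H. q \<in> \<Union>P} = {tw_class q}"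
    unfolding twistor_space_eq using tw_class_eq tw_class_self q by blast
  then show ?thesis by (simp add: twistor_class_def)
qed

lemma Union_tw_class_Ntilde: "q \<in> Ntilde H \<Longrightarrow> p \<in> \<Union>(tw_class q) \<Longrightarrow> p \<in> Ntilde H"
  unfolding mem_tw_class by (auto simp: act_Ntilde flow_Ntilde)

text \<open>The defining relation of the associated bundle. It makes the values of sections and of
  the contact form independent of the chosen point over the twistor space.\<close>

lemma L_elem_act: 
  assumes "x \<noteq> 0" shows "L_elem (act x ` c) (x\<^sup>2 * y) = L_elem c y"
proof -
  have *: "act u ` act v ` c = act (u * v) ` c" for u v by (simp add: image_image act_act)
  show ?thesis
  proof (intro equalityI subsetI)
    fix l assume "l \<in> L_elem (act x ` c) (x\<^sup>2 * y)"
    then obtain u where "u \<noteq> 0" "l = (act u ` act x ` c, u\<^sup>2 * (x\<^sup>2 * y))" by (auto simp: L_elem_def)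
    then have "l = (act (u * x) ` c, (u * x)\<^sup>2 * y)" "u * x \<noteq> 0"
      using assms by (auto simp: * power_mult_distrib)
    then show "l \<in> L_elem c y" unfolding L_elem_def by blast
  next
    fix l assume "l \<in> L_elem c y"
    then obtain u where "u \<noteq> 0" "l = (act u ` c, u\<^sup>2 * y)" by (auto simp: L_elem_def)
    then have "l = (act (u / x) ` act x ` c, (u / x)\<^sup>2 * (x\<^sup>2 * y))" "u / x \<noteq> 0"
      using assms by (auto simp: * power_divide)
    then show "l \<in> L_elem (act x ` c) (x\<^sup>2 * y)" unfolding L_elem_def by blast
  qed
qed

lemma L_scale_L_elem: "L_scale a (L_elem c y) = L_elem c (a * y)"
  unfolding L_scale_def L_elem_def by (simp add: setcompr_eq_image image_image mult.left_commute)

text \<open>The flow carries a point into the slice \<open>Z\<^sup>0 > 0\<close> by rotating \<open>w / z\<close> along with \<open>Z\<^sup>0\<close>, whence the factor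
  \<open>cnj Z\<^sup>0 / \<bar>Z\<^sup>0\<bar>\<close>.\<close>

definition projf :: "('n::finite \<Rightarrow> 'n \<Rightarrow> 'n \<Rightarrow> real) \<Rightarrow> 'n npoint \<Rightarrow> 'n tpoint" where
  "projf k = (\<lambda>(z, w, Z, \<zeta>t, \<zeta>, \<sigma>).
     (((\<chi> a. Z $ Some a / Z $ None), pi / 4 * fM k Z, \<zeta>t, - \<zeta>, 4 * pi * \<sigma>),
      w / z * (cnj (Z $ None) / of_real (norm (Z $ None)))))"

lemma projf_slice: "q \<in> slice H \<Longrightarrow> slice_coords k q = projf k q"
proof -
  assume q: "q \<in> slice H"
  obtain z w Z zt y \<sigma> where qe: "q = (z, w, Z, zt, y, \<sigma>)" by (cases q)
  have "Im (Z $ None) = 0" "Re (Z $ None) > 0" using q by (auto simp: qe slice_def)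
  then have "Z $ None = of_real (Re (Z $ None))" by (simp add: complex_eq_iff)
  then have "cnj (Z $ None) / of_real (norm (Z $ None)) = 1"
    using \<open>Re (Z $ None) > 0\<close> by (metis abs_of_pos complex_cnj_complex_of_real divide_self_if norm_of_real of_real_eq_0_iff less_irrefl)
  then show ?thesis by (simp add: slice_coords_def projf_def qe)
qed

lemma projf_act: "x \<noteq> 0 \<Longrightarrow> projf k (act x q) = projf k q"
  by (cases q) (simp add: projf_def act_def)

lemma slice_exists: 
  assumes "q \<in> Ntilde H" shows "\<exists>s. flow s q \<in> slice H"
proof -
  obtain z w Z zt y \<sigma> where q: "q = (z, w, Z, zt, y, \<sigma>)" by (cases q)
  have Z: "Z $ None \<noteq> 0" using assms by (auto simp: q Ntilde_def mem_csk)
  have "cis (- Arg (Z $ None)) * Z $ None = of_real (norm (Z $ None))"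
    by (subst (2) rcis_cmod_Arg[symmetric]) (simp add: rcis_def cis_mult mult.left_commute)
  \<comment> \<open>\<open>flow s\<close> turns \<open>Z $ None\<close> by the angle - 2 s, hence
    half of the argument.\<close>
  then have "flow (Arg (Z $ None) / 2) q \<in> slice H"
    using Z flow_Ntilde[of "Arg (Z $ None) / 2" q H] assms by (auto simp: q flow_def slice_def)
  then show ?thesis ..
qed

section \<open>The contact form in lifted coordinates\<close>

lemma bounded_bilinear_smult: "bounded_bilinear (\<lambda>c (v :: complex^'m::finite). c *s v)"
  unfolding bilinear_conv_bounded_bilinear[symmetric] bilinear_def
  by (auto intro!: linearI simp: vec_eq_iff algebra_simps)

lemma bounded_bilinear_dot: "bounded_bilinear (dot :: complex^'m::finite \<Rightarrow> _)"
  unfolding bilinear_conv_bounded_bilinear[symmetric] bilinear_def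
  by (auto intro!: linearI simp: dot_def algebra_simps sum.distrib scaleR_sum_right)

lemma bounded_linear_cvec: "bounded_linear (cvec :: real^'m::finite \<Rightarrow> _)"
  unfolding linear_conv_bounded_linear[symmetric]
  by (auto intro!: linearI simp: cvec_def vec_eq_iff complex_eq_iff)

lemma bounded_linear_cnjvec: "bounded_linear (cnjvec :: complex^'m::finite \<Rightarrow> _)"
  unfolding linear_conv_bounded_linear[symmetric]
  by (auto intro!: linearI simp: vec_eq_iff)

lemmas C2_smult = C2_bilinear[OF bounded_bilinear_smult]
lemmas C2_dot = C2_bilinear[OF bounded_bilinear_dot]
lemmas C2_cvec = C2_linear_compose[OF bounded_linear_cvec]
lemmas C2_cnjvec = C2_linear_compose[OF bounded_linear_cnjvec]
lemmas has_derivative_smult = bounded_bilinear.FDERIV[OF bounded_bilinear_smult]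
lemmas has_derivative_dot = bounded_bilinear.FDERIV[OF bounded_bilinear_dot]
lemmas has_derivative_cvec = bounded_linear.has_derivative[OF bounded_linear_cvec]
lemmas has_derivative_cnjvec = bounded_linear.has_derivative[OF bounded_linear_cnjvec]

lemma C2_dprepot_vec:
  assumes k: "symmetric3 k" and S: "open S" and f: "C2 S f" and nz: "\<And>x. x \<in> S \<Longrightarrow> f x $ None \<noteq> 0"
  shows "C2 S (\<lambda>x. dprepot k (f x))"
  using C2_vec[of S "\<lambda>i x. dprepot k (f x) $ i"] C2_dprepot[OF k S C2_nth[OF f] nz]
  by (simp add: vec_nth_inverse)

lemma cnjvec_simps: "cnjvec (x + y) = cnjvec x + cnjvec y" "cnjvec (- x) = - cnjvec x" 
  "cnjvec (c *s x) = cnj c *s cnjvec x" "cnjvec (cnjvec x) = x" "cnjvec (cvec r) = cvec r"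
  by (simp_all add: vec_eq_iff cvec_def)

lemma cvec_minus: "cvec (- x) = - cvec x"
  by (simp add: cvec_def vec_eq_iff)

lemma pairing_eq_dot: "pairing v w = dot (fst v) (snd w) - dot (snd v) (fst w)"
  by (simp add: pairing_def dot_def sum_subtractf)

abbreviation pz :: "'n::finite npoint \<Rightarrow> complex" where "pz q \<equiv> fst q"
abbreviation pw :: "'n::finite npoint \<Rightarrow> complex" where "pw q \<equiv> fst (snd q)"
abbreviation pZ :: "'n::finite npoint \<Rightarrow> complex^('n option)" where "pZ q \<equiv> fst (snd (snd q))"
abbreviation pt :: "'n::finite npoint \<Rightarrow> real^('n option)" where "pt q \<equiv> fst (snd (snd (snd q)))"
abbreviation py :: "'n::finite npoint \<Rightarrow> real^('n option)" where "py q \<equiv> fst (snd (snd (snd (snd q))))"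
abbreviation ps :: "'n::finite npoint \<Rightarrow> real" where "ps q \<equiv> snd (snd (snd (snd (snd q))))"

lemma np_has_derivative:
  "(pz has_derivative pz) F" "(pw has_derivative pw) F" "(pZ has_derivative pZ) F"
  "(pt has_derivative pt) F" "(py has_derivative py) F" "(ps has_derivative ps) F"
  by (auto intro!: bounded_linear_imp_has_derivative bounded_linear_fst_comp bounded_linear_snd_comp bounded_linear_ident)

lemma C2_np:
  "C2 S pz" "C2 S pw" "C2 S pZ" "C2 S pt" "C2 S py" "C2 S ps"
  by (intro C2_fst C2_snd C2_id)+

text \<open>The parts of \<xi>~ and, with \<open>cb\<close> below, of \<xi> that depend on z, w and
  Z. Both are invariant under \<open>flow\<close> and \<open>act\<close>, although their factors are
  not.\<close>

definition ca :: "('n::finite \<Rightarrow> 'n \<Rightarrow> 'n \<Rightarrow> real) \<Rightarrow> 'n npoint \<Rightarrow> complex^('n option)" where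
  "ca k q = (- \<i> * pi * (pz q / pw q)) *s dprepot k (pZ q) + (- \<i> * pi * (pw q / pz q)) *s cnjvec (dprepot k (pZ q))"

definition cb :: "'n::finite npoint \<Rightarrow> complex^('n option)" where
  "cb q = (- \<i> * pi * (pz q / pw q)) *s pZ q + (- \<i> * pi * (pw q / pz q)) *s cnjvec (pZ q)"

definition cxi :: "'n::finite npoint \<Rightarrow> complex^('n option)" where
  "cxi q = - cvec (py q) + cb q"

definition cxit :: "('n::finite \<Rightarrow> 'n \<Rightarrow> 'n \<Rightarrow> real) \<Rightarrow> 'n npoint \<Rightarrow> complex^('n option)" where
  "cxit k q = cvec (pt q) + ca k q"

text \<open>Both pairings carry a minus sign because \<zeta> is minus \<zeta>' under the
  identification.\<close>

definition calpha :: "('n::finite \<Rightarrow> 'n \<Rightarrow> 'n \<Rightarrow> real) \<Rightarrow> 'n npoint \<Rightarrow> complex" where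
  "calpha k q = of_real (4 * pi * ps q) - dot (ca k q) (cvec (py q)) - dot (cb q) (cvec (pt q))"

text \<open>The part of \<open>Ntilde\<close> lying over \<open>twistor_space_0\<close>, where z / w
  and w / z both make sense.\<close>

definition N0 :: "(real^'n::finite) set \<Rightarrow> 'n npoint set" where
  "N0 H = {q. pz q \<noteq> 0 \<and> pw q \<noteq> 0 \<and> pZ q \<in> csk H}"

text \<open>The terms with \<open>da\<close> and \<open>db\<close> in d\<alpha> cancel against the
  symplectic term except for \<open>dot a db - dot b da\<close>, while those pairing
  \<open>a\<close> with \<open>dy\<close> and \<open>b\<close> with \<open>dt\<close>
  double.\<close>

lemma contact_algebra:
  "(4 * pi * d\<sigma> - (dot a dy + dot da y) - (dot b dt + dot db t)) + dot (t + a) (- dy + db) - dot (- y + b) (dt + da)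
   = 4 * pi * d\<sigma> - (dot t dy - dot y dt) - 2 * dot a dy - 2 * dot b dt + (dot a db - dot b da)"
  by (simp add: dot_simps dot_commute[of da y] dot_commute[of db t] algebra_simps)

text \<open>\<open>S\<close> encodes F = \<tau> Z together with the symmetry of \<tau>. It cancels
  all products of two unconjugated or two conjugated factors. Of the mixed ones, one group is r^2
  times a Wronskian of \<open>p\<close> and \<open>p'\<close>, the other is the metric paired with
  the Euler direction.\<close>

lemma symplectic_algebra:
  assumes S: "dot F V = dot Z G"
  shows "dot (p *s F + p' *s cnjvec F) (dp *s Z + p *s V + (dp' *s cnjvec Z + p' *s cnjvec V))
       - dot (p *s Z + p' *s cnjvec Z) (dp *s F + p *s G + (dp' *s cnjvec F + p' *s cnjvec G))
     = (dot (cnjvec F) Z - dot F (cnjvec Z)) * (dp * p' - p * dp')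
       + p * p' * (dot F (cnjvec V) + dot (cnjvec F) V - dot (cnjvec Z) G - dot Z (cnjvec G))"
proof -
  have "dot (cnjvec F) (cnjvec V) = dot (cnjvec Z) (cnjvec G)" using S by (simp add: dot_cnjvec)
  then show ?thesis using S
    by (simp add: dot_simps dot_commute[of Z F] dot_commute[of "cnjvec Z" "cnjvec F"]
       dot_commute[of Z "cnjvec F"] dot_commute[of "cnjvec Z" F] algebra_simps)
qed

section \<open>The formula for the contact form upstairs\<close>

context
  fixes k :: "'n::finite \<Rightarrow> 'n \<Rightarrow> 'n \<Rightarrow> real"
  assumes k: "symmetric3 k"
begin

lemma ratio_has_derivative:
  assumes "pz q \<noteq> 0" "pw q \<noteq> 0"
  shows "((\<lambda>q. - \<i> * pi * (pz q / pw q)) has_derivative (\<lambda>u. - \<i> * pi * (pz u / pw q - pz q * pw u / (pw q)\<^sup>2))) (at q)"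
    "((\<lambda>q. - \<i> * pi * (pw q / pz q)) has_derivative (\<lambda>u. - \<i> * pi * (pw u / pz q - pw q * pz u / (pz q)\<^sup>2))) (at q)"
  by (rule has_derivative_eq_rhs[OF has_derivative_mult_right[OF has_derivative_divide'[OF np_has_derivative(1) np_has_derivative(2) assms(2)]]],
      use assms in \<open>simp add: fun_eq_iff field_simps power2_eq_square\<close>)
     (rule has_derivative_eq_rhs[OF has_derivative_mult_right[OF has_derivative_divide'[OF np_has_derivative(2) np_has_derivative(1) assms(1)]]],
      use assms in \<open>simp add: fun_eq_iff field_simps power2_eq_square\<close>)

definition dca :: "'n npoint \<Rightarrow> 'n npoint \<Rightarrow> complex^('n option)" where
  "dca q u = (- \<i> * pi * (pz u / pw q - pz q * pw u / (pw q)\<^sup>2)) *s dprepot k (pZ q)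
      + (- \<i> * pi * (pz q / pw q)) *s dF k (pZ q) (pZ u)
      + ((- \<i> * pi * (pw u / pz q - pw q * pz u / (pz q)\<^sup>2)) *s cnjvec (dprepot k (pZ q))
      + (- \<i> * pi * (pw q / pz q)) *s cnjvec (dF k (pZ q) (pZ u)))"

definition dcb :: "'n npoint \<Rightarrow> 'n npoint \<Rightarrow> complex^('n option)" where
  "dcb q u = (- \<i> * pi * (pz u / pw q - pz q * pw u / (pw q)\<^sup>2)) *s pZ q
      + (- \<i> * pi * (pz q / pw q)) *s pZ u
      + ((- \<i> * pi * (pw u / pz q - pw q * pz u / (pz q)\<^sup>2)) *s cnjvec (pZ q)
      + (- \<i> * pi * (pw q / pz q)) *s cnjvec (pZ u))"

lemma cb_has_derivative:
  assumes "pz q \<noteq> 0" "pw q \<noteq> 0"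
  shows "(cb has_derivative dcb q) (at q)"
  unfolding cb_def[abs_def] dcb_def[abs_def]
  by (rule has_derivative_eq_rhs[OF has_derivative_add[OF
        has_derivative_smult[OF ratio_has_derivative(1)[OF assms] np_has_derivative(3)]
        has_derivative_smult[OF ratio_has_derivative(2)[OF assms] has_derivative_cnjvec[OF np_has_derivative(3)]]]])
     (simp add: fun_eq_iff add_ac)

lemma ca_has_derivative:
  assumes "pz q \<noteq> 0" "pw q \<noteq> 0" "pZ q $ None \<noteq> 0"
  shows "(ca k has_derivative dca q) (at q)"
proof -
  note F = has_derivative_compose[OF np_has_derivative(3) dprepot_has_derivative[OF k assms(3)]]
  show ?thesis unfolding ca_def[abs_def] dca_def[abs_def]
    by (rule has_derivative_eq_rhs[OF has_derivative_add[OF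
          has_derivative_smult[OF ratio_has_derivative(1)[OF assms(1,2)] F]
          has_derivative_smult[OF ratio_has_derivative(2)[OF assms(1,2)] has_derivative_cnjvec[OF F]]]])
       (simp add: fun_eq_iff add_ac)
qed

text \<open>F = \<tau> Z and the symmetry of \<tau> remove \<tau> from the terms in which it meets
  Z. The result is the bracket of \<open>symplectic_algebra\<close> divided by - 4.\<close>

lemma gM_euler:
  assumes Z: "Z $ None \<noteq> 0"
  shows "of_real (gM k Z (\<i> *s Z) V) =
    - (dot (dprepot k Z) (cnjvec V) + dot (cnjvec (dprepot k Z)) V - dot (cnjvec Z) (dF k Z V) - dot Z (cnjvec (dF k Z V))) / 4"
proof -
  let ?Q = "dot (dprepot k Z) (cnjvec V)" and ?R = "dot (cnjvec Z) (dF k Z V)"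
  have "dot Z (dF k Z (cnjvec V)) = ?Q"
    using dot_dF_commute[OF k, of Z Z "cnjvec V"] dF_euler[OF k Z] by (simp add: dot_commute)
  then have "gM k Z (\<i> *s Z) V = - Re (?Q - ?R) / 2"
    by (simp add: gM_eq[OF k Z] dot_simps cnjvec_simps)
  then have "complex_of_real (gM k Z (\<i> *s Z) V) = - (?Q - ?R + cnj (?Q - ?R)) / 4"
    by (simp add: complex_eq_iff)
  moreover have "cnj ?Q = dot (cnjvec (dprepot k Z)) V" "cnj ?R = dot Z (cnjvec (dF k Z V))"
    by (simp_all add: dot_cnjvec[symmetric] cnjvec_simps)
  ultimately show ?thesis by (simp add: algebra_simps)
qed

lemma rsq_complex:
  assumes Z: "Z $ None \<noteq> 0"
  shows "of_real (rsq k Z) * (2 * \<i>) = dot (cnjvec (dprepot k Z)) Z - dot (dprepot k Z) (cnjvec Z)"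
proof -
  let ?P = "dot (dprepot k Z) (cnjvec Z)"
  have "dot (cnjvec (dprepot k Z)) Z = cnj ?P" by (simp add: dot_cnjvec[symmetric] cnjvec_simps)
  moreover have "rsq k Z = - Im ?P" by (simp add: rsq_eq_dot[OF k Z] dot_commute)
  ultimately show ?thesis by (simp add: complex_eq_iff)
qed

text \<open>After \<open>contact_algebra\<close> the terms match one by one: those linear in
  \<open>ca\<close> and \<open>cb\<close> give \<open>theta_plus\<close> and
  \<open>theta_minus\<close>, and the pairing of (\<open>ca\<close>, \<open>cb\<close>) with its own
  differential gives both the \<open>fM\<close> term and the \<open>eta\<close> term of
  \<open>theta_3\<close>. The nonzero r^2 cancels the denominator of \<open>eta\<close>.\<close>

lemma lambda_tilde_eq:
  assumes q: "pz q \<noteq> 0" "pw q \<noteq> 0" "pZ q $ None \<noteq> 0" "rsq k (pZ q) \<noteq> 0"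
  shows "lambda_tilde k q u = pz q * pw q / (8 * \<i>) *
    ((4 * pi * ps u - (dot (ca k q) (cvec (py u)) + dot (dca q u) (cvec (py q)))
        - (dot (cb q) (cvec (pt u)) + dot (dcb q u) (cvec (pt q))))
      + dot (cxit k q) (- cvec (py u) + dcb q u) - dot (cxi q) (cvec (pt u) + dca q u))"
proof -
  let ?Z = "pZ q" and ?F = "dprepot k (pZ q)" and ?V = "pZ u" and ?z = "pz q" and ?w = "pw q"
  let ?p = "- \<i> * pi * (?z / ?w)" and ?p' = "- \<i> * pi * (?w / ?z)"
    and ?dp = "- \<i> * pi * (pz u / ?w - ?z * pw u / ?w\<^sup>2)" and ?dp' = "- \<i> * pi * (pw u / ?z - ?w * pz u / ?z\<^sup>2)"
  have S: "dot ?F ?V = dot ?Z (dF k ?Z ?V)"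
    using dot_dF_commute[OF k, of ?Z ?Z ?V] dF_euler[OF k q(3)] by (simp add: dot_commute)
  \<comment> \<open>The first quantity turns 2\<i> r^2 into a multiple of z dw - w dz once
    multiplied by z w; the second is the coefficient of the \<open>eta\<close> term.\<close>
  have c1: "?dp * ?p' - ?p * ?dp' = - 2 * pi\<^sup>2 * (pz u / ?z - pw u / ?w)" and c2: "?p * ?p' = - (pi\<^sup>2)"
    using q(1,2) by (simp_all add: field_simps power2_eq_square)
  have gM: "dot ?F (cnjvec ?V) + dot (cnjvec ?F) ?V - dot (cnjvec ?Z) (dF k ?Z ?V) - dot ?Z (cnjvec (dF k ?Z ?V))
      = - 4 * of_real (gM k ?Z (\<i> *s ?Z) ?V)"
    by (simp add: gM_euler[OF q(3)])
  have "dot (ca k q) (dcb q u) - dot (cb q) (dca q u) =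
     (dot (cnjvec ?F) ?Z - dot ?F (cnjvec ?Z)) * (?dp * ?p' - ?p * ?dp') + ?p * ?p' *
     (dot ?F (cnjvec ?V) + dot (cnjvec ?F) ?V - dot (cnjvec ?Z) (dF k ?Z ?V) - dot ?Z (cnjvec (dF k ?Z ?V)))"
    unfolding ca_def cb_def dca_def dcb_def by (rule symplectic_algebra[OF S])
  also have "\<dots> = of_real (rsq k ?Z) * (2 * \<i>) * (- 2 * pi\<^sup>2 * (pz u / ?z - pw u / ?w))
      + 4 * pi\<^sup>2 * of_real (gM k ?Z (\<i> *s ?Z) ?V)"
    unfolding c1 c2 gM rsq_complex[OF q(3), symmetric] by simp
  finally have B: "dot (ca k q) (dcb q u) - dot (cb q) (dca q u) = \<dots>" .
  have th3: "theta_3 k q u = of_real (ps u) - 1 / (4 * of_real pi) * (dot (cvec (pt q)) (cvec (py u)) - dot (cvec (py q)) (cvec (pt u)))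
      + of_real pi * of_real (gM k ?Z (\<i> *s ?Z) ?V)"
    using q(4) by (simp add: theta_3_def case_prod_beta pairing_eq_dot eta_def euler_def)
  have thp: "theta_plus k q u = dot ?F (cvec (py u)) + dot ?Z (cvec (pt u))"
    by (simp add: theta_plus_def case_prod_beta pairing_eq_dot dot_simps)
  have thmi: "theta_minus k q u = dot (cnjvec ?F) (cvec (py u)) + dot (cnjvec ?Z) (cvec (pt u))"
    by (simp add: theta_minus_def case_prod_beta pairing_eq_dot dot_simps cnjvec_simps)
  have "lambda_tilde k q u = of_real (pi / 4) * (of_real (2 * pi * rsq k ?Z) * (?z * pw u - ?w * pz u)
           + ?z\<^sup>2 * theta_plus k q u + ?w\<^sup>2 * theta_minus k q u - 2 * \<i> * ?z * ?w * theta_3 k q u)"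
    by (simp add: lambda_tilde_def case_prod_beta fM_def)
  also have "\<dots> = ?z * ?w / (8 * \<i>) * (4 * pi * ps u - (dot (cvec (pt q)) (cvec (py u)) - dot (cvec (py q)) (cvec (pt u)))
      - 2 * dot (ca k q) (cvec (py u)) - 2 * dot (cb q) (cvec (pt u)) + (dot (ca k q) (dcb q u) - dot (cb q) (dca q u)))"
    unfolding B th3 thp thmi unfolding ca_def cb_def dot_simps using q(1,2)
    by (simp add: field_simps power2_eq_square)
  also have "\<dots> = ?z * ?w / (8 * \<i>) *
    ((4 * pi * ps u - (dot (ca k q) (cvec (py u)) + dot (dca q u) (cvec (py q)))
        - (dot (cb q) (cvec (pt u)) + dot (dcb q u) (cvec (pt q))))
      + dot (cxit k q) (- cvec (py u) + dcb q u) - dot (cxi q) (cvec (pt u) + dca q u))"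
    unfolding cxit_def cxi_def contact_algebra ..
  finally show ?thesis .
qed

lemma cxi_has_derivative:
  assumes "pz q \<noteq> 0" "pw q \<noteq> 0"
  shows "(cxi has_derivative (\<lambda>u. - cvec (py u) + dcb q u)) (at q)"
  unfolding cxi_def[abs_def]
  by (intro has_derivative_add has_derivative_minus has_derivative_cvec np_has_derivative cb_has_derivative assms)

lemma cxit_has_derivative:
  assumes "pz q \<noteq> 0" "pw q \<noteq> 0" "pZ q $ None \<noteq> 0"
  shows "(cxit k has_derivative (\<lambda>u. cvec (pt u) + dca q u)) (at q)"
  unfolding cxit_def[abs_def]
  by (intro has_derivative_add has_derivative_cvec np_has_derivative ca_has_derivative assms)

lemma calpha_has_derivative:
  assumes "pz q \<noteq> 0" "pw q \<noteq> 0" "pZ q $ None \<noteq> 0"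
  shows "(calpha k has_derivative (\<lambda>u. 4 * pi * ps u - (dot (ca k q) (cvec (py u)) + dot (dca q u) (cvec (py q)))
        - (dot (cb q) (cvec (pt u)) + dot (dcb q u) (cvec (pt q))))) (at q)"
proof -
  have "((\<lambda>q. complex_of_real (4 * pi * ps q)) has_derivative (\<lambda>u. of_real (4 * pi * ps u))) (at q)"
    by (intro has_derivative_of_real has_derivative_mult_right np_has_derivative)
  from has_derivative_diff[OF has_derivative_diff[OF this
        has_derivative_dot[OF ca_has_derivative[OF assms] has_derivative_cvec[OF np_has_derivative(5)]]]
        has_derivative_dot[OF cb_has_derivative[OF assms(1,2)] has_derivative_cvec[OF np_has_derivative(4)]]]
  show ?thesis unfolding calpha_def[abs_def] by simp
qed

lemma lambda_tilde_D:
  assumes q: "pz q \<noteq> 0" "pw q \<noteq> 0" "pZ q $ None \<noteq> 0" "rsq k (pZ q) \<noteq> 0"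
  shows "lambda_tilde k q u = pz q * pw q / (8 * \<i>) *
    (D (calpha k) q u + dot (cxit k q) (D cxi q u) - dot (cxi q) (D (cxit k) q u))"
  unfolding lambda_tilde_eq[OF q]
    frechet_derivative_at[OF cxi_has_derivative[OF q(1,2)], symmetric]
    frechet_derivative_at[OF cxit_has_derivative[OF q(1-3)], symmetric]
    frechet_derivative_at[OF calpha_has_derivative[OF q(1-3)], symmetric] ..

lemma C2_coords:
  assumes S: "open S" "\<And>q. q \<in> S \<Longrightarrow> pz q \<noteq> 0 \<and> pw q \<noteq> 0 \<and> pZ q $ None \<noteq> 0"
  shows "C2 S (ca k)" "C2 S cb" "C2 S cxi" "C2 S (cxit k)" "C2 S (calpha k)"
proof -
  have F: "C2 S (\<lambda>q. dprepot k (pZ q))" by (intro C2_dprepot_vec[OF k S(1)] C2_np) (use S(2) in blast)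
  show ca: "C2 S (ca k)" and cb: "C2 S cb" unfolding ca_def[abs_def] cb_def[abs_def]
    by (intro C2_add C2_smult C2_mult C2_const C2_divide C2_np C2_cnjvec F; use S(2) in blast)+
  show "C2 S cxi" "C2 S (cxit k)" "C2 S (calpha k)"
    unfolding cxi_def[abs_def] cxit_def[abs_def] calpha_def[abs_def]
    by (intro C2_add C2_diff C2_minus C2_dot C2_cvec C2_np C2_of_real C2_mult C2_const ca cb)+
qed

lemma rsq_C2:
  assumes S: "open S" and f: "C2 S f" and nz: "\<And>x. x \<in> S \<Longrightarrow> f x $ None \<noteq> 0"
  shows "C2 S (\<lambda>x. rsq k (f x))"
proof -
  have "C2 S (\<lambda>x. - Im (dot (cnjvec (f x)) (dprepot k (f x))))"
    using nz by (intro C2_minus C2_Im C2_dot C2_cnjvec f C2_dprepot_vec[OF k S f])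
  then show ?thesis by (rule C2_cong[OF _ S]) (simp add: rsq_eq_dot[OF k nz])
qed

end

section \<open>Coordinates on the twistor space\<close>

abbreviation qz :: "'n::finite tpoint \<Rightarrow> complex^'n" where "qz b \<equiv> fst (fst b)"
abbreviation qr :: "'n::finite tpoint \<Rightarrow> real" where "qr b \<equiv> fst (snd (fst b))"
abbreviation qt :: "'n::finite tpoint \<Rightarrow> real^('n option)" where "qt b \<equiv> fst (snd (snd (fst b)))"
abbreviation qy :: "'n::finite tpoint \<Rightarrow> real^('n option)" where "qy b \<equiv> fst (snd (snd (snd (fst b))))"
abbreviation qs :: "'n::finite tpoint \<Rightarrow> real" where "qs b \<equiv> snd (snd (snd (snd (fst b))))"
abbreviation qT :: "'n::finite tpoint \<Rightarrow> complex" where "qT b \<equiv> snd b"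

definition T0 :: "(real^'n::finite) set \<Rightarrow> 'n tpoint set" where
  "T0 H = {b. qz b \<in> Mbar H \<and> qr b > 0 \<and> qT b \<noteq> 0}"

definition stau :: "('n::finite \<Rightarrow> 'n \<Rightarrow> 'n \<Rightarrow> real) \<Rightarrow> 'n tpoint \<Rightarrow> real" where
  "stau k b = sqrt (2 * qr b / himag k (qz b))"

text \<open>The lift \<open>sec k b\<close> is the point over \<open>b\<close> with \<open>z = 1\<close> and \<open>Z\<^sup>0 > 0\<close>; since \<open>\<rho> = 2\<pi>\<^sup>2 h \<bar>Z\<^sup>0\<bar>\<^sup>2\<close>, the
  latter is \<open>\<tau>\<^sub>2 / 2\<pi>\<close>.\<close>

definition sec :: "('n::finite \<Rightarrow> 'n \<Rightarrow> 'n \<Rightarrow> real) \<Rightarrow> 'n tpoint \<Rightarrow> 'n npoint" where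
  "sec k b = (1, qT b, of_real (stau k b / (2 * pi)) *s homog (qz b), qt b, - qy b, qs b / (4 * pi))"

lemma xi_eq: "xi k b = cvec (qy b) + (- \<i> * of_real (stau k b) / 2) *s
    (inverse (qT b) *s homog (qz b) + qT b *s cnjvec (homog (qz b)))"
  by (simp add: xi_def case_prod_beta vec_eq_iff cvec_def tau2_def stau_def algebra_simps)

lemma xi_tilde_eq: "xi_tilde k b = cvec (qt b) + (- \<i> * of_real (stau k b) / 2) *s
    (inverse (qT b) *s dprepot k (homog (qz b)) + qT b *s cnjvec (dprepot k (homog (qz b))))"
  by (simp add: xi_tilde_def case_prod_beta vec_eq_iff cvec_def tau2_def stau_def algebra_simps)

lemma alpha_eq: "alpha k b = of_real (qs b) + (- \<i> * of_real (stau k b) / 2) *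
    (inverse (qT b) * (dot (dprepot k (homog (qz b))) (cvec (qy b)) - dot (homog (qz b)) (cvec (qt b)))
     + qT b * (dot (cnjvec (dprepot k (homog (qz b)))) (cvec (qy b)) - dot (cnjvec (homog (qz b))) (cvec (qt b))))"
  by (simp add: alpha_def case_prod_beta tau2_def stau_def pairing_eq_dot Ztilde_def)

lemma mem_Ntilde: "(q :: 'n::finite npoint) \<in> Ntilde H \<longleftrightarrow> (pz q, pw q) \<noteq> (0, 0) \<and> pZ q \<in> csk H"
  by (cases q) (simp add: Ntilde_def)

lemma N0_subset: "N0 H \<subseteq> Ntilde H"
  by (auto simp: N0_def mem_Ntilde)

lemma projf_eq: "projf k q = (((\<chi> a. pZ q $ Some a / pZ q $ None), pi / 4 * fM k (pZ q), pt q, - py q, 4 * pi * ps q),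
      pw q / pz q * (cnj (pZ q $ None) / of_real (norm (pZ q $ None))))"
  by (simp add: projf_def case_prod_beta)

lemma csk_decomp:
  assumes "Z \<in> csk H"
  obtains z where "Z $ None \<noteq> 0" "z \<in> Mbar H" "Z = (Z $ None) *s homog z" "(\<chi> a. Z $ Some a / Z $ None) = z"
proof -
  have "Z $ None \<noteq> 0" "(\<chi> a. Z $ Some a / Z $ None) \<in> Mbar H" using assms by (auto simp: mem_csk)
  moreover have "Z = (Z $ None) *s homog (\<chi> a. Z $ Some a / Z $ None)"
    using calculation(1) by (auto simp: vec_eq_iff homog_def split: option.split)
  ultimately show ?thesis using that by blast
qed

lemma C2_T:
  "C2 S qz" "C2 S qr" "C2 S qt" "C2 S qy" "C2 S qs" "C2 S qT"
  by (intro C2_fst C2_snd C2_id)+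

lemma C2_homog: "C2 S f \<Longrightarrow> C2 S (\<lambda>b. homog (f b))"
  unfolding homog_def
proof (intro C2_vec)
  fix i assume "C2 S f"
  then show "C2 S (\<lambda>x. case i of None \<Rightarrow> 1 | Some a \<Rightarrow> f x $ a)"
    by (cases i) (auto intro: C2_nth C2_const)
qed

section \<open>The section \<open>sec\<close>, the projection \<open>projf\<close>, and the
  coordinates along the fibres\<close>

context
  fixes k :: "'n::finite \<Rightarrow> 'n \<Rightarrow> 'n \<Rightarrow> real" and H :: "(real^'n) set"
  assumes PSR: "PSR_manifold k H"
begin

lemmas k_symmetric = PSR_sym[OF PSR]

lemma himag_pos: "z \<in> Mbar H \<Longrightarrow> himag k z > 0"
  using cone_pos[OF PSR] by (simp add: Mbar_def himag_def)

lemma stau_pos: "b \<in> T0 H \<Longrightarrow> stau k b > 0"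
  using himag_pos by (auto simp: T0_def stau_def)

lemma stau_sq: "b \<in> T0 H \<Longrightarrow> (stau k b)\<^sup>2 = 2 * qr b / himag k (qz b)"
  using himag_pos[of "qz b"] by (auto simp: T0_def stau_def)

lemma sec_N0: "b \<in> T0 H \<Longrightarrow> sec k b \<in> N0 H"
proof -
  assume b: "b \<in> T0 H"
  have "homog (qz b) \<in> csk H" using b by (simp add: mem_csk T0_def) (simp add: homog_def)
  then show ?thesis using stau_pos[OF b] b by (simp add: N0_def sec_def csk_scale T0_def)
qed

lemma projf_sec:
  assumes b: "b \<in> T0 H"
  shows "projf k (sec k b) = b"
proof -
  define r where "r = stau k b / (2 * pi)"
  have pos: "r > 0" "himag k (qz b) > 0" using stau_pos himag_pos b by (auto simp: T0_def r_def)
  then have nz: "complex_of_real r \<noteq> 0" by simp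
  have "(\<chi> a. homog (qz b) $ Some a) = qz b" by (simp add: homog_def vec_eq_iff)
  moreover
  have r2: "r\<^sup>2 = qr b / (2 * pi\<^sup>2 * himag k (qz b))"
    using pos by (simp add: r_def power_divide stau_sq[OF b] field_simps)
  have "pi / 4 * fM k (of_real r *s homog (qz b)) = qr b"
    unfolding fM_def rsq_homog[OF k_symmetric nz] norm_of_real power2_abs r2 using pos
    by (simp add: power2_eq_square)
  ultimately show ?thesis
    using pos nz unfolding projf_eq sec_def r_def[symmetric] by (simp add: prod_eq_iff)
qed

lemma projf_T0:
  assumes q: "q \<in> N0 H"
  shows "projf k q \<in> T0 H"
proof -
  have Z: "pZ q \<in> csk H" "pz q \<noteq> 0" "pw q \<noteq> 0" using q by (auto simp: N0_def)
  then have "rsq k (pZ q) > 0" "pZ q $ None \<noteq> 0" by (auto simp: rsq_pos[OF PSR] mem_csk)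
  then show ?thesis using Z by (simp add: T0_def projf_eq fM_def mem_csk)
qed

lemma rsq_phase:
  assumes "Z \<in> csk H" "norm c = 1"
  shows "rsq k (c *s Z) = rsq k Z"
proof -
  obtain z where z: "Z $ None \<noteq> 0" "Z = (Z $ None) *s homog z" using csk_decomp[OF assms(1)] by metis
  have "c \<noteq> 0" using assms(2) by auto
  then have "rsq k ((c * Z $ None) *s homog z) = rsq k ((Z $ None) *s homog z)"
    using z(1) assms(2) by (simp add: rsq_homog[OF k_symmetric] norm_mult)
  then show ?thesis using z(2) by (metis vector_smult_assoc)
qed

text \<open>The quotient w / z acquires the factor \<open>cis (- 2 * s)\<close> and the conjugate
  phase of Z^0 its inverse; the ratios of the Z^i and r^2 do not see a common phase.\<close>

lemma projf_flow: 
  assumes q: "q \<in> Ntilde H"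
  shows "projf k (flow s q) = projf k q"
proof -
  have e: "cis (- s) = cis s * cis (- 2 * s)" by (simp add: cis_mult)
  have c: "cis (2 * s) * cis (- 2 * s) = 1" by (simp add: cis_mult)
  have "cis (- s) * w / (cis s * z) * (cnj (cis (- 2 * s) * c) / of_real (norm (cis (- 2 * s) * c)))
      = w / z * (cnj c / of_real (norm c))" for w z c
    unfolding e using c by (simp add: norm_mult cis_cnj field_simps)
  then show ?thesis
    using q rsq_phase[of "pZ q" "cis (- 2 * s)"]
    by (simp add: projf_eq flow_def case_prod_beta fM_def mem_Ntilde)
qed

text \<open>The flow makes Z^0 positive and \<open>act\<close> makes z equal to 1. What is left to
  recover is the modulus of Z^0, which \<rho> determines through \<open>rsq_homog\<close>.\<close>

lemma sec_projf:
  assumes q: "q \<in> Ntilde H" "pz q \<noteq> 0"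
  shows "\<exists>x s. x \<noteq> 0 \<and> sec k (projf k q) = act x (flow s q)"
proof -
  obtain s where s: "flow s q \<in> slice H" using slice_exists[OF q(1)] by blast
  define q' where "q' = flow s q"
  have q': "pz q' \<noteq> 0" using q(2) by (simp add: q'_def flow_def case_prod_beta)
  define r where "r = act (1 / pz q') q'"
  have r: "pz r = 1" "pZ r = pZ q'" "pw r = pw q' / pz q'" "pt r = pt q'" "py r = py q'" "ps r = ps q'"
    using q' by (simp_all add: r_def act_def case_prod_beta)
  have Z: "pZ r \<in> csk H" "Im (pZ r $ None) = 0" "Re (pZ r $ None) > 0"
    using s unfolding r q'_def[symmetric] slice_def Ntilde_def by auto
  obtain z where z: "pZ r $ None \<noteq> 0" "z \<in> Mbar H" "pZ r = (pZ r $ None) *s homog z" "(\<chi> a. pZ r $ Some a / pZ r $ None) = z"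
    using csk_decomp[OF Z(1)] by metis
  have n: "of_real (norm (pZ r $ None)) = pZ r $ None" "cnj (pZ r $ None) = pZ r $ None"
    using Z by (simp_all add: complex_eq_iff cmod_def)
  have "rsq k (pZ r) = 4 * himag k z * (norm (pZ r $ None))\<^sup>2"
    using rsq_homog[OF k_symmetric z(1), of z] z(3) by simp
  then have "2 * qr (projf k r) / himag k z = (2 * pi * norm (pZ r $ None))\<^sup>2"
    using himag_pos[OF z(2)] by (simp add: projf_eq fM_def power2_eq_square)
  then have st: "stau k (projf k r) = 2 * pi * norm (pZ r $ None)"
    unfolding stau_def using z(4) by (simp add: projf_eq real_sqrt_mult real_sqrt_abs)
  have "sec k (projf k r) = r"
    unfolding sec_def st using n z r(1) by (simp add: projf_eq prod_eq_iff)
  moreover have "projf k r = projf k q"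
    using q' q by (simp add: r_def projf_act q'_def projf_flow)
  ultimately have "sec k (projf k q) = act (1 / pz q') (flow s q)" by (simp add: r_def q'_def)
  then show ?thesis using q' by (metis divide_eq_0_iff one_neq_zero)
qed

text \<open>On the section z / w is the inverse of t, and - \<i> \<open>pi\<close> Z^0 equals - \<i>
  / 2 times \<open>stau k b\<close>; the homogeneity of \<open>dprepot\<close> moves Z^0 out of
  F.\<close>

lemma xi_sec: "b \<in> T0 H \<Longrightarrow> xi k b = cxi (sec k b)" 
  and xi_tilde_sec: "b \<in> T0 H \<Longrightarrow> xi_tilde k b = cxit k (sec k b)"
  and alpha_sec: "b \<in> T0 H \<Longrightarrow> alpha k b = calpha k (sec k b)"
proof -
  assume b: "b \<in> T0 H"
  define c where "c = complex_of_real (stau k b / (2 * pi))"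
  have st: "complex_of_real (stau k b) = 2 * pi * c" "cnj c = c" by (simp_all add: c_def)
  have "c \<noteq> 0" using stau_pos[OF b] by (simp add: c_def)
  then have F: "dprepot k (c *s homog (qz b)) = c *s dprepot k (homog (qz b))"
    by (rule dprepot_scale[OF k_symmetric, rotated]) simp
  show "xi k b = cxi (sec k b)" "xi_tilde k b = cxit k (sec k b)" "alpha k b = calpha k (sec k b)"
    unfolding xi_eq xi_tilde_eq alpha_eq cxi_def cxit_def calpha_def ca_def cb_def sec_def c_def[symmetric] st(1)
    using b by (simp_all add: T0_def F st(2) cvec_minus cnjvec_simps dot_simps vector_smult_assoc vector_add_ldistrib field_simps)
qed

text \<open>The weight 2 of z / w cancels the weight - 2 of Z, and the weight - 2 of w / z cancels
  the weight 2 of its conjugate.\<close>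

lemma cb_flow: "cb (flow s q) = cb q" and ca_flow: "pZ q $ None \<noteq> 0 \<Longrightarrow> ca k (flow s q) = ca k q"
proof -
  have c: "cis (- s) = inverse (cis s)" "cis (- 2 * s) = inverse (cis s) ^ 2" "cis s \<noteq> 0" "cnj (cis (- 2 * s)) = cis s ^ 2"
    by (simp_all add: cis_cnj power2_eq_square cis_mult)
  have e: "cis s * z / (cis (- s) * w) * cis (- 2 * s) = z / w" "cis (- s) * w / (cis s * z) * cnj (cis (- 2 * s)) = w / z" for z w
    using c(3) unfolding c(4) unfolding c(1,2) by (simp_all add: field_simps power2_eq_square)
  have v: "(a * (cis s * z / (cis (- s) * w))) *s (cis (- 2 * s) *s V) = (a * (z / w)) *s V"
    "(a * (cis (- s) * w / (cis s * z))) *s (cnj (cis (- 2 * s)) *s V) = (a * (w / z)) *s V" for a z w and V :: "complex^('n option)"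
    unfolding vector_smult_assoc mult.assoc e by simp_all
  have f: "pz (flow s q) = cis s * pz q" "pw (flow s q) = cis (- s) * pw q" "pZ (flow s q) = cis (- 2 * s) *s pZ q"
    by (simp_all add: flow_def case_prod_beta)
  show "cb (flow s q) = cb q"
    unfolding cb_def f cnjvec_simps v ..
  assume "pZ q $ None \<noteq> 0"
  then have "dprepot k (cis (- 2 * s) *s pZ q) = cis (- 2 * s) *s dprepot k (pZ q)"
    by (intro dprepot_scale[OF k_symmetric]) (use c in auto)
  then show "ca k (flow s q) = ca k q"
    unfolding ca_def f cnjvec_simps v by (simp only: cnjvec_simps v)
qed

lemma cb_act: "x \<noteq> 0 \<Longrightarrow> cb (act x q) = cb q" and ca_act: "x \<noteq> 0 \<Longrightarrow> ca k (act x q) = ca k q"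
  by (simp_all add: cb_def ca_def act_def case_prod_beta)

text \<open>The functions on the right are invariant under \<open>flow\<close> and
  \<open>act\<close>, and \<open>sec\<close> meets every orbit of these in \<open>N0\<close>, so the
  comparison on the section suffices.\<close>

lemma coords_projf:
  assumes q: "q \<in> N0 H"
  shows "xi k (projf k q) = cxi q" "xi_tilde k (projf k q) = cxit k q" "alpha k (projf k q) = calpha k q"
proof -
  obtain x s where x: "x \<noteq> 0" "sec k (projf k q) = act x (flow s q)"
    using sec_projf[of q] q N0_subset unfolding N0_def by blast
  have Z: "pZ q $ None \<noteq> 0" using q by (simp add: N0_def mem_csk)
  have p: "pt (act x (flow s q)) = pt q" "py (act x (flow s q)) = py q" "ps (act x (flow s q)) = ps q"
    by (simp_all add: act_def flow_def case_prod_beta)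
  have "ca k (act x (flow s q)) = ca k q" "cb (act x (flow s q)) = cb q"
    using x(1) Z by (simp_all add: ca_act cb_act ca_flow cb_flow)
  then have "cxi (act x (flow s q)) = cxi q" "cxit k (act x (flow s q)) = cxit k q" "calpha k (act x (flow s q)) = calpha k q"
    unfolding cxi_def cxit_def calpha_def p by simp_all
  then show "xi k (projf k q) = cxi q" "xi_tilde k (projf k q) = cxit k q" "alpha k (projf k q) = calpha k q"
    using x(2) xi_sec[OF projf_T0[OF q]] xi_tilde_sec[OF projf_T0[OF q]] alpha_sec[OF projf_T0[OF q]] by metis+
qed

section \<open>Open domains and differentiability\<close>

lemma open_T0: "open (T0 H)"
proof -
  have "T0 H = {b. qz b \<in> Mbar H} \<inter> {b. 0 < qr b} \<inter> {b. qT b \<noteq> 0}" by (auto simp: T0_def)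
  moreover have "open ((\<lambda>b :: 'n tpoint. qz b) -` Mbar H)"
    by (intro open_vimage open_Mbar[OF PSR] continuous_intros)
  ultimately show ?thesis
    by (auto intro!: open_Int open_Collect_less open_Collect_neq continuous_intros simp: vimage_def)
qed

lemma open_csk: "open (csk H)"
proof -
  let ?U = "{Z :: complex^('n option). Z $ None \<noteq> 0}"
  have "continuous_on ?U (\<lambda>Z. \<chi> a. Z $ Some a / Z $ None)"
    by (intro continuous_on_vec_lambda continuous_intros) auto
  then have "open (?U \<inter> (\<lambda>Z. \<chi> a. Z $ Some a / Z $ None) -` Mbar H)"
    by (intro continuous_open_preimage open_None open_Mbar[OF PSR])
  moreover have "csk H = ?U \<inter> (\<lambda>Z. \<chi> a. Z $ Some a / Z $ None) -` Mbar H"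
    by (auto simp: mem_csk)
  ultimately show ?thesis by simp
qed

lemma open_Ntilde: "open (Ntilde H)"
proof -
  have "Ntilde H = ({q. pz q \<noteq> 0} \<union> {q. pw q \<noteq> 0}) \<inter> (\<lambda>q. pZ q) -` csk H"
    unfolding set_eq_iff mem_Ntilde by auto
  moreover have "open ((\<lambda>q :: 'n npoint. pZ q) -` csk H)"
    by (intro open_vimage open_csk continuous_intros)
  ultimately show ?thesis
    by (auto intro!: open_Int open_Un open_Collect_neq continuous_intros)
qed

lemma open_N0: "open (N0 H)"
proof -
  have "N0 H = {q. pz q \<noteq> 0} \<inter> {q. pw q \<noteq> 0} \<inter> (\<lambda>q. pZ q) -` csk H"
    by (auto simp: N0_def)
  moreover have "open ((\<lambda>q :: 'n npoint. pZ q) -` csk H)"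
    by (intro open_vimage open_csk continuous_intros)
  ultimately show ?thesis
    by (auto intro!: open_Int open_Collect_neq continuous_intros)
qed

lemma C2_stau: "C2 (T0 H) (stau k)"
proof -
  have "C2 (T0 H) (\<lambda>b. himag k (qz b))"
    unfolding himag_def cubic_eq_trilin
    by (intro C2_divide C2_const C2_trilin) (simp_all add: C2_Im[OF C2_nth[OF C2_T(1)]])
  then show ?thesis
    unfolding stau_def[abs_def] using himag_pos
    by (intro C2_sqrt C2_divide C2_mult C2_const C2_T) (force simp: T0_def)+
qed

lemma C2_sec: "C2 (T0 H) (sec k)"
  unfolding sec_def[abs_def]
  by (intro C2_Pair C2_const C2_T C2_smult C2_of_real C2_divide C2_stau C2_homog C2_minus) auto

lemma C2_xis: "C2 (T0 H) (xi k)" "C2 (T0 H) (xi_tilde k)" "C2 (T0 H) (alpha k)"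
proof -
  have F: "C2 (T0 H) (\<lambda>b. dprepot k (homog (qz b)))"
    by (intro C2_dprepot_vec[OF k_symmetric open_T0] C2_homog C2_T) simp
  note i = C2_add C2_diff C2_mult C2_smult C2_dot C2_cvec C2_cnjvec C2_of_real C2_const C2_divide C2_inverse C2_homog C2_T C2_stau F
  show "C2 (T0 H) (xi k)" unfolding xi_eq[abs_def] by (intro i) (auto simp: T0_def)
  show "C2 (T0 H) (xi_tilde k)" unfolding xi_tilde_eq[abs_def] by (intro i) (auto simp: T0_def)
  show "C2 (T0 H) (alpha k)" unfolding alpha_eq[abs_def] by (intro i) (auto simp: T0_def)
qed

lemma projf_C2: "C2 {q \<in> Ntilde H. pz q \<noteq> 0} (projf k)"
proof -
  let ?S = "{q \<in> Ntilde H. pz q \<noteq> 0}"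
  have "open (Ntilde H \<inter> {q. pz q \<noteq> 0})"
    by (intro open_Int open_Ntilde open_Collect_neq continuous_intros)
  moreover have "Ntilde H \<inter> {q. pz q \<noteq> 0} = ?S" by blast
  ultimately have op: "open ?S" by metis
  have Z: "pZ q $ None \<noteq> 0" if "q \<in> ?S" for q using that by (auto simp: mem_Ntilde mem_csk)
  have n: "C2 ?S (\<lambda>q. norm (pZ q $ None))"
    unfolding cmod_def
    by (intro C2_sqrt C2_add C2_power C2_Re C2_Im C2_nth C2_np) (use Z complex_neq_0 in blast)
  show ?thesis
    unfolding projf_eq[abs_def] fM_def
    by (intro C2_Pair C2_vec C2_divide C2_mult C2_const C2_np C2_nth C2_minus C2_cnj C2_of_real n rsq_C2[OF k_symmetric op])
       (use Z in auto)
qed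

end

section \<open>Local invertibility of the coordinates\<close>

text \<open>Existence of the derivative is part of the notion, so that the closure rules below need
  no separate proofs of differentiability.\<close>

definition kills :: "'a::real_normed_vector \<Rightarrow> 'a \<Rightarrow> ('a \<Rightarrow> 'b::real_normed_vector) \<Rightarrow> bool" where
  "kills b v f \<longleftrightarrow> (\<exists>f'. (f has_derivative f') (at b) \<and> f' v = 0)"

lemma kills_const: "kills b v (\<lambda>_. c)"
  unfolding kills_def by (intro exI[of _ "\<lambda>_. 0"]) auto

lemma kills_linear_compose: "bounded_linear h \<Longrightarrow> kills b v f \<Longrightarrow> kills b v (\<lambda>x. h (f x))"
  unfolding kills_def
  by (elim exE conjE, rule exI, rule conjI, erule (1) bounded_linear.has_derivative)
     (simp add: linear_simps(3))

lemma kills_bilinear: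
  assumes h: "bounded_bilinear h" and "kills b v f" "kills b v g"
  shows "kills b v (\<lambda>x. h (f x) (g x))"
proof -
  obtain f' g' where "(f has_derivative f') (at b)" "f' v = 0" "(g has_derivative g') (at b)" "g' v = 0"
    using assms unfolding kills_def by blast
  then show ?thesis unfolding kills_def
    by (intro exI[of _ "\<lambda>v. h (f b) (g' v) + h (f' v) (g b)"] conjI bounded_bilinear.FDERIV[OF h])
       (auto simp: bounded_bilinear.zero_left[OF h] bounded_bilinear.zero_right[OF h])
qed

lemma kills_add: "kills b v f \<Longrightarrow> kills b v g \<Longrightarrow> kills b v (\<lambda>x. f x + g x)"
  unfolding kills_def by (metis has_derivative_add add.right_neutral)

lemma kills_diff: "kills b v f \<Longrightarrow> kills b v g \<Longrightarrow> kills b v (\<lambda>x. f x - g x)"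
  unfolding kills_def by (metis has_derivative_diff diff_0_right)

lemma kills_minus: "kills b v f \<Longrightarrow> kills b v (\<lambda>x. - f x)"
  unfolding kills_def by (metis has_derivative_minus minus_zero)

lemma kills_divide:
  fixes f g :: "'a::real_normed_vector \<Rightarrow> complex"
  assumes "kills b v f" "kills b v g" "g b \<noteq> 0"
  shows "kills b v (\<lambda>x. f x / g x)"
proof -
  obtain f' g' where f: "(f has_derivative f') (at b)" "f' v = 0" "(g has_derivative g') (at b)" "g' v = 0"
    using assms unfolding kills_def by blast
  show ?thesis unfolding kills_def
    by (rule exI, rule conjI, rule has_derivative_divide'[OF f(1,3) assms(3)]) (simp add: f)
qed

lemma kills_cong:
  assumes "kills b v f" "open S" "b \<in> S" "\<And>x. x \<in> S \<Longrightarrow> f x = g x"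
  shows "kills b v g"
  using assms unfolding kills_def by (meson has_derivative_transform_within_open)

lemma killsD: "kills b v f \<Longrightarrow> (f has_derivative f') (at b) \<Longrightarrow> f' v = 0"
  unfolding kills_def using has_derivative_unique by blast

lemma kills_linearD: "kills b v f \<Longrightarrow> bounded_linear f \<Longrightarrow> f v = 0"
  unfolding kills_def by (metis bounded_linear_imp_has_derivative has_derivative_unique)

lemma kills_C2: "C2 S f \<Longrightarrow> b \<in> S \<Longrightarrow> D f b v = 0 \<Longrightarrow> kills b v f"
  unfolding kills_def using C2_has_derivative by blast

lemma kills_dprepot:
  assumes "symmetric3 k" "kills b v f" "f b $ None \<noteq> 0"
  shows "kills b v (\<lambda>x. dprepot k (f x))"
proof -
  obtain f' where "(f has_derivative f') (at b)" "f' v = 0" using assms(2) unfolding kills_def by blast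
  then show ?thesis unfolding kills_def
    using has_derivative_compose[of f f' b UNIV "dprepot k" "dF k (f b)"] dprepot_has_derivative[OF assms(1,3)]
    by (intro exI[of _ "\<lambda>u. dF k (f b) (f' u)"]) auto
qed

lemmas kills_mult = kills_bilinear[OF bounded_bilinear_mult]
lemmas kills_smult = kills_bilinear[OF bounded_bilinear_smult]
lemmas kills_dot = kills_bilinear[OF bounded_bilinear_dot]
lemmas kills_cnj = kills_linear_compose[OF bounded_linear_cnj]
lemmas kills_cnjvec = kills_linear_compose[OF bounded_linear_cnjvec]
lemmas kills_nth = kills_linear_compose[OF bounded_linear_vec_nth]

text \<open>With \<open>A = - \<i>\<tau>\<^sub>2/2\<close> (so that \<open>cnj A = - A\<close>), \<open>y = (A/t) (1, z)\<close> and \<open>R = \<bar>t\<bar>\<^sup>2\<close>, one has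
  \<open>\<xi> = \<zeta> + y - R cnj y\<close>, and \<open>Y = (1 + R) y\<close> is the point of the special Kaehler cone whose
  real special coordinates are the imaginary parts of the \<open>\<xi>\<close>.\<close>

definition ysc :: "('n::finite \<Rightarrow> 'n \<Rightarrow> 'n \<Rightarrow> real) \<Rightarrow> 'n tpoint \<Rightarrow> complex" where
  "ysc k b = - \<i> * of_real (stau k b) / 2 / qT b"

definition tsq :: "'n::finite tpoint \<Rightarrow> complex" where
  "tsq b = qT b * cnj (qT b)"

definition ypt :: "('n::finite \<Rightarrow> 'n \<Rightarrow> 'n \<Rightarrow> real) \<Rightarrow> 'n tpoint \<Rightarrow> complex^('n option)" where
  "ypt k b = ysc k b *s homog (qz b)"

definition fpt :: "('n::finite \<Rightarrow> 'n \<Rightarrow> 'n \<Rightarrow> real) \<Rightarrow> 'n tpoint \<Rightarrow> complex^('n option)" where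
  "fpt k b = ysc k b *s dprepot k (homog (qz b))"

definition Ypt :: "('n::finite \<Rightarrow> 'n \<Rightarrow> 'n \<Rightarrow> real) \<Rightarrow> 'n tpoint \<Rightarrow> complex^('n option)" where
  "Ypt k b = (1 + tsq b) *s ypt k b"

lemma cnj_tsq: "cnj (tsq b) = tsq b"
  by (simp add: tsq_def mult.commute)

lemma tsq_real: "tsq b = of_real ((norm (qT b))\<^sup>2)"
  unfolding tsq_def by (rule complex_norm_square[symmetric])

lemma tsq_nz: "1 + tsq b \<noteq> 0"
proof -
  have "1 + (norm (qT b))\<^sup>2 > 0" by (intro add_pos_nonneg) auto
  then have "complex_of_real (1 + (norm (qT b))\<^sup>2) \<noteq> 0" by (metis of_real_eq_0_iff less_irrefl)
  then show ?thesis by (simp add: tsq_real)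
qed

lemma xi_ypt:
  assumes "qT b \<noteq> 0"
  shows "xi k b = cvec (qy b) + (ypt k b - tsq b *s cnjvec (ypt k b))"
    and "xi_tilde k b = cvec (qt b) + (fpt k b - tsq b *s cnjvec (fpt k b))"
    and "alpha k b = of_real (qs b) + (dot (fpt k b) (cvec (qy b)) - dot (ypt k b) (cvec (qt b)))
       - tsq b * (dot (cnjvec (fpt k b)) (cvec (qy b)) - dot (cnjvec (ypt k b)) (cvec (qt b)))"
proof -
  define A where "A = - \<i> * of_real (stau k b) / 2"
  have c: "tsq b * cnj (ysc k b) = - A * qT b" and c': "ysc k b = A * inverse (qT b)"
    using assms by (simp_all add: tsq_def ysc_def A_def field_simps)
  have e: "a *s (it *s v + t *s w) = (a * it) *s v - (- a * t) *s w" for a it t and v w :: "complex^('m::finite)"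
    by (simp add: vec_eq_iff algebra_simps)
  show "xi k b = cvec (qy b) + (ypt k b - tsq b *s cnjvec (ypt k b))"
    "xi_tilde k b = cvec (qt b) + (fpt k b - tsq b *s cnjvec (fpt k b))"
    unfolding xi_eq xi_tilde_eq ypt_def fpt_def cnjvec_simps vector_smult_assoc A_def[symmetric] e c unfolding c' by (rule refl)+
  have cc: "tsq b * (cnj (ysc k b) * p - cnj (ysc k b) * p') = - A * qT b * (p - p')" for p p'
    unfolding c[symmetric] by (simp add: algebra_simps)
  show "alpha k b = of_real (qs b) + (dot (fpt k b) (cvec (qy b)) - dot (ypt k b) (cvec (qt b)))
       - tsq b * (dot (cnjvec (fpt k b)) (cvec (qy b)) - dot (cnjvec (ypt k b)) (cvec (qt b)))"
    unfolding alpha_eq ypt_def fpt_def cnjvec_simps dot_simps A_def[symmetric] cc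
    unfolding c' by (simp add: algebra_simps)
qed

text \<open>As \<open>r\<close> and \<open>R\<close> are real, \<open>r\<close> drops out of the
  imaginary part, where \<open>y\<close> and its conjugate combine to (1 + R) y. This is the origin
  of \<open>Ypt\<close>.\<close>

lemma xi_imaginary:
  assumes "x = cvec r + (y - R *s cnjvec y)" "cnj R = R"
  shows "x - cnjvec x = (1 + R) *s y - cnjvec ((1 + R) *s y)"
    and "x + cnjvec x = 2 *s cvec r + (1 - R) *s (y + cnjvec y)"
  using assms(2) unfolding assms(1) by (simp_all add: vec_eq_iff cvec_def algebra_simps)

text \<open>The imaginary part of \<alpha> still contains \<zeta> and \<zeta>~, linearly and with
  the imaginary parts of \<xi>~ and \<xi> as coefficients. Subtracting the symplectic pairing of
  imaginary with real parts cancels them.\<close>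

definition invE :: "complex^'m::finite \<Rightarrow> complex^'m \<Rightarrow> complex \<Rightarrow> complex" where
  "invE x xt a = (a - cnj a) - (dot (xt - cnjvec xt) (x + cnjvec x) - dot (x - cnjvec x) (xt + cnjvec xt)) / 2"

text \<open>The right-hand side is \<open>(1 - R) / (1 + R)\<close> times a nowhere vanishing function of \<open>Y\<close>, and thus
  determines \<open>R\<close>.\<close>

lemma invE_eq:
  assumes x: "x = cvec r + (y - R *s cnjvec y)" and xt: "xt = cvec rt + (f - R *s cnjvec f)" and R: "cnj R = R"
    and a: "a = of_real s + (dot f (cvec r) - dot y (cvec rt)) - R * (dot (cnjvec f) (cvec r) - dot (cnjvec y) (cvec rt))"
  shows "invE x xt a = - (1 - R\<^sup>2) * (dot f (cnjvec y) - dot (cnjvec f) y)"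
proof -
  have cc: "cnj (dot u (cvec p)) = dot (cnjvec u) (cvec p)" "cnj (dot (cnjvec u) (cvec p)) = dot u (cvec p)" for u :: "complex^'m" and p
    using dot_cnjvec[of u "cvec p"] dot_cnjvec[of "cnjvec u" "cvec p"] by (simp_all add: cnjvec_simps)
  show ?thesis
    unfolding invE_def xi_imaginary[OF x R] xi_imaginary[OF xt R] cnjvec_simps
    by (simp add: a R cc dot_simps cnjvec_simps dot_commute[of y f] dot_commute[of y "cnjvec f"] dot_commute[of "cnjvec y" f]
       dot_commute[of "cnjvec y" "cnjvec f"])
       (simp add: field_simps power2_eq_square)
qed

section \<open>Injectivity of the differential of (\<xi>, \<xi>~, \<alpha>)\<close>

context
  fixes k :: "'n::finite \<Rightarrow> 'n \<Rightarrow> 'n \<Rightarrow> real" and H :: "(real^'n) set"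
  assumes PSR: "PSR_manifold k H"
begin

lemma ysc_nz: "b \<in> T0 H \<Longrightarrow> ysc k b \<noteq> 0"
  using stau_pos[OF PSR, of b] by (simp add: ysc_def T0_def)

lemma Ypt_csk:
  assumes "b \<in> T0 H"
  shows "Ypt k b \<in> csk H"
proof -
  have "homog (qz b) \<in> csk H" using assms by (simp add: mem_csk T0_def) (simp add: homog_def)
  then show ?thesis using ysc_nz[OF assms] tsq_nz[of b] csk_scale[of "(1 + tsq b) * ysc k b" "homog (qz b)" H]
    by (simp add: Ypt_def ypt_def vector_smult_assoc)
qed

lemma dprepot_Ypt:
  assumes "b \<in> T0 H"
  shows "dprepot k (Ypt k b) = (1 + tsq b) *s fpt k b"
proof -
  have "dprepot k (((1 + tsq b) * ysc k b) *s homog (qz b)) = ((1 + tsq b) * ysc k b) *s dprepot k (homog (qz b))"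
    using ysc_nz[OF assms] tsq_nz[of b] by (intro dprepot_scale[OF PSR_sym[OF PSR]]) auto
  then show ?thesis by (simp add: Ypt_def ypt_def fpt_def vector_smult_assoc)
qed

lemma C2_Ypt: "C2 (T0 H) (Ypt k)"
  unfolding Ypt_def[abs_def] ypt_def ysc_def tsq_def
  by (intro C2_smult C2_mult C2_add C2_const C2_cnj C2_T C2_homog C2_divide C2_of_real C2_stau[OF PSR])
     (auto simp: T0_def)

text \<open>Each fact named \<open>K...\<close> adds a function to those with zero derivative along
  \<open>v\<close>. In the end all coordinates of \<open>b\<close> are reached (t through its
  square); being linear, they have the components of \<open>v\<close> as derivatives.\<close>

lemma coords_kernel:
  assumes b: "b \<in> T0 H" and d: "D (xi k) b v = 0" "D (xi_tilde k) b v = 0" "D (alpha k) b v = 0"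
  shows "v = 0"
proof -
  note op = open_T0[OF PSR] and s3 = PSR_sym[OF PSR]
  have T: "qT p \<noteq> 0" if "p \<in> T0 H" for p using that by (simp add: T0_def)
  have Kxi: "kills b v (xi k)" and Kxit: "kills b v (xi_tilde k)" and Ka: "kills b v (alpha k)"
    using kills_C2[OF C2_xis(1)[OF PSR] b d(1)] kills_C2[OF C2_xis(2)[OF PSR] b d(2)]
      kills_C2[OF C2_xis(3)[OF PSR] b d(3)] by auto
  have Ync: "Ypt k b \<in> csk H" by (rule Ypt_csk[OF b])
  then have Yn: "Ypt k b $ None \<noteq> 0" by (simp add: mem_csk)
  have dY: "(Ypt k has_derivative D (Ypt k) b) (at b)" by (rule C2_has_derivative[OF C2_Ypt b])
  have K1: "kills b v (\<lambda>b. Ypt k b - cnjvec (Ypt k b))"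
    by (rule kills_cong[OF kills_diff[OF Kxi kills_cnjvec[OF Kxi]] op b])
       (simp add: xi_imaginary(1)[OF xi_ypt(1) cnj_tsq] T Ypt_def)
  have K2: "kills b v (\<lambda>b. dprepot k (Ypt k b) - cnjvec (dprepot k (Ypt k b)))"
    by (rule kills_cong[OF kills_diff[OF Kxit kills_cnjvec[OF Kxit]] op b])
       (simp add: xi_imaginary(1)[OF xi_ypt(2) cnj_tsq] T dprepot_Ypt)
  \<comment> \<open>The derivative of \<open>Ypt k\<close> along \<open>v\<close> is real by
    \<open>K1\<close>, and \<tau> maps it to a real vector by \<open>K2\<close>; nondegeneracy of Im
    \<tau> on real vectors makes it zero.\<close>
  let ?c = "D (Ypt k) b v"
  have c1: "?c - cnjvec ?c = 0"
    by (rule killsD[OF K1]) (intro has_derivative_diff has_derivative_cnjvec dY)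
  have c: "?c = cvec (\<chi> i. Re (?c $ i))"
    using c1 by (simp add: vec_eq_iff cvec_def complex_eq_iff)
  have "((\<lambda>b. dprepot k (Ypt k b)) has_derivative (\<lambda>v. dF k (Ypt k b) (D (Ypt k) b v))) (at b)"
    by (rule has_derivative_compose[OF dY dprepot_has_derivative[OF s3 Yn]])
  then have "dF k (Ypt k b) ?c - cnjvec (dF k (Ypt k b) ?c) = 0"
    by (intro killsD[OF K2] has_derivative_diff has_derivative_cnjvec)
  then have "Im (dF k (Ypt k b) ?c $ i) = 0" for i
    by (simp add: vec_eq_iff complex_eq_iff)
  then have "(\<chi> i. Re (?c $ i)) = (0 :: real^('n option))"
    using tau_nondegenerate[OF PSR Ync, of "\<chi> i. Re (?c $ i)"] c by metis
  then have "?c = 0" using c by (metis bounded_linear_cvec linear_simps(3))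
  then have KY: "kills b v (Ypt k)" unfolding kills_def using dY by blast
  note KF = kills_dprepot[OF s3 KY Yn]
  \<comment> \<open>\<open>?Q\<close> is - 2\<i> r^2 at the point \<open>Ypt k b\<close>, so it has
    no zero, and it depends on \<open>b\<close> only through \<open>Ypt k b\<close>, so it is
    killed.\<close>
  let ?Q = "\<lambda>b. dot (dprepot k (Ypt k b)) (cnjvec (Ypt k b)) - dot (cnjvec (dprepot k (Ypt k b))) (Ypt k b)"
  have Qeq: "?Q p = - (2 * \<i>) * of_real (rsq k (Ypt k p))" "?Q p \<noteq> 0" 
    "?Q p = (1 + tsq p)\<^sup>2 * (dot (fpt k p) (cnjvec (ypt k p)) - dot (cnjvec (fpt k p)) (ypt k p))" if "p \<in> T0 H" for p
  proof -
    have Z: "Ypt k p \<in> csk H" by (rule Ypt_csk[OF that])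
    then have "Ypt k p $ None \<noteq> 0" by (simp add: mem_csk)
    from rsq_complex[OF s3 this] show *: "?Q p = - (2 * \<i>) * of_real (rsq k (Ypt k p))"
      by (simp add: algebra_simps)
    show "?Q p \<noteq> 0" unfolding * using rsq_pos[OF PSR Z] by simp
    show "?Q p = (1 + tsq p)\<^sup>2 * (dot (fpt k p) (cnjvec (ypt k p)) - dot (cnjvec (fpt k p)) (ypt k p))"
      unfolding dprepot_Ypt[OF that] unfolding Ypt_def
      by (simp add: cnjvec_simps dot_simps cnj_tsq power2_eq_square algebra_simps)
  qed
  \<comment> \<open>The numerator is minus the value found in \<open>invE_eq\<close>. Its factor
    depending on \<open>fpt\<close> and \<open>ypt\<close> is also contained in \<open>?Q\<close>,
    and the quotient is a function of R = \<open>tsq p\<close> alone.\<close>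
  have ratio: "- (- (1 - (tsq p)\<^sup>2) * (dot (fpt k p) (cnjvec (ypt k p)) - dot (cnjvec (fpt k p)) (ypt k p))) / ?Q p
      = (1 - tsq p) / (1 + tsq p)" if "p \<in> T0 H" for p
  proof -
    let ?d = "dot (fpt k p) (cnjvec (ypt k p)) - dot (cnjvec (fpt k p)) (ypt k p)"
    have "?d \<noteq> 0" using Qeq(2)[OF that] unfolding Qeq(3)[OF that] by auto
    moreover have "1 - (tsq p)\<^sup>2 = (1 - tsq p) * (1 + tsq p)" by (simp add: power2_eq_square algebra_simps)
    ultimately show ?thesis
      unfolding Qeq(3)[OF that] using tsq_nz[of p] by (simp add: power2_eq_square)
  qed
  have KQ: "kills b v ?Q" by (intro kills_diff kills_dot kills_cnjvec KF KY)
  note Qnz = Qeq(2)[OF b]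
  have "kills b v (\<lambda>b. invE (xi k b) (xi_tilde k b) (alpha k b))"
    unfolding invE_def by (intro kills_diff kills_add kills_divide kills_const kills_dot kills_cnj kills_cnjvec Kxi Kxit Ka) auto
  then have "kills b v (\<lambda>b. - (1 - (tsq b)\<^sup>2) * (dot (fpt k b) (cnjvec (ypt k b)) - dot (cnjvec (fpt k b)) (ypt k b)))"
    by (rule kills_cong[OF _ op b]) (rule invE_eq[OF xi_ypt(1) xi_ypt(2) cnj_tsq xi_ypt(3)], use T in auto)
  from kills_divide[OF kills_minus[OF this] KQ Qnz]
  have Kk: "kills b v (\<lambda>b. (1 - tsq b) / (1 + tsq b))"
    by (rule kills_cong[OF _ op b]) (rule ratio)
  \<comment> \<open>The map taking R to (1 - R) / (1 + R) is its own inverse, which recovers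
    R.\<close>
  have cay: "(1 - (1 - R) / (1 + R)) / (1 + (1 - R) / (1 + R)) = R" if "1 + R \<noteq> 0" for R :: complex
  proof -
    have "1 - (1 - R) / (1 + R) = 2 * R / (1 + R)" "1 + (1 - R) / (1 + R) = 2 / (1 + R)"
      using that by (simp_all add: field_simps)
    then show ?thesis using that by simp
  qed
  have "1 + (1 - tsq b) / (1 + tsq b) \<noteq> 0" using tsq_nz[of b] by (simp add: field_simps)
  from kills_divide[OF kills_diff[OF kills_const[of _ _ 1] Kk] kills_add[OF kills_const[of _ _ 1] Kk] this]
  have KR: "kills b v tsq"
    by (rule kills_cong[OF _ op b]) (rule cay[OF tsq_nz])
  have YS: "Ypt k p $ Some a / Ypt k p $ None = qz p $ a" if "p \<in> T0 H" for p a
    using ysc_nz[OF that] tsq_nz[of p] by (simp add: Ypt_def ypt_def) (simp add: homog_def)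
  have "qz v $ a = 0" for a
  proof -
    have "kills b v (\<lambda>b. qz b $ a)"
      by (rule kills_cong[OF kills_divide[OF kills_nth[OF KY, of "Some a"] kills_nth[OF KY] Yn] op b YS])
    then show ?thesis
      by (rule kills_linearD) (intro bounded_linear_compose[OF bounded_linear_vec_nth] bounded_linear_fst_comp bounded_linear_ident)
  qed
  then have vz: "qz v = 0" by (simp add: vec_eq_iff)
  have Y0: "Ypt k p $ None = (1 + tsq p) * ysc k p" for p
    by (simp add: Ypt_def ypt_def)
  have yy: "ysc k p * cnj (ysc k p) * tsq p = of_real ((stau k p)\<^sup>2) / 4" if "p \<in> T0 H" for p
    using T[OF that] by (simp add: ysc_def tsq_def power2_eq_square) (simp add: complex_eq_iff)
  \<comment> \<open>The left-hand side is half of r^2 at \<open>Ypt k p\<close>, times R / (1 +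
    R)^2. By \<open>rsq_homog\<close> and \<open>yy\<close> this is half of h times the square of
    \<open>stau k p\<close>.\<close>
  have rho: "\<i> / 4 * ?Q p * tsq p / (1 + tsq p)\<^sup>2 = of_real (qr p)" if p: "p \<in> T0 H" for p
  proof -
    have hp: "himag k (qz p) > 0" using himag_pos[OF PSR] p by (simp add: T0_def)
    have nz: "(1 + tsq p) * ysc k p \<noteq> 0" using tsq_nz ysc_nz[OF p] by simp
    have "rsq k (Ypt k p) = 4 * himag k (qz p) * (norm ((1 + tsq p) * ysc k p))\<^sup>2"
      using rsq_homog[OF s3 nz, of "qz p"] by (simp add: Ypt_def ypt_def vector_smult_assoc)
    then have "complex_of_real (rsq k (Ypt k p)) = 4 * of_real (himag k (qz p)) * (((1 + tsq p) * ysc k p) * cnj ((1 + tsq p) * ysc k p))"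
      unfolding complex_norm_square[symmetric] by simp
    then have "\<i> / 4 * ?Q p * tsq p / (1 + tsq p)\<^sup>2 = 2 * of_real (himag k (qz p)) * (ysc k p * cnj (ysc k p) * tsq p)"
      unfolding Qeq(1)[OF p] using tsq_nz[of p] by (simp add: cnj_tsq power2_eq_square)
    also have "\<dots> = of_real (himag k (qz p) * (stau k p)\<^sup>2 / 2)" unfolding yy[OF p] by simp
    also have "himag k (qz p) * (stau k p)\<^sup>2 / 2 = qr p"
      using hp by (simp add: stau_sq[OF PSR p])
    finally show ?thesis .
  qed
  have "kills b v (\<lambda>b. complex_of_real (qr b))"
    by (rule kills_cong[OF _ op b rho], unfold power2_eq_square) (intro kills_divide kills_mult kills_add kills_const KQ KR, use tsq_nz[of b] in auto)
  from kills_linearD[OF this] have vr: "qr v = 0"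
    by (simp add: bounded_linear_fst_comp bounded_linear_snd_comp bounded_linear_ident bounded_linear_compose[OF bounded_linear_of_real])
  \<comment> \<open>The conjugate of \<open>ysc\<close> is - t / cnj t times \<open>ysc\<close>, so
    only the square of t is visible. Its derivative determines that of t because t is
    nonzero.\<close>
  have tt: "- tsq p * cnj (Ypt k p $ None) / Ypt k p $ None = (qT p)\<^sup>2" if "p \<in> T0 H" for p
  proof -
    have "cnj (Ypt k p $ None) * qT p * (- tsq p) = (qT p)\<^sup>2 * (Ypt k p $ None) * qT p"
      unfolding Y0 using T[OF that] by (simp add: cnj_tsq) (simp add: ysc_def tsq_def power2_eq_square)
    then have "(cnj (Ypt k p $ None) * (- tsq p)) * qT p = ((qT p)\<^sup>2 * (Ypt k p $ None)) * qT p"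
      by (simp only: mult_ac)
    then have "cnj (Ypt k p $ None) * (- tsq p) = (qT p)\<^sup>2 * (Ypt k p $ None)"
      unfolding mult_right_cancel[OF T[OF that]] .
    moreover have "Ypt k p $ None \<noteq> 0" using Ypt_csk[OF that] by (simp add: mem_csk)
    ultimately show ?thesis by (simp add: field_simps)
  qed
  have "kills b v (\<lambda>b. (qT b)\<^sup>2)"
    by (rule kills_cong[OF _ op b tt]) (intro kills_divide kills_mult kills_minus kills_cnj kills_nth KY KR Yn)
  then have "2 * qT b * qT v = 0"
    by (rule killsD) (auto intro!: derivative_eq_intros)
  then have vT: "qT v = 0" using T[OF b] by simp
  have un: "(1 / (1 + tsq p)) *s ((1 + tsq p) *s u) = u" for p :: "'n tpoint" and u :: "complex^('n option)"
    using tsq_nz[of p] unfolding vector_smult_assoc by simp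
  have Ky: "kills b v (ypt k)"
    by (rule kills_cong[OF kills_smult[OF kills_divide[OF kills_const[of _ _ 1] kills_add[OF kills_const KR] tsq_nz] KY] op b])
       (simp only: Ypt_def un)
  have Kf: "kills b v (fpt k)"
    by (rule kills_cong[OF kills_smult[OF kills_divide[OF kills_const[of _ _ 1] kills_add[OF kills_const KR] tsq_nz] KF] op b])
       (simp only: dprepot_Ypt un)
  have Kzy: "kills b v (\<lambda>b. cvec (qy b))"
    by (rule kills_cong[OF kills_diff[OF Kxi kills_diff[OF Ky kills_smult[OF KR kills_cnjvec[OF Ky]]]] op b])
       (simp add: xi_ypt T)
  have Kzt: "kills b v (\<lambda>b. cvec (qt b))"
    by (rule kills_cong[OF kills_diff[OF Kxit kills_diff[OF Kf kills_smult[OF KR kills_cnjvec[OF Kf]]]] op b])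
       (simp add: xi_ypt T)
  have "kills b v (\<lambda>b. alpha k b - (dot (fpt k b) (cvec (qy b)) - dot (ypt k b) (cvec (qt b)))
       + tsq b * (dot (cnjvec (fpt k b)) (cvec (qy b)) - dot (cnjvec (ypt k b)) (cvec (qt b))))"
    by (intro kills_add kills_diff kills_mult kills_dot kills_cnjvec Ka Kf Ky Kzy Kzt KR)
  then have Ks: "kills b v (\<lambda>b. complex_of_real (qs b))"
    by (rule kills_cong[OF _ op b]) (simp add: xi_ypt T)
  have "cvec (qy v) = 0" "cvec (qt v) = 0" "complex_of_real (qs v) = 0"
    by (rule kills_linearD[OF Kzy], intro bounded_linear_compose[OF bounded_linear_cvec] bounded_linear_fst_comp bounded_linear_snd_comp bounded_linear_ident)
       (rule kills_linearD[OF Kzt], intro bounded_linear_compose[OF bounded_linear_cvec] bounded_linear_fst_comp bounded_linear_snd_comp bounded_linear_ident,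
        rule kills_linearD[OF Ks], intro bounded_linear_compose[OF bounded_linear_of_real] bounded_linear_fst_comp bounded_linear_snd_comp bounded_linear_ident)
  then show "v = 0" using vz vr vT by (simp add: prod_eq_iff cvec_def vec_eq_iff)
qed

end

section \<open>The contact form on the twistor space\<close>

abbreviation (input) Xc :: "('n::finite \<Rightarrow> 'n \<Rightarrow> 'n \<Rightarrow> real) \<Rightarrow> 'n tpoint \<Rightarrow> (complex^('n option)) \<times> (complex^('n option)) \<times> complex" where
  "Xc k b \<equiv> (xi k b, xi_tilde k b, alpha k b)"

lemma zw_fun_eq: "zw_fun q = pz q * pw q"
  by (simp add: zw_fun_def case_prod_beta)

lemma zw_has_derivative: "(zw_fun has_derivative (\<lambda>u. pz q * pw u + pz u * pw q)) (at q)"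
  unfolding zw_fun_eq[abs_def] by (intro has_derivative_mult np_has_derivative)

lemma D_zw: "D zw_fun q u = pz q * pw u + pz u * pw q"
  using frechet_derivative_at[OF zw_has_derivative, of q, symmetric] by simp

lemma zw_flow: "zw_fun (flow s q) = zw_fun q"
proof -
  have "cis s * cis (- s) = 1" by (simp add: cis_mult)
  then show ?thesis by (simp add: zw_fun_eq flow_def case_prod_beta)
qed

lemma zw_act: "zw_fun (act x q) = x\<^sup>2 * zw_fun q"
  by (simp add: zw_fun_eq act_def case_prod_beta power2_eq_square)

lemma bounded_linear_act: "bounded_linear (act x :: 'n::finite npoint \<Rightarrow> _)"
  unfolding linear_conv_bounded_linear[symmetric] act_def case_prod_beta
  by (intro linearI) (simp_all add: algebra_simps)

lemma bounded_linear_flow: "bounded_linear (flow s :: 'n::finite npoint \<Rightarrow> _)"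
  unfolding linear_conv_bounded_linear[symmetric] flow_def case_prod_beta
  by (intro linearI) (simp_all add: algebra_simps vec_eq_iff)

lemma N0_act: "x \<noteq> 0 \<Longrightarrow> act x q \<in> N0 H \<longleftrightarrow> q \<in> N0 H"
  by (simp add: N0_def act_def case_prod_beta)

lemma N0_flow: "flow s q \<in> N0 H \<longleftrightarrow> q \<in> N0 H"
  by (simp add: N0_def flow_def case_prod_beta csk_scale)

lemma N0_tw_class: "p \<in> \<Union>(tw_class q) \<Longrightarrow> p \<in> N0 H \<longleftrightarrow> q \<in> N0 H"
  unfolding mem_tw_class by (auto simp: N0_act N0_flow)

lemma twistor_space_0_eq: "twistor_space_0 H = tw_class ` N0 H"
proof (intro equalityI subsetI)
  fix P assume "P \<in> twistor_space_0 H"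
  then obtain q where q: "q \<in> Ntilde H" "P = tw_class q" "\<forall>(z, w, p) \<in> \<Union>P. z \<noteq> 0 \<and> w \<noteq> 0"
    unfolding twistor_space_0_def twistor_space_eq by blast
  then have "case q of (z, w, p) \<Rightarrow> z \<noteq> 0 \<and> w \<noteq> 0" using tw_class_self[of q] by blast
  then have "pz q \<noteq> 0 \<and> pw q \<noteq> 0" by (simp add: case_prod_beta)
  then have "q \<in> N0 H" using q(1) by (simp add: N0_def mem_Ntilde)
  then show "P \<in> tw_class ` N0 H" using q(2) by blast
next
  fix P assume "P \<in> tw_class ` N0 H"
  then obtain q where q: "q \<in> N0 H" "P = tw_class q" by blast
  have "pz p \<noteq> 0 \<and> pw p \<noteq> 0" if "p \<in> \<Union>P" for p
    using N0_tw_class[of p q H] that q by (simp add: N0_def)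
  then have "\<forall>(z, w, p) \<in> \<Union>P. z \<noteq> 0 \<and> w \<noteq> 0" by (simp add: case_prod_beta)
  moreover have "P \<in> twistor_space H" using q N0_subset unfolding twistor_space_eq by blast
  ultimately show "P \<in> twistor_space_0 H" unfolding twistor_space_0_def by blast
qed

lemma derivative_along_constant:
  assumes f: "(f has_derivative f') (at q)" and c: "\<And>s. f (q + s *\<^sub>R v) = f q"
  shows "f' v = 0"
proof -
  have "((\<lambda>s. q + s *\<^sub>R v) has_derivative (\<lambda>s. s *\<^sub>R v)) (at 0)" by (auto intro!: derivative_eq_intros)
  from has_derivative_compose[OF this, of f f'] f
  have "((\<lambda>s. f q) has_derivative (\<lambda>s. f' (s *\<^sub>R v))) (at 0)" by (simp add: c)
  from has_derivative_unique[OF this has_derivative_const]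
  have "f' (1 *\<^sub>R v) = 0" by (rule fun_cong)
  then show ?thesis by simp
qed

lemma C2_dF:
  assumes S: "open S" and f: "C2 S f" and nz: "\<And>x. x \<in> S \<Longrightarrow> f x $ None \<noteq> 0"
  shows "C2 S (\<lambda>x. dF k (f x) V)"
proof -
  have t: "C2 S (\<lambda>x. tail (f x) $ a)" for a by (simp add: tail_def C2_nth[OF f])
  have "C2 S (\<lambda>x. dF k (f x) V $ i)" for i
    using nz by (cases i)
      (auto simp: dF_def intro!: C2_diff C2_divide C2_mult C2_power C2_trilin C2_const C2_nth f t)
  from C2_vec[of S "\<lambda>i x. dF k (f x) V $ i", OF this] show ?thesis by (simp add: vec_nth_inverse)
qed

context
  fixes k :: "'n::finite \<Rightarrow> 'n \<Rightarrow> 'n \<Rightarrow> real" and H :: "(real^'n) set"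
  assumes PSR: "PSR_manifold k H"
begin

section \<open>The twistor space in coordinates, lifts of tangent vectors, and the value of the
  contact form\<close>

lemma projf_tw_class:
  assumes "q \<in> Ntilde H" "p \<in> \<Union>(tw_class q)"
  shows "projf k p = projf k q"
  using assms(2) unfolding mem_tw_class by (auto simp: projf_act projf_flow[OF PSR assms(1)])

lemma twistor_coords_eq:
  assumes q: "q \<in> Ntilde H"
  shows "twistor_coords k H (tw_class q) = projf k q"
proof -
  obtain s where s: "flow s q \<in> slice H" using slice_exists[OF q] by blast
  moreover have "flow s q \<in> \<Union>(tw_class q)" unfolding mem_tw_class by (metis act_1 zero_neq_one)
  moreover have "slice_coords k p = projf k q" if "p \<in> slice H \<inter> \<Union>(tw_class q)" for p
    using that projf_slice[of p H k] projf_tw_class[OF q] by (metis IntD1 IntD2)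
  then have "slice_coords k ` (slice H \<inter> \<Union>(tw_class q)) = (\<lambda>_. projf k q) ` (slice H \<inter> \<Union>(tw_class q))"
    by (rule image_cong[OF refl])
  ultimately have "slice_coords k ` (slice H \<inter> \<Union>(tw_class q)) = {projf k q}"
    unfolding image_constant_conv by auto
  then show ?thesis by (simp add: twistor_coords_def)
qed

lemma proj_eq: "q \<in> Ntilde H \<Longrightarrow> proj k H q = projf k q"
  by (simp add: proj_def twistor_class_eq twistor_coords_eq)

lemma projf_has_derivative:
  assumes "q \<in> N0 H"
  shows "(projf k has_derivative D (projf k) q) (at q)"
  by (rule C2_has_derivative[OF projf_C2[OF PSR]]) (use assms in \<open>simp add: N0_def mem_Ntilde\<close>)

lemma D_proj:
  assumes "q \<in> N0 H"
  shows "D (proj k H) q = D (projf k) q"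
proof -
  have "(proj k H has_derivative D (projf k) q) (at q)"
    by (rule has_derivative_transform_within_open[OF projf_has_derivative[OF assms] open_Ntilde[OF PSR]])
       (use assms N0_subset proj_eq in auto)
  then show ?thesis by (rule frechet_derivative_at[symmetric])
qed

lemma N0E:
  assumes "q \<in> N0 H"
  shows "pz q \<noteq> 0" "pw q \<noteq> 0" "pZ q $ None \<noteq> 0" "rsq k (pZ q) \<noteq> 0" "q \<in> Ntilde H" "zw_fun q \<noteq> 0"
  using assms rsq_pos[OF PSR, of "pZ q"] by (auto simp: N0_def mem_csk[of "pZ q"] mem_Ntilde zw_fun_eq)

lemma twistor_coords_bij: "bij_betw (twistor_coords k H) (twistor_space_0 H) (T0 H)"
proof (rule bij_betw_imageI)
  have sec: "tw_class (sec k (projf k q)) = tw_class q" if q: "q \<in> N0 H" for q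
  proof -
    obtain x s where "x \<noteq> 0" "sec k (projf k q) = act x (flow s q)"
      using sec_projf[OF PSR, of q] N0E[OF q] by blast
    then show ?thesis by (simp add: tw_class_act tw_class_flow)
  qed
  show "inj_on (twistor_coords k H) (twistor_space_0 H)"
  proof (rule inj_onI)
    fix P Q assume "P \<in> twistor_space_0 H" "Q \<in> twistor_space_0 H" and eq: "twistor_coords k H P = twistor_coords k H Q"
    then obtain p q where pq: "p \<in> N0 H" "P = tw_class p" "q \<in> N0 H" "Q = tw_class q"
      unfolding twistor_space_0_eq by blast
    then have "projf k p = projf k q" using eq N0E(5) by (simp add: twistor_coords_eq)
    then show "P = Q" using sec pq by metis
  qed
  show "twistor_coords k H ` twistor_space_0 H = T0 H"
  proof (intro equalityI subsetI)
    fix b assume "b \<in> twistor_coords k H ` twistor_space_0 H"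
    then obtain q where q: "q \<in> N0 H" "b = twistor_coords k H (tw_class q)" unfolding twistor_space_0_eq by blast
    then show "b \<in> T0 H" using N0E(5) projf_T0[OF PSR] by (simp add: twistor_coords_eq)
  next
    fix b assume b: "b \<in> T0 H"
    note s = sec_N0[OF PSR b]
    have "b = twistor_coords k H (tw_class (sec k b))"
      using twistor_coords_eq[OF N0E(5)[OF s]] projf_sec[OF PSR b] by simp
    then show "b \<in> twistor_coords k H ` twistor_space_0 H" unfolding twistor_space_0_eq using s by blast
  qed
qed

text \<open>Let \<open>A\<close> undo the flow and the scaling that lead from \<open>q\<close> to
  \<open>sec k ?b\<close>. Then \<open>A\<close> composed with \<open>sec k\<close> is a local
  section through \<open>q\<close>, since \<open>projf\<close> is invariant, and its derivative is a
  right inverse of the derivative of \<open>projf\<close>.\<close>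

lemma lift_exists:
  assumes q: "q \<in> N0 H"
  shows "\<exists>u. D (projf k) q u = v"
proof -
  let ?b = "projf k q"
  obtain x s where x: "x \<noteq> 0" "sec k ?b = act x (flow s q)"
    using sec_projf[OF PSR, of q] N0E[OF q] by blast
  define A :: "'n npoint \<Rightarrow> 'n npoint" where "A = (\<lambda>p. flow (- s) (act (1 / x) p))"
  have A: "bounded_linear A" unfolding A_def
    by (rule bounded_linear_compose[OF bounded_linear_flow bounded_linear_act])
  have Aq: "A (sec k ?b) = q" unfolding A_def x(2) using x(1) by (simp add: act_act act_flow[symmetric] flow_add)
  have b: "?b \<in> T0 H" by (rule projf_T0[OF PSR q])
  have id: "projf k (A (sec k b')) = b'" if "b' \<in> T0 H" for b'
  proof -
    have "act (1 / x) (sec k b') \<in> Ntilde H" using N0E(5)[OF sec_N0[OF PSR that]] x(1) by (simp add: act_Ntilde)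
    then show ?thesis unfolding A_def using x(1) projf_sec[OF PSR that]
      by (simp add: projf_flow[OF PSR] projf_act)
  qed
  have "((\<lambda>b. A (sec k b)) has_derivative (\<lambda>v. A (D (sec k) ?b v))) (at ?b)"
    by (rule bounded_linear.has_derivative[OF A C2_has_derivative[OF C2_sec[OF PSR] b]])
  moreover have "(projf k has_derivative D (projf k) q) (at (A (sec k ?b)))"
    unfolding Aq by (rule projf_has_derivative[OF q])
  ultimately have "((\<lambda>b. projf k (A (sec k b))) has_derivative (\<lambda>v. D (projf k) q (A (D (sec k) ?b v)))) (at ?b)"
    by (rule has_derivative_compose)
  then have "((\<lambda>b. b) has_derivative (\<lambda>v. D (projf k) q (A (D (sec k) ?b v)))) (at ?b)"
    by (rule has_derivative_transform_within_open[OF _ open_T0[OF PSR] b id])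
  from has_derivative_unique[OF this has_derivative_ident] show ?thesis by metis
qed

text \<open>The direction is tangent to the orbit of \<open>act\<close>, on which
  \<open>projf\<close> is constant. As \<open>zw_fun\<close> has degree 2 and is nonzero on
  \<open>N0\<close>, the multiple \<open>c / (2 * zw_fun q)\<close> gives the prescribed
  value.\<close>

lemma fibre_direction:
  assumes q: "q \<in> N0 H"
  shows "\<exists>u. D (projf k) q u = 0 \<and> D zw_fun q u = c"
proof -
  let ?h = "\<lambda>y. (y * pz q, y * pw q, 0, 0, 0, 0) :: 'n npoint"
  have bl: "bounded_linear ?h"
    unfolding linear_conv_bounded_linear[symmetric] by (intro linearI) (simp_all add: algebra_simps zero_prod_def)
  have a: "act x q = q + ?h (x - 1)" for x
    by (simp add: act_def case_prod_beta prod_eq_iff algebra_simps)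
  have "((\<lambda>x. q + ?h (x - 1)) has_derivative ?h) (at 1)"
  proof -
    have "((\<lambda>x::complex. x - 1) has_derivative (\<lambda>x. x)) (at 1)" by (auto intro!: derivative_eq_intros)
    from has_derivative_add[OF has_derivative_const bounded_linear.has_derivative[OF bl this]]
    show ?thesis by simp
  qed
  then have "((\<lambda>x. act x q) has_derivative ?h) (at 1)" by (simp add: a)
  moreover have "(projf k has_derivative D (projf k) q) (at (act 1 q))" by (simp add: projf_has_derivative[OF q])
  ultimately have "((\<lambda>x. projf k (act x q)) has_derivative (\<lambda>y. D (projf k) q (?h y))) (at 1)"
    by (rule has_derivative_compose)
  then have "((\<lambda>x :: complex. projf k q) has_derivative (\<lambda>y. D (projf k) q (?h y))) (at 1)"
    by (rule has_derivative_transform_within_open[of _ _ _ _ "{x. x \<noteq> 0}"])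
       (auto simp: projf_act intro!: open_Collect_neq continuous_intros)
  from has_derivative_unique[OF this has_derivative_const]
  have "D (projf k) q (?h y) = 0" for y by metis
  moreover have "D zw_fun q (?h (c / (2 * zw_fun q))) = c"
    using N0E(6)[OF q] by (simp add: D_zw zw_fun_eq field_simps)
  ultimately show ?thesis by blast
qed

lemma D_coords_projf:
  assumes q: "q \<in> N0 H"
  shows "D cxi q u = D (xi k) (projf k q) (D (projf k) q u)"
    "D (cxit k) q u = D (xi_tilde k) (projf k q) (D (projf k) q u)"
    "D (calpha k) q u = D (alpha k) (projf k q) (D (projf k) q u)"
proof -
  note b = projf_T0[OF PSR q]
  have *: "D c q u = D f (projf k q) (D (projf k) q u)"
    if "C2 (T0 H) f" "\<And>q. q \<in> N0 H \<Longrightarrow> f (projf k q) = c q" for f :: "'n tpoint \<Rightarrow> 'b::real_normed_vector" and c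
  proof -
    have "(c has_derivative (\<lambda>u. D f (projf k q) (D (projf k) q u))) (at q)"
      by (rule has_derivative_transform_within_open[OF has_derivative_compose[OF projf_has_derivative[OF q] C2_has_derivative[OF that(1) b]] open_N0[OF PSR] q that(2)])
    from frechet_derivative_at[OF this] show ?thesis by metis
  qed
  show "D cxi q u = D (xi k) (projf k q) (D (projf k) q u)"
    "D (cxit k) q u = D (xi_tilde k) (projf k q) (D (projf k) q u)"
    "D (calpha k) q u = D (alpha k) (projf k q) (D (projf k) q u)"
    by (rule *, simp_all add: C2_xis[OF PSR] coords_projf[OF PSR])+
qed

text \<open>For every lift of \<open>v\<close>, at every point \<open>q\<close> over
  \<open>P\<close>, the value of \<open>lambda_tilde\<close> is the same multiple \<open>c\<close>
  of \<open>zw_fun q\<close>. With \<open>L_elem_act\<close> both sets under \<open>the_elem\<close>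
  are therefore singletons.\<close>

lemma contact_form_value:
  assumes P: "P \<in> twistor_space_0 H" and b: "b = twistor_coords k H P"
  shows "contact_form k H P v = L_scale (1 / (8 * \<i>) *
      (D (alpha k) b v + pairing (xi_tilde k b, xi k b) (D (xi_tilde k) b v, D (xi k) b v))) (L_section H zw_fun P)"
proof -
  obtain q0 where q0: "q0 \<in> N0 H" "P = tw_class q0" using P unfolding twistor_space_0_eq by (rule imageE)
  have b0: "b = projf k q0" unfolding b q0(2) by (rule twistor_coords_eq[OF N0E(5)[OF q0(1)]])
  define c where "c = 1 / (8 * \<i>) * (D (alpha k) b v + pairing (xi_tilde k b, xi k b) (D (xi_tilde k) b v, D (xi k) b v))"
  have L: "L_elem (curve_through H q) (a * zw_fun q) = L_elem (orbit q0) (a * zw_fun q0)" if "q \<in> \<Union>P" for q a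
  proof -
    from that have "\<exists>x s. x \<noteq> 0 \<and> q = act x (flow s q0)" unfolding q0(2) mem_tw_class .
    then obtain x s where x: "x \<noteq> 0" "q = act x (flow s q0)" by (elim exE conjE)
    have "curve_through H q = orbit q"
      using Union_tw_class_Ntilde[OF N0E(5)[OF q0(1)], of q] that q0(2) by (simp add: curve_through_eq)
    also have "\<dots> = act x ` orbit q0" unfolding x(2) by (simp add: act_orbit[symmetric] orbit_flow)
    finally have "curve_through H q = act x ` orbit q0" .
    moreover have "a * zw_fun q = x\<^sup>2 * (a * zw_fun q0)" unfolding x(2) by (simp add: zw_act zw_flow)
    ultimately show ?thesis using L_elem_act[OF x(1)] by metis
  qed
  have lam: "lambda_tilde k q u = c * zw_fun q" if "q \<in> \<Union>P" "D (proj k H) q u = v" for q u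
  proof -
    have q: "q \<in> N0 H" using N0_tw_class[of q q0 H] that(1) q0 by simp
    have bq: "projf k q = b" using projf_tw_class[OF N0E(5)[OF q0(1)]] that(1) q0(2) b0 by simp
    have v: "D (projf k) q u = v" using that(2) D_proj[OF q] by simp
    show ?thesis
      unfolding lambda_tilde_D[OF PSR_sym[OF PSR] N0E(1-4)[OF q]] D_coords_projf[OF q] bq v c_def
        coords_projf[OF PSR q, symmetric] pairing_eq_dot
      by (simp add: zw_fun_eq)
  qed
  have q0P: "q0 \<in> \<Union>P" unfolding q0(2) by (rule tw_class_self)
  obtain u0 where u0: "D (proj k H) q0 u0 = v" using lift_exists[OF q0(1), of v] D_proj[OF q0(1)] by auto
  have "{L_elem (curve_through H q) (lambda_tilde k q u) |q u. q \<in> \<Union>P \<and> D (proj k H) q u = v} = {L_elem (orbit q0) (c * zw_fun q0)}"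
    (is "?S = _")
  proof (intro equalityI subsetI)
    fix l assume "l \<in> ?S"
    then obtain q u where "l = L_elem (curve_through H q) (lambda_tilde k q u)" "q \<in> \<Union>P" "D (proj k H) q u = v" by blast
    then show "l \<in> {L_elem (orbit q0) (c * zw_fun q0)}" using lam L by simp
  next
    fix l assume "l \<in> {L_elem (orbit q0) (c * zw_fun q0)}"
    then have "l = L_elem (curve_through H q0) (lambda_tilde k q0 u0)" using lam[OF q0P u0] L[OF q0P] by simp
    then show "l \<in> ?S" using q0P u0 by blast
  qed
  then have "contact_form k H P v = L_elem (orbit q0) (c * zw_fun q0)" by (simp add: contact_form_def)
  moreover have "{L_elem (curve_through H q) (zw_fun q) |q. q \<in> \<Union>P} = {L_elem (orbit q0) (zw_fun q0)}" (is "?S = _")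
  proof (intro equalityI subsetI)
    fix l assume "l \<in> ?S"
    then obtain q where "l = L_elem (curve_through H q) (zw_fun q)" "q \<in> \<Union>P" by blast
    then show "l \<in> {L_elem (orbit q0) (zw_fun q0)}" using L[of q 1] by simp
  next
    fix l assume "l \<in> {L_elem (orbit q0) (zw_fun q0)}"
    then have "l = L_elem (curve_through H q0) (zw_fun q0)" using L[OF q0P, of 1] by simp
    then show "l \<in> ?S" using q0P by blast
  qed
  then have "L_section H zw_fun P = L_elem (orbit q0) (zw_fun q0)" by (simp add: L_section_def)
  ultimately show ?thesis unfolding c_def[symmetric] by (simp add: L_scale_L_elem)
qed

text \<open>The kernel of d\<lambda> is tested against the direction \<open>s\<close> of \<sigma>'.
  The coefficients of \<open>lambda_tilde\<close> do not depend on \<sigma>', and its value on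
  \<open>s\<close> is - \<i>\<pi>/2 z w; so d\<lambda>(u, s) is a constant multiple of d(zw)(u), at
  the points with z w = 0 as well.\<close>

lemma holomorphic_zw: "holomorphic_L_section k H zw_fun"
  unfolding holomorphic_L_section_def
proof (intro conjI ballI allI impI)
  fix c p q assume "c \<in> Nhat H" "p \<in> c" "q \<in> c"
  then obtain r where "c = orbit r" unfolding Nhat_eq by blast
  then show "zw_fun p = zw_fun q" using \<open>p \<in> c\<close> \<open>q \<in> c\<close> unfolding orbit_def by (auto simp only: zw_flow)
next
  fix q x show "zw_fun (act x q) = x\<^sup>2 * zw_fun q" by (rule zw_act)
next
  fix q :: "'n npoint" show "zw_fun differentiable (at q)" using zw_has_derivative unfolding differentiable_def by blast
next
  fix q assume q: "q \<in> Ntilde H"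
  fix uu assume "uu \<in> kernel_dlambda k q"
  then obtain u1 u2 where uu: "uu = (u1, u2)" and ker: "\<And>v. ext_deriv (lambda_tilde k) q u1 v + \<i> * ext_deriv (lambda_tilde k) q u2 v = 0"
    by (auto simp: kernel_dlambda_def)
  define s :: "'n npoint" where "s = (0, 0, 0, 0, 0, 1)"
  note s3 = PSR_sym[OF PSR]
  have Zn: "pZ p $ None \<noteq> 0" "rsq k (pZ p) \<noteq> 0" if "p \<in> Ntilde H" for p
    using that rsq_pos[OF PSR, of "pZ p"] by (auto simp: mem_Ntilde mem_csk[of "pZ p"])
  \<comment> \<open>\<open>derivative_along_constant\<close> requires differentiability in the base
    point; \<open>gM_euler\<close> eliminates the quotient in \<open>eta\<close>, after which every
    term is visibly \<open>C2\<close>.\<close>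
  have C: "C2 (Ntilde H) (\<lambda>p. lambda_tilde k p u)" for u
  proof -
    have F: "C2 (Ntilde H) (\<lambda>q. dprepot k (pZ q))" and G: "C2 (Ntilde H) (\<lambda>q. dF k (pZ q) (pZ u))"
      using Zn by (intro C2_dprepot_vec[OF s3 open_Ntilde[OF PSR]] C2_dF open_Ntilde[OF PSR] C2_np; blast)+
    have "C2 (Ntilde H) (\<lambda>q. of_real (pi / 4) *
          (of_real (2 * pi * rsq k (pZ q)) * (pz q * pw u - pw q * pz u)
           + (pz q)\<^sup>2 * (dot (dprepot k (pZ q)) (cvec (py u)) + dot (pZ q) (cvec (pt u)))
           + (pw q)\<^sup>2 * (dot (cnjvec (dprepot k (pZ q))) (cvec (py u)) + dot (cnjvec (pZ q)) (cvec (pt u)))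
           - 2 * \<i> * pz q * pw q * (of_real (ps u) - 1 / (4 * of_real pi) * (dot (cvec (pt q)) (cvec (py u)) - dot (cvec (py q)) (cvec (pt u)))
      + of_real pi * (- (dot (dprepot k (pZ q)) (cnjvec (pZ u)) + dot (cnjvec (dprepot k (pZ q))) (pZ u) - dot (cnjvec (pZ q)) (dF k (pZ q) (pZ u)) - dot (pZ q) (cnjvec (dF k (pZ q) (pZ u)))) / 4))))"
      by (intro C2_add C2_diff C2_mult C2_minus C2_divide C2_power C2_of_real C2_dot C2_cvec C2_cnjvec C2_const C2_np F G rsq_C2[OF s3 open_Ntilde[OF PSR]])
         (use Zn in auto)
    then show ?thesis
    proof (rule C2_cong[OF _ open_Ntilde[OF PSR]])
      fix p assume p: "p \<in> Ntilde H"
      show "of_real (pi / 4) *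
          (of_real (2 * pi * rsq k (pZ p)) * (pz p * pw u - pw p * pz u)
           + (pz p)\<^sup>2 * (dot (dprepot k (pZ p)) (cvec (py u)) + dot (pZ p) (cvec (pt u)))
           + (pw p)\<^sup>2 * (dot (cnjvec (dprepot k (pZ p))) (cvec (py u)) + dot (cnjvec (pZ p)) (cvec (pt u)))
           - 2 * \<i> * pz p * pw p * (of_real (ps u) - 1 / (4 * of_real pi) * (dot (cvec (pt p)) (cvec (py u)) - dot (cvec (py p)) (cvec (pt u)))
      + of_real pi * (- (dot (dprepot k (pZ p)) (cnjvec (pZ u)) + dot (cnjvec (dprepot k (pZ p))) (pZ u) - dot (cnjvec (pZ p)) (dF k (pZ p) (pZ u)) - dot (pZ p) (cnjvec (dF k (pZ p) (pZ u)))) / 4)))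
       = lambda_tilde k p u"
        unfolding gM_euler[OF s3 Zn(1)[OF p], symmetric] using Zn(2)[OF p]
        by (simp add: lambda_tilde_def theta_plus_def theta_minus_def theta_3_def fM_def eta_def euler_def case_prod_beta pairing_eq_dot dot_simps cnjvec_simps add_ac)
    qed
  qed
  have "D (\<lambda>x. lambda_tilde k x u) q s = 0" for u
    by (rule derivative_along_constant[OF C2_has_derivative[OF C q]])
       (simp add: s_def lambda_tilde_def theta_plus_def theta_minus_def theta_3_def case_prod_beta)
  moreover have "D (\<lambda>x. lambda_tilde k x s) q u = - (\<i> * pi / 2) * D zw_fun q u" for u
  proof -
    have "(\<lambda>x. lambda_tilde k x s) = (\<lambda>x. - (\<i> * pi / 2) * zw_fun x)"
      by (rule ext) (simp add: s_def lambda_tilde_def theta_plus_def theta_minus_def theta_3_def case_prod_beta pairing_eq_dot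
         zw_fun_eq dot_def cvec_def eta_def gM_def)
    then have "((\<lambda>x. lambda_tilde k x s) has_derivative (\<lambda>u. - (\<i> * pi / 2) * D zw_fun q u)) (at q)"
      using has_derivative_mult_right[OF zw_has_derivative[of q], of "- (\<i> * pi / 2)"] by (simp add: D_zw)
    from frechet_derivative_at[OF this] show ?thesis by metis
  qed
  ultimately have "- (\<i> * pi / 2) * (D zw_fun q u1 + \<i> * D zw_fun q u2) = 0"
    using ker[of s] by (simp add: ext_deriv_def algebra_simps)
  then have "D zw_fun q u1 + \<i> * D zw_fun q u2 = 0" by simp
  then show "case uu of (u1, u2) \<Rightarrow> D zw_fun q u1 + \<i> * D zw_fun q u2 = 0" by (simp add: uu)
qed

end

section \<open>The complex structure\<close>

lemma times_i_linear: "linear times_i"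
  unfolding times_i_def case_prod_beta by (intro linearI) (simp_all add: algebra_simps vec_eq_iff)

lemma times_i_times_i: "times_i (times_i x) = - x"
  by (simp add: times_i_def case_prod_beta prod_eq_iff vector_smult_assoc)

context
  fixes k :: "'n::finite \<Rightarrow> 'n \<Rightarrow> 'n \<Rightarrow> real" and H :: "(real^'n) set"
  assumes PSR: "PSR_manifold k H"
begin

section \<open>The differential of the coordinate map as an isomorphism\<close>

lemma C2_Xc: "C2 (T0 H) (Xc k)"
  by (intro C2_Pair C2_xis[OF PSR])

lemma D_Xc:
  assumes "b \<in> T0 H"
  shows "D (Xc k) b v = (D (xi k) b v, D (xi_tilde k) b v, D (alpha k) b v)"
proof -
  have "(Xc k has_derivative (\<lambda>v. (D (xi k) b v, D (xi_tilde k) b v, D (alpha k) b v))) (at b)"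
    by (intro has_derivative_Pair C2_has_derivative[OF C2_xis(1)[OF PSR] assms]
        C2_has_derivative[OF C2_xis(2)[OF PSR] assms] C2_has_derivative[OF C2_xis(3)[OF PSR] assms])
  from fun_cong[OF frechet_derivative_at[OF this], of v, symmetric] show ?thesis .
qed

lemma linear_D_Xc: "b \<in> T0 H \<Longrightarrow> linear (D (Xc k) b)"
  using C2_has_derivative[OF C2_Xc] has_derivative_linear by blast

lemma inj_D_Xc:
  assumes b: "b \<in> T0 H"
  shows "inj (D (Xc k) b)"
  unfolding linear_injective_0[OF linear_D_Xc[OF b]] D_Xc[OF b]
  using coords_kernel[OF PSR b] by (simp add: zero_prod_def)

lemma dim_eq: "DIM('n tpoint) = DIM((complex^('n option)) \<times> (complex^('n option)) \<times> complex)"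
  by simp

lemma bij_D_Xc:
  assumes b: "b \<in> T0 H"
  shows "bij (D (Xc k) b)"
proof -
  have "dim (range (D (Xc k) b)) = DIM((complex^('n option)) \<times> (complex^('n option)) \<times> complex)"
    using dim_image_eq[OF linear_D_Xc[OF b] inj_on_subset[OF inj_D_Xc[OF b]]] dim_eq by (auto simp: dim_UNIV)
  then have "span (range (D (Xc k) b)) = UNIV" by (simp only: dim_eq_full)
  moreover have "span (range (D (Xc k) b)) = range (D (Xc k) b)"
    unfolding span_eq_iff by (rule linear_subspace_image[OF linear_D_Xc[OF b] subspace_UNIV])
  ultimately have "surj (D (Xc k) b)" by (simp only:)
  then show ?thesis using inj_D_Xc[OF b] by (simp add: bij_def)
qed

text \<open>A lift of a tangent vector of the twistor space realizes the last three values; adding a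
  vertical vector then adjusts the derivative of zw without changing them.\<close>

lemma coords_derivative_surj:
  assumes q: "q \<in> N0 H"
  shows "\<exists>u. D zw_fun q u = c \<and> D cxi q u = x \<and> D (cxit k) q u = xt \<and> D (calpha k) q u = a"
proof -
  have b: "projf k q \<in> T0 H" by (rule projf_T0[OF PSR q])
  obtain v where "(x, xt, a) = D (Xc k) (projf k q) v"
    by (rule surjE[OF bij_is_surj[OF bij_D_Xc[OF b]]])
  then have v: "D (Xc k) (projf k q) v = (x, xt, a)" by (rule sym)
  obtain u1 where u1: "D (projf k) q u1 = v" using lift_exists[OF PSR q] by blast
  obtain u2 where u2: "D (projf k) q u2 = 0" "D zw_fun q u2 = c - D zw_fun q u1" using fibre_direction[OF PSR q] by blast
  have "D (projf k) q (u1 + u2) = v"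
    using linear_add[OF has_derivative_linear[OF projf_has_derivative[OF PSR q]]] u1 u2 by simp
  moreover have "D zw_fun q (u1 + u2) = c"
    using u2(2) by (simp add: D_zw algebra_simps)
  ultimately show ?thesis
    using v unfolding D_coords_projf[OF PSR q] D_Xc[OF b] by (intro exI[of _ "u1 + u2"]) simp
qed

section \<open>The exterior derivative of \<lambda> and its kernel\<close>

definition Theta :: "'n npoint \<Rightarrow> 'n npoint \<Rightarrow> complex" where
  "Theta q v = D (calpha k) q v + dot (cxit k q) (D cxi q v) - dot (cxi q) (D (cxit k) q v)"

text \<open>This is the Leibniz rule for zw \<Theta> / 8\<i>. The two halves of the symplectic term
  contribute equally to d\<Theta>, whence the factor 2.\<close>

lemma ext_deriv_lambda:
  assumes q: "q \<in> N0 H"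
  shows "ext_deriv (lambda_tilde k) q u v = 1 / (8 * \<i>) * (D zw_fun q u * Theta q v - D zw_fun q v * Theta q u
     + 2 * zw_fun q * (dot (D (cxit k) q u) (D cxi q v) - dot (D (cxit k) q v) (D cxi q u)))"
proof -
  note op = open_N0[OF PSR] and s3 = PSR_sym[OF PSR]
  have C: "C2 (N0 H) cxi" "C2 (N0 H) (cxit k)" "C2 (N0 H) (calpha k)"
    using N0E[OF PSR] by (intro C2_coords[OF s3 op]; blast)+
  \<comment> \<open>\<open>D2\<close> collects the second derivatives; being symmetric they drop out
    of the antisymmetrization.\<close>
  define D2 where "D2 = (\<lambda>v u. D (\<lambda>x. D (calpha k) x v) q u + dot (cxit k q) (D (\<lambda>x. D cxi x v) q u)
      - dot (cxi q) (D (\<lambda>x. D (cxit k) x v) q u))"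
  have sym: "D2 v u = D2 u v" for u v
    unfolding D2_def C2_second_derivative(2)[OF C(1) op q, of v u] C2_second_derivative(2)[OF C(2) op q, of v u]
      C2_second_derivative(2)[OF C(3) op q, of v u] ..
  have der: "D (\<lambda>x. lambda_tilde k x v) q u = 1 / (8 * \<i>) * (D zw_fun q u * Theta q v + zw_fun q *
      (D2 v u + dot (D (cxit k) q u) (D cxi q v) - dot (D cxi q u) (D (cxit k) q v)))" for u v
  proof -
    have dzw: "(zw_fun has_derivative D zw_fun q) (at q)"
      using zw_has_derivative[of q] unfolding frechet_derivative_at[OF zw_has_derivative[of q], symmetric] .
    have "((\<lambda>x. Theta x v) has_derivative (\<lambda>u. D (\<lambda>x. D (calpha k) x v) q u
        + (dot (cxit k q) (D (\<lambda>x. D cxi x v) q u) + dot (D (cxit k) q u) (D cxi q v))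
        - (dot (cxi q) (D (\<lambda>x. D (cxit k) x v) q u) + dot (D cxi q u) (D (cxit k) q v)))) (at q)"
      unfolding Theta_def
      by (intro has_derivative_diff has_derivative_add has_derivative_dot C2_second_derivative(1)[OF C(1) op q]
         C2_second_derivative(1)[OF C(2) op q] C2_second_derivative(1)[OF C(3) op q]
         C2_has_derivative[OF C(1) q] C2_has_derivative[OF C(2) q])
    from has_derivative_mult_right[OF has_derivative_mult[OF dzw this], of "1 / (8 * \<i>)"]
    have "((\<lambda>x. lambda_tilde k x v) has_derivative (\<lambda>u. 1 / (8 * \<i>) * (zw_fun q * (D (\<lambda>x. D (calpha k) x v) q u
        + (dot (cxit k q) (D (\<lambda>x. D cxi x v) q u) + dot (D (cxit k) q u) (D cxi q v))
        - (dot (cxi q) (D (\<lambda>x. D (cxit k) x v) q u) + dot (D cxi q u) (D (cxit k) q v))) + D zw_fun q u * Theta q v))) (at q)"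
    proof (rule has_derivative_transform_within_open[OF _ op q])
      fix p assume p: "p \<in> N0 H"
      show "1 / (8 * \<i>) * (zw_fun p * Theta p v) = lambda_tilde k p v"
        unfolding lambda_tilde_D[OF s3 N0E(1-4)[OF PSR p]] Theta_def zw_fun_eq by simp
    qed
    from fun_cong[OF frechet_derivative_at[OF this], of u, symmetric] show ?thesis
      unfolding D2_def by (simp add: algebra_simps)
  qed
  show ?thesis
    unfolding ext_deriv_def der sym[of v u] dot_commute[of "D cxi q u"] dot_commute[of "D cxi q v"]
    by (simp add: field_simps)
qed

text \<open>In the independent differentials of zw, \<alpha>, \<xi>, \<xi>~ the form d\<lambda> is
  nondegenerate: d(zw) is paired with \<Theta>, and d\<xi> with d\<xi>~.\<close>

lemma kernel_dlambda_iff: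
  assumes q: "q \<in> N0 H"
  shows "(u1, u2) \<in> kernel_dlambda k q \<longleftrightarrow>
    D zw_fun q u1 + \<i> * D zw_fun q u2 = 0 \<and> D cxi q u1 + \<i> *s D cxi q u2 = 0 \<and>
    D (cxit k) q u1 + \<i> *s D (cxit k) q u2 = 0 \<and> D (calpha k) q u1 + \<i> * D (calpha k) q u2 = 0"
proof -
  define A where "A = D zw_fun q u1 + \<i> * D zw_fun q u2"
  define X where "X = D cxi q u1 + \<i> *s D cxi q u2"
  define Y where "Y = D (cxit k) q u1 + \<i> *s D (cxit k) q u2"
  define B where "B = Theta q u1 + \<i> * Theta q u2"
  have B: "B = (D (calpha k) q u1 + \<i> * D (calpha k) q u2) + dot (cxit k q) X - dot (cxi q) Y"
    by (simp add: B_def X_def Y_def Theta_def dot_simps algebra_simps)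
  have e: "ext_deriv (lambda_tilde k) q u1 v + \<i> * ext_deriv (lambda_tilde k) q u2 v =
     1 / (8 * \<i>) * (A * Theta q v - D zw_fun q v * B + 2 * zw_fun q * (dot Y (D cxi q v) - dot (D (cxit k) q v) X))" for v
    unfolding ext_deriv_lambda[OF q] A_def B_def X_def Y_def by (simp add: dot_simps field_simps)
  have "(u1, u2) \<in> kernel_dlambda k q \<longleftrightarrow>
      (\<forall>v. A * Theta q v - D zw_fun q v * B + 2 * zw_fun q * (dot Y (D cxi q v) - dot (D (cxit k) q v) X) = 0)"
    unfolding kernel_dlambda_def mem_Collect_eq prod.case e by simp
  also have "\<dots> \<longleftrightarrow> A = 0 \<and> B = 0 \<and> X = 0 \<and> Y = 0"
  proof
    assume *: "\<forall>v. A * Theta q v - D zw_fun q v * B + 2 * zw_fun q * (dot Y (D cxi q v) - dot (D (cxit k) q v) X) = 0"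
    \<comment> \<open>The derivatives of the four functions along \<open>v\<close> may be
      prescribed. The instances below give the values of \<open>a\<close>, \<open>x\<close>,
      \<open>xt\<close>, \<open>c\<close> in this order, and each isolates one of \<open>A\<close>,
      \<open>B\<close>, a component of \<open>Y\<close>, a component of \<open>X\<close>.\<close>
    have test: "A * (a + dot (cxit k q) x - dot (cxi q) xt) - c * B + 2 * zw_fun q * (dot Y x - dot xt X) = 0" for c x xt a
    proof -
      obtain v where "D zw_fun q v = c" "D cxi q v = x" "D (cxit k) q v = xt" "D (calpha k) q v = a"
        using coords_derivative_surj[OF q] by blast
      then show ?thesis using *[rule_format, of v] by (simp add: Theta_def)
    qed
    have d0: "dot x 0 = 0" "dot 0 x = 0" for x :: "complex^('n option)" by (simp_all add: dot_def)
    have A0: "A = 0" using test[of 1 0 0 0] by (simp add: d0)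
    have B0: "B = 0" using test[of 0 0 0 1] by (simp add: d0 A0)
    have ax1: "dot x (axis i 1) = x $ i" for x :: "complex^('n option)" and i
    proof -
      have "dot x (axis i 1) = (\<Sum>j\<in>UNIV. if j = i then x $ j else 0)"
        unfolding dot_def axis_def by (intro sum.cong) auto
      then show ?thesis by simp
    qed
    note ax = ax1 ax1[unfolded dot_commute[of _ "axis _ 1"]]
    have "Y $ i = 0" for i using test[of 0 "axis i 1" 0 0] N0E(6)[OF PSR q] by (simp add: d0 A0 ax)
    moreover have "X $ i = 0" for i using test[of 0 0 "axis i 1" 0] N0E(6)[OF PSR q] by (simp add: d0 A0 ax)
    ultimately show "A = 0 \<and> B = 0 \<and> X = 0 \<and> Y = 0" using A0 B0 by (simp add: vec_eq_iff)
  qed (simp add: dot_def)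
  also have "\<dots> \<longleftrightarrow> A = 0 \<and> X = 0 \<and> Y = 0 \<and> D (calpha k) q u1 + \<i> * D (calpha k) q u2 = 0"
    unfolding B by (auto simp: dot_def)
  finally show ?thesis by (simp add: A_def X_def Y_def)
qed

text \<open>The three functions factor through the projection, so the conditions on their
  differentials descend; the condition on zw concerns only the vertical part of a lift.\<close>

lemma twistor_01_eq:
  assumes b: "b \<in> T0 H"
  shows "twistor_01 k H b = {(v1, v2). D (Xc k) b v1 + times_i (D (Xc k) b v2) = 0}"
proof (intro equalityI subsetI)
  fix x assume "x \<in> twistor_01 k H b"
  then obtain q u1 u2 where x: "x = (D (proj k H) q u1, D (proj k H) q u2)"
    and q: "q \<in> \<Union>(\<Union>(twistor_space_0 H))" "proj k H q = b" "(u1, u2) \<in> kernel_dlambda k q"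
    unfolding twistor_01_def by blast
  obtain q0 where "q0 \<in> N0 H" "q \<in> \<Union>(tw_class q0)" using q(1) unfolding twistor_space_0_eq by blast
  then have q': "q \<in> N0 H" using N0_tw_class by blast
  have "projf k q = b" using q(2) proj_eq[OF PSR N0E(5)[OF PSR q']] by simp
  then show "x \<in> {(v1, v2). D (Xc k) b v1 + times_i (D (Xc k) b v2) = 0}"
    using q(3) unfolding x kernel_dlambda_iff[OF q'] D_coords_projf[OF PSR q'] D_proj[OF PSR q']
    by (simp add: D_Xc[OF b] times_i_def zero_prod_def)
next
  fix x assume "x \<in> {(v1, v2). D (Xc k) b v1 + times_i (D (Xc k) b v2) = 0}"
  then obtain v1 v2 where x: "x = (v1, v2)" and v: "D (Xc k) b v1 + times_i (D (Xc k) b v2) = 0" by auto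
  define q where "q = sec k b"
  have q: "q \<in> N0 H" and qb: "projf k q = b" unfolding q_def by (rule sec_N0[OF PSR b], rule projf_sec[OF PSR b])
  obtain u1 u2 where u: "D (projf k) q u1 = v1" "D (projf k) q u2 = v2" using lift_exists[OF PSR q] by metis
  \<comment> \<open>A vertical vector that restores the condition on d(zw), which the chosen lifts
    need not satisfy.\<close>
  obtain u3 where u3: "D (projf k) q u3 = 0" "D zw_fun q u3 = - (D zw_fun q u1 + \<i> * D zw_fun q u2)"
    using fibre_direction[OF PSR q] by blast
  have u13: "D (projf k) q (u1 + u3) = v1"
    using linear_add[OF has_derivative_linear[OF projf_has_derivative[OF PSR q]]] u u3 by simp
  have "D zw_fun q (u1 + u3) + \<i> * D zw_fun q u2 = 0"
    using u3(2) by (simp add: D_zw algebra_simps)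
  then have "(u1 + u3, u2) \<in> kernel_dlambda k q"
    using v unfolding kernel_dlambda_iff[OF q] D_coords_projf[OF PSR q] u13 u(2) qb D_Xc[OF b]
    by (simp add: times_i_def zero_prod_def)
  moreover have "q \<in> \<Union>(\<Union>(twistor_space_0 H))" unfolding twistor_space_0_eq using q tw_class_self[of q] by blast
  moreover have "proj k H q = b" using proj_eq[OF PSR N0E(5)[OF PSR q]] qb by simp
  moreover have "x = (D (proj k H) q (u1 + u3), D (proj k H) q u2)" unfolding x D_proj[OF PSR q] u13 u(2) ..
  ultimately show "x \<in> twistor_01 k H b" unfolding twistor_01_def by blast
qed

text \<open>Multiplication by \<i>, transported by the differential of the coordinates, is a complex
  structure with the required (0,1)-space. It is the only one: the pair of \<open>v\<close> and its
  image lies in \<open>space_01\<close> for every \<open>v\<close>, so the (0,1)-space is determined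
  by, and determines, the operator.\<close>

lemma twistor_J_holomorphic:
  assumes b: "b \<in> T0 H"
  shows "D (Xc k) b (twistor_J k H b v) = times_i (D (Xc k) b v)"
proof -
  define L where "L = D (Xc k) b"
  have lin: "linear L" and bij: "bij L" unfolding L_def by (rule linear_D_Xc[OF b], rule bij_D_Xc[OF b])
  define M where "M = inv L"
  have retr: "M (L v) = v" and sect: "L (M y) = y" for v y
    using bij by (auto simp: M_def bij_is_inj bij_is_surj surj_f_inv_f)
  have linM: "linear M"
  proof (rule linearI)
    show "M (x + y) = M x + M y" for x y using retr[of "M x + M y"] by (simp add: linear_add[OF lin] sect)
    show "M (r *\<^sub>R x) = r *\<^sub>R M x" for r x using retr[of "r *\<^sub>R M x"] by (simp add: linear_scale[OF lin] sect)
  qed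
  define J where "J = (\<lambda>v. M (times_i (L v)))"
  have J: "linear J" unfolding J_def
    using linear_compose[OF linear_compose[OF lin times_i_linear] linM] by (simp add: o_def)
  have LJ: "L (J v) = times_i (L v)" for v by (simp add: J_def sect)
  have JJ: "J (J v) = - v" for v
  proof -
    have "L (J (J v)) = L (- v)" by (simp add: LJ times_i_times_i linear_neg[OF lin])
    then show ?thesis by (metis retr)
  qed
  have sp: "space_01 J = twistor_01 k H b"
  proof -
    have "J v1 = v2 \<and> J v2 = - v1 \<longleftrightarrow> L v1 + times_i (L v2) = 0" for v1 v2
    proof
      assume "J v1 = v2 \<and> J v2 = - v1"
      then have "times_i (L v2) = L (- v1)" using LJ[of v2] by simp
      then show "L v1 + times_i (L v2) = 0" by (simp add: linear_neg[OF lin])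
    next
      assume "L v1 + times_i (L v2) = 0"
      then have "L (J v2) = L (- v1)" by (simp add: LJ linear_neg[OF lin] eq_neg_iff_add_eq_0 add.commute)
      then have J2: "J v2 = - v1" by (metis retr)
      then have "J (- v1) = - v2" using JJ[of v2] by simp
      then have "J v1 = v2" by (simp add: linear_neg[OF J])
      then show "J v1 = v2 \<and> J v2 = - v1" using J2 by simp
    qed
    then show ?thesis unfolding twistor_01_eq[OF b] space_01_def L_def by simp
  qed
  have "twistor_J k H b = J"
    unfolding twistor_J_def
  proof (rule the_equality)
    show "linear J \<and> (\<forall>v. J (J v) = - v) \<and> space_01 J = twistor_01 k H b" using J JJ sp by simp
  next
    fix J' assume J': "linear J' \<and> (\<forall>v. J' (J' v) = - v) \<and> space_01 J' = twistor_01 k H b"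
    show "J' = J"
    proof (rule ext)
      fix v
      have "J' (J' v) = - v" using J' by blast
      then have "(v, J' v) \<in> space_01 J'" by (simp add: space_01_def)
      then have "(v, J' v) \<in> space_01 J" using J' sp by simp
      then show "J' v = J v" by (simp add: space_01_def)
    qed
  qed
  then show ?thesis using LJ by (simp add: L_def)
qed

lemma coordinates: "holomorphic_coordinates (twistor_J k H) (T0 H) (Xc k)"
  unfolding holomorphic_coordinates_def
proof
  fix b assume b: "b \<in> T0 H"
  obtain W where "open W" "b \<in> W" "W \<subseteq> T0 H" "inj_on (Xc k) W" "open (Xc k ` W)"
      "Xc k differentiable_on W" "inv_into W (Xc k) differentiable_on (Xc k ` W)"
    using C2_local_inverse[OF C2_Xc open_T0[OF PSR] b inj_D_Xc[OF b] dim_eq] by blast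
  moreover from this have "\<forall>p\<in>W. \<forall>v. D (Xc k) p (twistor_J k H p v) = times_i (D (Xc k) p v)"
    using twistor_J_holomorphic by blast
  ultimately show "\<exists>W. open W \<and> b \<in> W \<and> W \<subseteq> T0 H \<and> inj_on (Xc k) W \<and> open (Xc k ` W) \<and>
        Xc k differentiable_on W \<and> inv_into W (Xc k) differentiable_on (Xc k ` W) \<and>
        (\<forall>p\<in>W. \<forall>v. D (Xc k) p (twistor_J k H p v) = times_i (D (Xc k) p v))"
    by blast
qed

end

theorem proposition4p7:
  fixes k :: "'n::finite \<Rightarrow> 'n \<Rightarrow> 'n \<Rightarrow> real"
    and H :: "(real^'n) set"
    and N :: "'n qpoint set"
    and g :: "'n qpoint \<Rightarrow> 'n qpoint \<Rightarrow> 'n qpoint \<Rightarrow> real"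
  assumes "qmap_space k H N g"
  shows "bij_betw (twistor_coords k H) (twistor_space_0 H) (N \<times> (UNIV - {0})) \<and>
         holomorphic_L_section k H zw_fun \<and>
         (\<forall>P\<in>twistor_space_0 H. \<forall>v.
            let b = twistor_coords k H P in
              contact_form k H P v =
                L_scale (1 / (8 * \<i>) *
                  (D (alpha k) b v
                   + pairing (xi_tilde k b, xi k b) (D (xi_tilde k) b v, D (xi k) b v)))
                  (L_section H zw_fun P) \<and>
              contact_form k H P v =
                L_scale (1 / (8 * \<i>) *
                  (D (alpha k) b v
                   + (\<Sum>i\<in>UNIV. xi_tilde k b $ i * D (\<lambda>p. xi k p $ i) b v
                               - xi k b $ i * D (\<lambda>p. xi_tilde k p $ i) b v)))
                  (L_section H zw_fun P)) \<and>
         holomorphic_coordinates (twistor_J k H) (N \<times> (UNIV - {0}))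
           (\<lambda>b. (xi k b, xi_tilde k b, alpha k b))"
proof -
  have PSR: "PSR_manifold k H" and N: "N = {(z, \<rho>, \<zeta>t, \<zeta>, \<sigma>). z \<in> Mbar H \<and> \<rho> > 0}"
    using assms by (auto simp: qmap_space_def)
  have T0: "N \<times> (UNIV - {0}) = T0 H"
    unfolding N T0_def set_eq_iff by (simp add: case_prod_beta mem_Times_iff)
  have contact: "let b = twistor_coords k H P in
              contact_form k H P v =
                L_scale (1 / (8 * \<i>) *
                  (D (alpha k) b v
                   + pairing (xi_tilde k b, xi k b) (D (xi_tilde k) b v, D (xi k) b v)))
                  (L_section H zw_fun P) \<and>
              contact_form k H P v =
                L_scale (1 / (8 * \<i>) *
                  (D (alpha k) b v
                   + (\<Sum>i\<in>UNIV. xi_tilde k b $ i * D (\<lambda>p. xi k p $ i) b v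
                               - xi k b $ i * D (\<lambda>p. xi_tilde k p $ i) b v)))
                  (L_section H zw_fun P)" if P: "P \<in> twistor_space_0 H" for P v
  proof -
    define b where "b = twistor_coords k H P"
    have b: "b \<in> T0 H" unfolding b_def using twistor_coords_bij[OF PSR] P by (rule bij_betw_apply)
    have nth: "D (\<lambda>p. f p $ i) b v = D f b v $ i" if "C2 (T0 H) f" for f :: "'n tpoint \<Rightarrow> complex^('n option)" and i
      by (rule fun_cong[OF frechet_derivative_at[OF bounded_linear.has_derivative[OF bounded_linear_vec_nth
            C2_has_derivative[OF that b]]], of v, symmetric])
    show ?thesis
      unfolding Let_def b_def[symmetric] contact_form_value[OF PSR P b_def]
        nth[OF C2_xis(1)[OF PSR]] nth[OF C2_xis(2)[OF PSR]]
      by (simp add: pairing_def)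
  qed
  show ?thesis
    unfolding T0 using twistor_coords_bij[OF PSR] holomorphic_zw[OF PSR] contact coordinates[OF PSR] by blast
qed

end
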